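(* Let $d\ge2$, let $G_4$ be the analytic continuation to $\mathcal{D}$ of the Euclidean four-point function of identical scalar operators of dimension $\Delta$ of a unitary CFT, and let $C_L\in\mathcal{D}_L$ be a Lorentzian configuration. If the variables $z,\bar z$ of $C_L$ do not belong to $(-\infty,0)$, and furthermore $N_t(C_L)=0$, then the Lorentzian four-point function $G_4$ is analytic at $C_L$ and is given there by $$G_4(C_L)=\frac{g(\tilde\chi_t,\tilde{\bar\chi}_t)}{[x_{23}^2x_{14}^2]^\Delta},$$ where $\tilde\chi_t,\tilde{\bar\chi}_t$ are the $t$-channel variables of $C_L$ (computed along any admissible path ending at $C_L$), and $g(\tilde\chi_t,\tilde{\bar\chi}_t)$ is computed by the convergent series $g(\chi,\bar\chi)=\sum_{h,\bar h\ge0} b_{h,\bar h}e^{ih\chi+i\bar h\bar\chi}$.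
   Context: Kinematics. Points are $x_k=(\tau_k,\mathbf{x}_k)$, $\tau_k\in\mathbb{C}$, $\mathbf{x}_k\in\mathbb{R}^{d-1}$; $x_{ij}^2=(\tau_i-\tau_j)^2+(\mathbf{x}_i-\mathbf{x}_j)^2$. $\mathcal{D}$ is the set of four-point configurations with $\mathrm{Re}\,\tau_1>\mathrm{Re}\,\tau_2>\mathrm{Re}\,\tau_3>\mathrm{Re}\,\tau_4$; $\mathcal{D}_E\subset\mathcal{D}$ is the subset with all $\tau_k$ real; $\mathcal{D}_L$ is the set of Lorentzian configurations $x_k=(it_k,\mathbf{x}_k)$ ($t_k$ real) with $x_{ij}^2\ne0$ for all $i\neq j$. Cross-ratios: $u=\frac{x_{12}^2x_{34}^2}{x_{13}^2x_{24}^2}$, $v=\frac{x_{14}^2x_{23}^2}{x_{13}^2x_{24}^2}$; $z,\bar z$ are the two solutions (unordered) of $u=z\bar z$, $v=(1-z)(1-\bar z)$. $\Gamma=\{C\in\mathcal{D}: 4u-(1+u-v)^2=0\}$ (where $z=\bar z$). $\rho(z)=\frac{(1-\sqrt{1-z})^2}{z}$ maps $\mathbb{C}\setminus[1,\infty)$ bijectively to the open unit disc; $\rho=\rho(z)$, $\bar\rho=\rho(\bar z)$. Known fact (to be used as given): $z,\bar z\notin\{0\}\cup[1,\infty)$ on $\mathcal{D}$. Admissible paths. An admissible path to $C$ is a continuous $\gamma:[0,1]\to\overline{\mathcal{D}}$ with $\gamma(0)\in\mathcal{D}_E\setminus\Gamma$, $\gamma(s)\in\mathcal{D}\setminus\Gamma$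 for $s<1$, $\gamma(1)=C$. At $\gamma(0)$, $\bar z=z^*$ is non-real; label so that $\mathrm{Im}\,z>0$, and continue $z,\bar z$ continuously along $\gamma$. Define continuous $\chi,\bar\chi$ along $\gamma$ by $\rho=e^{i\chi}$, $\bar\rho=e^{i\bar\chi}$ and $0\le\mathrm{Re}\,\chi\le\pi$, $-\pi\le\mathrm{Re}\,\bar\chi\le0$ at $s=0$; $\chi(1),\bar\chi(1)$ are the values at the end. Crossing numbers. If $z,\bar z\notin(-\infty,0)$ at $\gamma(1)$, $n_t(\gamma)$ is the number of times $z$ crosses $(-\infty,0)$ from above minus the number of times it crosses from below along $\gamma$; $\bar n_t(\gamma)$ is the same for $\bar z$ (equivalently $(2n_t-1)\pi<\mathrm{Re}\,\chi(1)<(2n_t+1)\pi$ and $(2\bar n_t-1)\pi<\mathrm{Re}\,\bar\chi(1)<(2\bar n_t+1)\pi$). $N_t=n_t+\bar n_t$; it depends only on $C=\gamma(1)$ and is denoted $N_t(C)$. $t$-channel variables. Let $S=\{\chi\in\mathbb{C}:-\pi<\mathrm{Re}\,\chi<\pi,\ \mathrm{Im}\,\chi>0\}$. The map $\chi\mapsto z=\frac{4e^{i\chi}}{(1+e^{i\chi})^2}=\frac{1}{\cos^2(\chi/2)}$ is a biholomorphism from $S$ to $\mathbb{C}\setminus((-\infty,0]\cup[1,\infty))$. Conjugating $z\mapsto1-z$ by it gives a biholomorphism $\Phi:S\to S$. When $N_t=0$, put $\tilde\chi=\chi(1)-2n_t\pi$, $\tilde{\bar\chi}=\bar\chi(1)+2n_t\pi$,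 and $\tilde\chi_t=\Phi(\tilde\chi)$, $\tilde{\bar\chi}_t=\Phi(\tilde{\bar\chi})$. For configurations in $\mathcal{D}_L$ where $\tilde\chi$ or $\tilde{\bar\chi}$ is real (i.e. $z$ or $\bar z\in(1,\infty)$), $\Phi$ is understood as extended by continuity to $(-\pi,0)\cup(0,\pi)$. Standing properties of the Euclidean four-point function. $G_4^E$ is a permutation-invariant function of four pairwise distinct points of $\mathbb{R}^d$ of the form $\frac{g(u,v)}{(x_{12}^2)^{\Delta}(x_{34}^2)^{\Delta}}$ (permutation invariance gives crossing symmetry); for Euclidean configurations with $z\notin[1,\infty)$ (there $\bar\rho=\rho^*$), $g=\sum_{\delta\ge0}\sum_{l\in\mathbb{N}}c_{\delta,l}(\rho\bar\rho)^{\delta/2}P^l(\rho,\bar\rho)$, with $c_{\delta,l}\ge0$ and $P^l(\rho,\bar\rho)=\sum_{k=0}^lp^l_k(\rho/\bar\rho)^{l/2-k}$, $p^l_k=p^l_{l-k}$ (the Gegenbauer polynomial $C_l^{d/2-1}(\cos\theta)$ for $\rho=re^{i\theta},\bar\rho=re^{-i\theta}$). Equivalently $g=\sum_{h,\bar h\ge0}b_{h,\bar h}\rho^h\bar\rho^{\bar h}$ with $b_{h,\bar h}\ge0$, $h-\bar h\in\mathbb{Z}$, absolutely convergent for $0<|\rho|,|\bar\rho|<1$. One sets $g(\chi,\bar\chi)=\sum b_{h,\bar h}e^{ih\chi+i\bar h\bar\chi}$ on $\mathrm{Im}\,\chi,\mathrm{Im}\,\bar\chi>0$. It is known that $G_4^E$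 extends to a function $G_4$ on $\mathcal{D}$, analytic in the $\tau_k$ and continuous in the $\mathbf{x}_k$, equal to $g(\chi(C,\gamma),\bar\chi(C,\gamma))/[x_{12}^2x_{34}^2]^{\Delta}$ for any admissible path $\gamma$ to $C$. Powers of $x_{ij}^2$ denote the branch analytic on $\mathcal{D}$ that is positive on $\mathcal{D}_E$, extended to $\mathcal{D}_L$ by limits from $\mathcal{D}$. "$G_4$ is analytic at $C_L$" means: $G_4$ extends from $\mathcal{D}$ to a neighbourhood of $C_L$ (complex $\tau_k$, real $\mathbf{x}_k$) as a function analytic in the $\tau_k$ and continuous in the $\mathbf{x}_k$; its value at $C_L$ is $\lim_{\epsilon_k\to0,\ \epsilon_1>\epsilon_2>\epsilon_3>\epsilon_4}G_4(\epsilon_k+it_k,\mathbf{x}_k)$. *)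

theory Defs
  imports "HOL-Analysis.Analysis"
begin

(* A four-point configuration is (tau, xs): the times tau $ k and the spatial parts xs $ k in
   R^(d-1), so d = CARD('n) + 1, and d >= 2 because every type is nonempty.
   The index type 4 has the elements 1, 2, 3, 4, where 4 = 0. *)
type_synonym 'n config = "(complex, 4) vec \<times> ((real, 'n) vec, 4) vec"

definition xsq :: "4 \<Rightarrow> 4 \<Rightarrow> 'n::finite config \<Rightarrow> complex" where
  "xsq i j C = (fst C $ i - fst C $ j)\<^sup>2 + complex_of_real ((norm (snd C $ i - snd C $ j))\<^sup>2)"

definition Dom :: "'n::finite config set" where
  "Dom = {C. Re (fst C $ 1) > Re (fst C $ 2) \<and> Re (fst C $ 2) > Re (fst C $ 3) \<and>
             Re (fst C $ 3) > Re (fst C $ 4)}"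

definition Dom_E :: "'n::finite config set" where
  "Dom_E = {C \<in> Dom. \<forall>k. fst C $ k \<in> \<real>}"

definition Dom_L :: "'n::finite config set" where
  "Dom_L = {C. (\<forall>k. Re (fst C $ k) = 0) \<and> (\<forall>i j. i \<noteq> j \<longrightarrow> xsq i j C \<noteq> 0)}"

(* Four pairwise distinct points of R^d, in arbitrary order. *)
definition Euclid :: "'n::finite config set" where
  "Euclid = {C. (\<forall>k. fst C $ k \<in> \<real>) \<and>
                (\<forall>i j. i \<noteq> j \<longrightarrow> (fst C $ i, snd C $ i) \<noteq> (fst C $ j, snd C $ j))}"

definition permute_config :: "(4 \<Rightarrow> 4) \<Rightarrow> 'n::finite config \<Rightarrow> 'n config" where
  "permute_config p C = ((\<chi> k. fst C $ p k), (\<chi> k. snd C $ p k))"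

definition cr_u :: "'n::finite config \<Rightarrow> complex" where
  "cr_u C = xsq 1 2 C * xsq 3 4 C / (xsq 1 3 C * xsq 2 4 C)"

definition cr_v :: "'n::finite config \<Rightarrow> complex" where
  "cr_v C = xsq 1 4 C * xsq 2 3 C / (xsq 1 3 C * xsq 2 4 C)"

definition is_zzbar :: "'n::finite config \<Rightarrow> complex \<Rightarrow> complex \<Rightarrow> bool" where
  "is_zzbar C z zb \<longleftrightarrow> cr_u C = z * zb \<and> cr_v C = (1 - z) * (1 - zb)"

definition Gamma_set :: "'n::finite config set" where
  "Gamma_set = {C \<in> Dom. 4 * cr_u C - (1 + cr_u C - cr_v C)\<^sup>2 = 0}"

(* The principal root is the right one on the complement of [1,oo). At z = 0 the convention
   x / 0 = 0 gives rho 0 = 0, the continuous value. *)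
definition rho :: "complex \<Rightarrow> complex" where
  "rho z = (1 - csqrt (1 - z))\<^sup>2 / z"

definition neg_reals :: "complex set" where
  "neg_reals = complex_of_real ` {..<0}"

definition one_to_inf :: "complex set" where
  "one_to_inf = complex_of_real ` {1..}"

(* Complex powers of x_ij^2. For Re tau_i \<noteq> Re tau_j the number x_ij^2 never lies in (-oo,0], so on
   Dom the branch that is analytic there and positive on Dom_E is the principal one. Products such
   as x_12^2 x_34^2 may cross the principal cut: their powers are products of xpow factors. *)
definition xpow :: "real \<Rightarrow> 4 \<Rightarrow> 4 \<Rightarrow> 'n::finite config \<Rightarrow> complex" where
  "xpow \<Delta> i j C =
     (if C \<in> Dom then xsq i j C powr complex_of_real \<Delta>
      else Lim (at C within Dom) (\<lambda>C'. xsq i j C' powr complex_of_real \<Delta>))"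


definition admissible_path :: "(real \<Rightarrow> 'n::finite config) \<Rightarrow> bool" where
  "admissible_path \<gamma> \<longleftrightarrow> path \<gamma> \<and> path_image \<gamma> \<subseteq> closure Dom \<and>
     pathstart \<gamma> \<in> Dom_E - Gamma_set \<and> (\<forall>s\<in>{0..<1}. \<gamma> s \<in> Dom - Gamma_set)"

(* z, zb, chi, chib are the continuous functions of the path parameter obtained from the labelling
   at s = 0. The relation exp (i chi) = rho z is imposed for s < 1 only: if z(1) lies in (1,oo),
   the formula for rho sits on its cut and chi(1) is determined by continuity instead. *)
definition continuation ::
  "(real \<Rightarrow> 'n::finite config) \<Rightarrow> (real \<Rightarrow> complex) \<Rightarrow> (real \<Rightarrow> complex) \<Rightarrow>
   (real \<Rightarrow> complex) \<Rightarrow> (real \<Rightarrow> complex) \<Rightarrow> bool" where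
  "continuation \<gamma> z zb chi chib \<longleftrightarrow>
     continuous_on {0..1} z \<and> continuous_on {0..1} zb \<and>
     (\<forall>s\<in>{0..1}. is_zzbar (\<gamma> s) (z s) (zb s)) \<and> Im (z 0) > 0 \<and>
     continuous_on {0..1} chi \<and> continuous_on {0..1} chib \<and>
     (\<forall>s\<in>{0..<1}. rho (z s) = exp (\<i> * chi s) \<and> rho (zb s) = exp (\<i> * chib s)) \<and>
     0 \<le> Re (chi 0) \<and> Re (chi 0) \<le> pi \<and> - pi \<le> Re (chib 0) \<and> Re (chib 0) \<le> 0"

(* The net number of crossings of (-oo,0), read off from the end value w = chi(1) (or chib(1));
   for paths that are merely continuous this is what the count of crossings means. *)
definition crossings :: "complex \<Rightarrow> int" where
  "crossings w = (THE n::int. (2 * real_of_int n - 1) * pi < Re w \<and> Re w < (2 * real_of_int n + 1) * pi)"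

(* N_t(C) = N. The sum of the two crossing numbers is the same for all admissible paths to C,
   hence it may be read off from any one of them. *)
definition N_t_equals :: "'n::finite config \<Rightarrow> int \<Rightarrow> bool" where
  "N_t_equals C N \<longleftrightarrow>
     (\<exists>\<gamma> z zb chi chib. admissible_path \<gamma> \<and> pathfinish \<gamma> = C \<and> continuation \<gamma> z zb chi chib \<and>
        N = crossings (chi 1) + crossings (chib 1))"


definition S_strip :: "complex set" where
  "S_strip = {w. - pi < Re w \<and> Re w < pi \<and> Im w > 0}"

definition z_of_chi :: "complex \<Rightarrow> complex" where
  "z_of_chi w = 4 * exp (\<i> * w) / (1 + exp (\<i> * w))\<^sup>2"

definition Phi_S :: "complex \<Rightarrow> complex" where
  "Phi_S w = the_inv_into S_strip z_of_chi (1 - z_of_chi w)"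

(* Outside S_strip only arguments in (-pi,0) or (0,pi) matter. The limits there have real part
   pi or -pi, so they are not values of the_inv_into. *)
definition Phi :: "complex \<Rightarrow> complex" where
  "Phi w = (if w \<in> S_strip then Phi_S w else Lim (at w within S_strip) Phi_S)"

(* Arguments: the end values chi(1) and chib(1). In the second function the first argument is
   again chi(1): the shift is by the crossing number of chi, with opposite sign. *)
definition chi_t :: "complex \<Rightarrow> complex" where
  "chi_t w = Phi (w - 2 * of_int (crossings w) * of_real pi)"

definition chib_t :: "complex \<Rightarrow> complex \<Rightarrow> complex" where
  "chib_t w wb = Phi (wb + 2 * of_int (crossings w) * of_real pi)"


definition g_term :: "(real \<Rightarrow> real \<Rightarrow> real) \<Rightarrow> complex \<Rightarrow> complex \<Rightarrow> real \<times> real \<Rightarrow> complex" where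
  "g_term b w wb = (\<lambda>(h, hb). of_real (b h hb) * exp (\<i> * of_real h * w + \<i> * of_real hb * wb))"

definition g_series :: "(real \<Rightarrow> real \<Rightarrow> real) \<Rightarrow> complex \<Rightarrow> complex \<Rightarrow> complex" where
  "g_series b w wb = infsum (g_term b w wb) ({0..} \<times> {0..})"

(* C_l^lam (cos t) = (SUM k<=l. gegenbauer_coeff lam l k * exp (i (l - 2 k) t)) with lam = d/2 - 1.
   For d = 2 (lam = 0) the Gegenbauer polynomials vanish identically for l > 0, and as usual the
   rescaled limit, normalised here to the Chebyshev polynomial cos (l t), takes their place; the
   normalisation is irrelevant as it can be absorbed in the expansion coefficients. *)
definition gegenbauer_coeff :: "real \<Rightarrow> nat \<Rightarrow> nat \<Rightarrow> real" where
  "gegenbauer_coeff lam l k =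
     (if lam = 0 then (if l = 0 then 1 else if k = 0 \<or> k = l then 1 / 2 else 0)
      else pochhammer lam k / fact k * (pochhammer lam (l - k) / fact (l - k)))"

(* P^l(rho, rhob) for rho = r exp (i t), rhob = r exp (- i t); then (rho/rhob)^(l/2-k) stands for
   exp (i t)^(l - 2 k). The principal power of rho/rhob would have the wrong sign for odd l and
   Re rho < 0. *)
definition P_spin :: "real \<Rightarrow> nat \<Rightarrow> complex \<Rightarrow> complex" where
  "P_spin lam l r = (\<Sum>k\<le>l. of_real (gegenbauer_coeff lam l k) * sgn r powi (int l - 2 * int k))"

(* The standing properties of the Euclidean four-point function GE. In Euclidean signature the
   second cross-ratio variable is the complex conjugate of the first, and for rho = exp (i chi) the
   conjugate of rho is exp (i chib) with chib = - cnj chi. The integrality of h - hb makes the last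
   clause independent of the choice of chi. *)
definition euclidean_four_point ::
  "real \<Rightarrow> ('n::finite config \<Rightarrow> complex) \<Rightarrow> (complex \<Rightarrow> complex \<Rightarrow> complex) \<Rightarrow>
   (real \<Rightarrow> nat \<Rightarrow> real) \<Rightarrow> (real \<Rightarrow> real \<Rightarrow> real) \<Rightarrow> bool" where
  "euclidean_four_point \<Delta> GE g c b \<longleftrightarrow>
     (\<forall>C\<in>Euclid. \<forall>p. p permutes UNIV \<longrightarrow> GE (permute_config p C) = GE C) \<and>
     (\<forall>C\<in>Euclid. GE C = g (cr_u C) (cr_v C) /
        (xsq 1 2 C powr complex_of_real \<Delta> * xsq 3 4 C powr complex_of_real \<Delta>)) \<and>
     (\<forall>\<delta>\<ge>0. \<forall>l. c \<delta> l \<ge> 0) \<and>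
     (\<forall>C\<in>(Euclid :: 'n config set). \<forall>z. is_zzbar C z (cnj z) \<and> z \<notin> one_to_inf \<longrightarrow>
        ((\<lambda>(\<delta>, l). of_real (c \<delta> l) * (rho z * cnj (rho z)) powr complex_of_real (\<delta> / 2) *
             P_spin ((real CARD('n) + 1) / 2 - 1) l (rho z))
         has_sum g (cr_u C) (cr_v C)) ({0..} \<times> UNIV)) \<and>
     (\<forall>h\<ge>0. \<forall>hb\<ge>0. b h hb \<ge> 0 \<and> (b h hb \<noteq> 0 \<longrightarrow> h - hb \<in> \<int>)) \<and>
     (\<forall>r rb. 0 < r \<and> r < 1 \<and> 0 < rb \<and> rb < 1 \<longrightarrow>
        (\<lambda>(h, hb). b h hb * r powr h * rb powr hb) summable_on ({0..} \<times> {0..})) \<and>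
     (\<forall>C\<in>(Euclid :: 'n config set). \<forall>z chi. is_zzbar C z (cnj z) \<and> z \<notin> one_to_inf \<and>
        rho z = exp (\<i> * chi) \<longrightarrow> g (cr_u C) (cr_v C) = g_series b chi (- cnj chi))"

(* Analytic in the four tau variables jointly (Frechet differentiable with complex linear
   derivative) at fixed spatial points, and continuous in all variables. *)
definition tau_analytic_on :: "'n::finite config set \<Rightarrow> ('n config \<Rightarrow> complex) \<Rightarrow> bool" where
  "tau_analytic_on U F \<longleftrightarrow> continuous_on U F \<and>
     (\<forall>C\<in>U. \<exists>L. ((\<lambda>\<tau>. F (\<tau>, snd C)) has_derivative L) (at (fst C)) \<and>
        (\<forall>a w. L (a *s w) = a * L w))"

definition four_point_continuation ::
  "real \<Rightarrow> ('n::finite config \<Rightarrow> complex) \<Rightarrow> (real \<Rightarrow> real \<Rightarrow> real) \<Rightarrow> ('n config \<Rightarrow> complex) \<Rightarrow> bool" where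
  "four_point_continuation \<Delta> GE b G4 \<longleftrightarrow>
     tau_analytic_on Dom G4 \<and> (\<forall>C\<in>Dom_E. G4 C = GE C) \<and>
     (\<forall>\<gamma> z zb chi chib.
        admissible_path \<gamma> \<and> pathfinish \<gamma> \<in> Dom \<and> continuation \<gamma> z zb chi chib \<longrightarrow>
        G4 (pathfinish \<gamma>) = g_series b (chi 1) (chib 1) /
          (xpow \<Delta> 1 2 (pathfinish \<gamma>) * xpow \<Delta> 3 4 (pathfinish \<gamma>)))"

definition analytic_at_config :: "('n::finite config \<Rightarrow> complex) \<Rightarrow> 'n config \<Rightarrow> bool" where
  "analytic_at_config G4 C \<longleftrightarrow>
     (\<exists>U F. open U \<and> C \<in> U \<and> tau_analytic_on U F \<and> (\<forall>C'\<in>U \<inter> Dom. F C' = G4 C'))"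

(* Val is the value at a Lorentzian C: the limit of G4 (eps_k + i t_k, x_k). *)
definition lorentzian_value :: "('n::finite config \<Rightarrow> complex) \<Rightarrow> 'n config \<Rightarrow> complex \<Rightarrow> bool" where
  "lorentzian_value G4 C Val \<longleftrightarrow>
     ((\<lambda>\<epsilon>::real^4. G4 ((\<chi> k. complex_of_real (\<epsilon> $ k) + fst C $ k), snd C)) \<longlongrightarrow> Val)
       (at 0 within {\<epsilon>. \<epsilon> $ 1 > \<epsilon> $ 2 \<and> \<epsilon> $ 2 > \<epsilon> $ 3 \<and> \<epsilon> $ 3 > \<epsilon> $ 4})"

end

theory Submission
  imports Defs "HOL-Complex_Analysis.Conformal_Mappings"
begin

text \<open>
  Write \<open>q = exp (\<i> \<chi> / 2)\<close>, so that \<open>\<rho> = q\<^sup>2\<close>. Then \<open>1 - z\<close> has the coordinate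
  \<open>\<rho>\<^sub>t = ((1 - q) / (1 + q))\<^sup>2 = (1 - sqrt z) / (1 + sqrt z)\<close>. Exchanging the points 1 and 3 in a Euclidean
  configuration gives the crossing relation on the totally real slice \<open>\<chi>b = - cnj \<chi>\<close>, hence on
  \<open>S \<times> S\<close> by the identity theorem. Its prefactor is the power of \<open>z zb / ((1 - z) (1 - zb))\<close> obtained from
  the logarithm \<open>log 4 + \<i> \<chi> - 2 log (1 - exp (\<i> \<chi>))\<close>, which grows by \<open>2 \<pi> \<i>\<close> under
  \<open>\<chi> \<mapsto> \<chi> + 2 \<pi>\<close>. Along a path the sum of these logarithms for \<open>\<chi>\<close> and \<open>\<chi>b\<close> is the sum of principal
  logarithms of the \<open>x\<^sub>i\<^sub>j\<^sup>2\<close>. This shows that the sum of the crossing numbers is locally constant, and that the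
  crossing relation exchanges the two prefactors exactly when this sum is zero. The resulting series converges near a
  Lorentzian configuration because \<open>\<bar>\<rho>\<^sub>t\<bar> < 1\<close> off the negative axis; since it is symmetric in \<open>z\<close> and \<open>zb\<close>
  it can be expanded in \<open>\<rho>\<^sub>t + \<rho>b\<^sub>t\<close> and \<open>\<rho>\<^sub>t \<rho>b\<^sub>t\<close>, which are analytic also where \<open>z = zb\<close>.

  That \<open>z\<close> avoids \<open>[1,\<infinity>)\<close> on the domain is proved by representing configurations by \<open>2 \<times> 2\<close> matrices,
  for which inverses of matrices with Hermitian part below a negative constant form a convex set.
\<close>

subsection \<open>Cross-ratios on the domain\<close>

text \<open>The given series for \<open>G4\<close> breaks down at the boundary: for z in (1,oo) the
  coordinate rho reaches the unit circle, whereas \<open>rho_t\<close> does so only on the negative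
  axis. At the end of one path the t-channel formula is a computation; the obstacle is that
  analyticity at \<open>C\<close> needs it, with one choice of branches, at every point of
  \<open>Dom\<close> near \<open>C\<close>, while the series is only given at ends of admissible
  paths. Hence three facts: \<open>Dom - Gamma_set\<close> is path connected, so each of its points
  is reached from the same Euclidean start; it is dense in \<open>Dom\<close>, so continuity fills
  in the rest; and the sum of crossing numbers is a function of the configuration
  (\<open>cross_defect\<close>), so that paths to neighbouring points have sum 0 as well, whatever
  their shape. At \<open>C\<close>, which lies outside \<open>Dom\<close>, principal logarithms may
  jump; branches near \<open>C\<close> are therefore written as principal logarithms of ratios to
  the value at \<open>C\<close> plus constants, and the constants are identified by limits from
  \<open>Dom\<close>. The summand log 4 comes from z / (1 - z) = 4 rho / (1 - rho)^2.\<close>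

lemma xsq_sym: "xsq i j C = xsq j i C"
  by (simp add: xsq_def norm_minus_commute power2_commute)

lemma square_plus_real_nonneg_notin_nonpos_Reals:
  assumes "Re s \<noteq> 0" "r \<ge> 0"
  shows "s\<^sup>2 + complex_of_real r \<notin> \<real>\<^sub>\<le>\<^sub>0"
proof
  assume "s\<^sup>2 + complex_of_real r \<in> \<real>\<^sub>\<le>\<^sub>0"
  then have *: "Re (s\<^sup>2 + complex_of_real r) \<le> 0" "Im (s\<^sup>2 + complex_of_real r) = 0"
    by (auto simp: complex_nonpos_Reals_iff)
  from *(2) assms(1) have "Im s = 0"
    by (simp add: power2_eq_square)
  with *(1) have "(Re s)\<^sup>2 + r \<le> 0" by (simp add: power2_eq_square)
  with assms show False
    by (smt (verit) zero_less_power2)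
qed

lemma xsq_notin_nonpos_Reals:
  assumes "Re (fst C $ i) \<noteq> Re (fst C $ j)"
  shows "xsq i j C \<notin> \<real>\<^sub>\<le>\<^sub>0"
  unfolding xsq_def by (rule square_plus_real_nonneg_notin_nonpos_Reals) (use assms in auto)

lemma xsq_Dom_notin_nonpos_Reals:
  assumes "C \<in> Dom" "i \<noteq> j"
  shows "xsq i j C \<notin> \<real>\<^sub>\<le>\<^sub>0"
proof (rule xsq_notin_nonpos_Reals)
  show "Re (fst C $ i) \<noteq> Re (fst C $ j)"
    using assms exhaust_4[of i] exhaust_4[of j] unfolding Dom_def by auto
qed

lemma xsq_Dom_nonzero: "C \<in> Dom \<Longrightarrow> i \<noteq> j \<Longrightarrow> xsq i j C \<noteq> 0"
  using xsq_Dom_notin_nonpos_Reals[of C i j] by (auto simp: complex_nonpos_Reals_iff)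

section \<open>Matrix proof that z avoids [1,oo) on the domain\<close>

lemma singular_2x2_kernel:
  fixes a b c d :: complex
  assumes "a * d - b * c = 0"
  obtains x y where "a * x + b * y = 0" "c * x + d * y = 0" "x \<noteq> 0 \<or> y \<noteq> 0"
proof (cases "a = 0 \<and> b = 0")
  case True
  show ?thesis
  proof (cases "c = 0 \<and> d = 0")
    case True with \<open>a = 0 \<and> b = 0\<close> show ?thesis by (intro that[of 1 0]) auto
  next
    case False with True show ?thesis by (intro that[of d "-c"]) auto
  qed
next
  case False
  with assms show ?thesis by (intro that[of b "-a"]) (auto simp: algebra_simps)
qed

lemma norm_square_convex_combination:
  fixes x y :: complex
  assumes "0 \<le> t" "t \<le> 1"
  shows "(cmod (of_real (1 - t) * x + of_real t * y))\<^sup>2 \<le> (1 - t) * (cmod x)\<^sup>2 + t * (cmod y)\<^sup>2"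
proof -
  have "(1 - t) * (cmod x)\<^sup>2 + t * (cmod y)\<^sup>2 - (cmod (of_real (1 - t) * x + of_real t * y))\<^sup>2
        = t * (1 - t) * (cmod (x - y))\<^sup>2"
    unfolding cmod_power2 by (simp add: power2_eq_square algebra_simps)
  with assms show ?thesis
    by (smt (verit, best) mult_nonneg_nonneg zero_le_power2)
qed

text \<open>The matrix is s + i p.\<sigma> with p = (a,b,c); i p.\<sigma> is anti-Hermitian and
  drops out of the real part, and so does Im s.\<close>

lemma Re_pauli_form:
  fixes s y1 y2 :: complex and a b c :: real
  shows "Re (cnj y1 * ((s + \<i> * c) * y1 + (\<i> * a + b) * y2)
           + cnj y2 * ((\<i> * a - b) * y1 + (s - \<i> * c) * y2))
         = Re s * ((cmod y1)\<^sup>2 + (cmod y2)\<^sup>2)"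
  unfolding cmod_power2 by (simp add: power2_eq_square algebra_simps)

text \<open>The vectors are encoded by the matrices \<open>s + \<i> p \<cdot> \<sigma>\<close> with the Pauli matrices \<open>\<sigma>\<close>. Their
  determinants are the squares \<open>s\<^sup>2 + p\<^sup>2\<close>, and their Hermitian parts are \<open>Re s\<close>. If the two sides agreed,
  \<open>M\<^sub>1 ((1 - t) M\<^sub>3\<^sup>-\<^sup>1 + t M\<^sub>4\<^sup>-\<^sup>1)\<close> would fix a nonzero vector.\<close>
lemma pauli_separation:
  fixes s1 s3 s4 :: complex and a1 b1 c1 a3 b3 c3 a4 b4 c4 t m :: real
  defines "q1 \<equiv> s1\<^sup>2 + of_real (a1\<^sup>2 + b1\<^sup>2 + c1\<^sup>2)"
    and "q3 \<equiv> s3\<^sup>2 + of_real (a3\<^sup>2 + b3\<^sup>2 + c3\<^sup>2)"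
    and "q4 \<equiv> s4\<^sup>2 + of_real (a4\<^sup>2 + b4\<^sup>2 + c4\<^sup>2)"
    and "q13 \<equiv> (s1 - s3)\<^sup>2 + of_real ((a1 - a3)\<^sup>2 + (b1 - b3)\<^sup>2 + (c1 - c3)\<^sup>2)"
    and "q14 \<equiv> (s1 - s4)\<^sup>2 + of_real ((a1 - a4)\<^sup>2 + (b1 - b4)\<^sup>2 + (c1 - c4)\<^sup>2)"
    and "q34 \<equiv> (s3 - s4)\<^sup>2 + of_real ((a3 - a4)\<^sup>2 + (b3 - b4)\<^sup>2 + (c3 - c4)\<^sup>2)"
  assumes t: "0 < t" "t < 1" and m: "Re s3 \<le> m" "Re s4 \<le> m" "m < 0" "m < Re s1"
  shows "of_real t * of_real (1 - t) * q1 * q34 \<noteq> of_real (1 - t) * q13 * q4 + of_real t * q14 * q3"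
proof
  assume eq: "of_real t * of_real (1 - t) * q1 * q34 = of_real (1 - t) * q13 * q4 + of_real t * q14 * q3"
  have nz: "q3 \<noteq> 0" "q4 \<noteq> 0"
    using square_plus_real_nonneg_notin_nonpos_Reals[of s3 "a3\<^sup>2 + b3\<^sup>2 + c3\<^sup>2"]
      square_plus_real_nonneg_notin_nonpos_Reals[of s4 "a4\<^sup>2 + b4\<^sup>2 + c4\<^sup>2"] m
    unfolding q3_def q4_def by force+
  define T where "T = complex_of_real t"
  define r3 where "r3 = 1 / q3"
  define r4 where "r4 = 1 / q4"
  have r: "r3 * q3 = 1" "r4 * q4 = 1" using nz by (auto simp: r3_def r4_def)
  let ?a1 = "complex_of_real a1" and ?b1 = "complex_of_real b1" and ?c1 = "complex_of_real c1"
  let ?a3 = "complex_of_real a3" and ?b3 = "complex_of_real b3" and ?c3 = "complex_of_real c3"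
  let ?a4 = "complex_of_real a4" and ?b4 = "complex_of_real b4" and ?c4 = "complex_of_real c4"
  \<comment> \<open>n = (1 - t) M3^-1 + t M4^-1, each inverse being the adjugate times
    \<open>r3\<close> or \<open>r4\<close>; below, k = M1 n.\<close>
  define n11 where "n11 = (1 - T) * r3 * (s3 - \<i> * ?c3) + T * r4 * (s4 - \<i> * ?c4)"
  define n12 where "n12 = - ((1 - T) * r3 * (\<i> * ?a3 + ?b3) + T * r4 * (\<i> * ?a4 + ?b4))"
  define n21 where "n21 = - ((1 - T) * r3 * (\<i> * ?a3 - ?b3) + T * r4 * (\<i> * ?a4 - ?b4))"
  define n22 where "n22 = (1 - T) * r3 * (s3 + \<i> * ?c3) + T * r4 * (s4 + \<i> * ?c4)"
  define k11 where "k11 = (s1 + \<i> * ?c1) * n11 + (\<i> * ?a1 + ?b1) * n21"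
  define k12 where "k12 = (s1 + \<i> * ?c1) * n12 + (\<i> * ?a1 + ?b1) * n22"
  define k21 where "k21 = (\<i> * ?a1 - ?b1) * n11 + (s1 - \<i> * ?c1) * n21"
  define k22 where "k22 = (\<i> * ?a1 - ?b1) * n12 + (s1 - \<i> * ?c1) * n22"
  have detM: "k11 * k22 - k12 * k21 = q1 * (n11 * n22 - n12 * n21)"
  proof -
    have q1: "q1 = (s1 + \<i> * ?c1) * (s1 - \<i> * ?c1) - (\<i> * ?a1 + ?b1) * (\<i> * ?a1 - ?b1)"
      unfolding q1_def by (simp add: power2_eq_square algebra_simps)
    show ?thesis unfolding q1 k11_def k12_def k21_def k22_def by algebra
  qed
  have detN: "n11 * n22 - n12 * n21
      = (1 - T)\<^sup>2 * r3\<^sup>2 * q3 + T\<^sup>2 * r4\<^sup>2 * q4 + T * (1 - T) * r3 * r4 * (q3 + q4 - q34)"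
    unfolding n11_def n12_def n21_def n22_def q3_def q4_def q34_def
    by (simp add: power2_eq_square algebra_simps)
  have tr: "k11 + k22 = (1 - T) * r3 * (q1 + q3 - q13) + T * r4 * (q1 + q4 - q14)"
    unfolding k11_def k22_def n11_def n12_def n21_def n22_def q1_def q3_def q4_def q13_def q14_def
    by (simp add: power2_eq_square algebra_simps)
  have eq': "T * (1 - T) * q1 * q34 = (1 - T) * q13 * q4 + T * q14 * q3"
    using eq by (simp add: T_def)
  \<comment> \<open>det (k - 1) = det k - tr k + 1; multiplied by q3 q4 it is the difference of the
    two sides of \<open>eq\<close>, so k has the eigenvalue 1.\<close>
  have "(k11 - 1) * (k22 - 1) - k12 * k21 = (k11 * k22 - k12 * k21) - (k11 + k22) + 1"
    by (simp add: algebra_simps)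
  also have "\<dots> = 0"
    unfolding detM detN tr using r eq' by algebra
  finally obtain w1 w2 where w: "(k11 - 1) * w1 + k12 * w2 = 0" "k21 * w1 + (k22 - 1) * w2 = 0"
      "w1 \<noteq> 0 \<or> w2 \<noteq> 0"
    by (rule singular_2x2_kernel)
  \<comment> \<open>y = M3^-1 w and z = M4^-1 w, so v = n w is their convex combination and M1 v =
    w.\<close>
  define y1 where "y1 = r3 * ((s3 - \<i> * ?c3) * w1 - (\<i> * ?a3 + ?b3) * w2)"
  define y2 where "y2 = r3 * ((s3 + \<i> * ?c3) * w2 - (\<i> * ?a3 - ?b3) * w1)"
  define z1 where "z1 = r4 * ((s4 - \<i> * ?c4) * w1 - (\<i> * ?a4 + ?b4) * w2)"
  define z2 where "z2 = r4 * ((s4 + \<i> * ?c4) * w2 - (\<i> * ?a4 - ?b4) * w1)"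
  define v1 where "v1 = of_real (1 - t) * y1 + of_real t * z1"
  define v2 where "v2 = of_real (1 - t) * y2 + of_real t * z2"
  have v: "v1 = n11 * w1 + n12 * w2" "v2 = n21 * w1 + n22 * w2"
    unfolding v1_def v2_def y1_def y2_def z1_def z2_def n11_def n12_def n21_def n22_def T_def
    by (simp_all add: algebra_simps)
  have "w1 = (s1 + \<i> * ?c1) * v1 + (\<i> * ?a1 + ?b1) * v2"
       "w2 = (\<i> * ?a1 - ?b1) * v1 + (s1 - \<i> * ?c1) * v2"
    using w(1,2) unfolding v k11_def k12_def k21_def k22_def by (simp_all add: algebra_simps)
  note M1 = this
  have q3': "q3 = (s3 + \<i> * ?c3) * (s3 - \<i> * ?c3) - (\<i> * ?a3 + ?b3) * (\<i> * ?a3 - ?b3)"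
    unfolding q3_def by (simp add: power2_eq_square algebra_simps)
  have q4': "q4 = (s4 + \<i> * ?c4) * (s4 - \<i> * ?c4) - (\<i> * ?a4 + ?b4) * (\<i> * ?a4 - ?b4)"
    unfolding q4_def by (simp add: power2_eq_square algebra_simps)
  have M3: "w1 = (s3 + \<i> * ?c3) * y1 + (\<i> * ?a3 + ?b3) * y2"
       "w2 = (\<i> * ?a3 - ?b3) * y1 + (s3 - \<i> * ?c3) * y2"
    using r(1) unfolding y1_def y2_def q3' by algebra+
  have M4: "w1 = (s4 + \<i> * ?c4) * z1 + (\<i> * ?a4 + ?b4) * z2"
       "w2 = (\<i> * ?a4 - ?b4) * z1 + (s4 - \<i> * ?c4) * z2"
    using r(2) unfolding z1_def z2_def q4' by algebra+
  have e1: "Re (cnj v1 * w1 + cnj v2 * w2) = Re s1 * ((cmod v1)\<^sup>2 + (cmod v2)\<^sup>2)"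
    by (subst (1) M1(1), subst (1) M1(2)) (rule Re_pauli_form)
  have e3: "Re (cnj y1 * w1 + cnj y2 * w2) = Re s3 * ((cmod y1)\<^sup>2 + (cmod y2)\<^sup>2)"
    by (subst (1) M3(1), subst (1) M3(2)) (rule Re_pauli_form)
  have e4: "Re (cnj z1 * w1 + cnj z2 * w2) = Re s4 * ((cmod z1)\<^sup>2 + (cmod z2)\<^sup>2)"
    by (subst (1) M4(1), subst (1) M4(2)) (rule Re_pauli_form)
  have "Re (cnj v1 * w1 + cnj v2 * w2)
      = (1 - t) * Re (cnj y1 * w1 + cnj y2 * w2) + t * Re (cnj z1 * w1 + cnj z2 * w2)"
    unfolding v1_def v2_def by (simp add: algebra_simps)
  also have "\<dots> \<le> (1 - t) * (m * ((cmod y1)\<^sup>2 + (cmod y2)\<^sup>2)) + t * (m * ((cmod z1)\<^sup>2 + (cmod z2)\<^sup>2))"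
    unfolding e3 e4 using t m by (intro add_mono mult_left_mono mult_right_mono) auto
  also have "\<dots> = m * (((1 - t) * (cmod y1)\<^sup>2 + t * (cmod z1)\<^sup>2) + ((1 - t) * (cmod y2)\<^sup>2 + t * (cmod z2)\<^sup>2))"
    by (simp add: algebra_simps)
  \<comment> \<open>Convexity of the squared norm bounds that of v from above; the factor m is
    negative, which turns the inequality the useful way.\<close>
  also have "\<dots> \<le> m * ((cmod v1)\<^sup>2 + (cmod v2)\<^sup>2)"
    unfolding v1_def v2_def using t m norm_square_convex_combination[of t]
    by (intro mult_left_mono_neg add_mono) auto
  finally have "(Re s1 - m) * ((cmod v1)\<^sup>2 + (cmod v2)\<^sup>2) \<le> 0"
    unfolding e1 by (simp add: algebra_simps)
  then have "(cmod v1)\<^sup>2 + (cmod v2)\<^sup>2 \<le> 0"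
    using m(4) by (simp add: mult_le_0_iff)
  then have "v1 = 0" "v2 = 0"
    by (smt (verit) zero_le_power2 norm_eq_zero power_eq_0_iff)+
  with M1 w(3) show False by simp
qed

text \<open>Only separations of four points enter, and relative to one point these are three
  vectors: their span fits isometrically into R^3, where the Pauli matrices apply, whatever the
  spatial dimension.\<close>

lemma isometry_three_vectors:
  fixes p1 p3 p4 :: "'a::euclidean_space"
  obtains f :: "'a \<Rightarrow> real^3" where "linear f"
    "\<And>x. x \<in> span {p1, p3, p4} \<Longrightarrow> norm (f x) = norm x"
proof -
  have "dim (span {p1, p3, p4}) \<le> card {p1, p3, p4}"
    by (simp add: dim_le_card')
  also have "\<dots> \<le> 3"
    by (simp add: card_insert_if)
  finally have "dim (span {p1, p3, p4}) \<le> dim (UNIV :: (real^3) set)"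
    by simp
  then show ?thesis
    using isometry_subset_subspace[of "span {p1, p3, p4}" "UNIV :: (real^3) set"] that
    by (metis subspace_span subspace_UNIV)
qed

text \<open>With point 2 as origin the time ordering gives Re s1 > 0 > Re s3, Re s4, the hypothesis
  of \<open>pauli_separation\<close> with m the larger of the last two.\<close>

lemma cross_ratio_separation:
  fixes C :: "'n::finite config"
  assumes "C \<in> Dom" "0 < t" "t < 1"
  shows "of_real t * of_real (1 - t) * xsq 1 2 C * xsq 3 4 C
      \<noteq> of_real (1 - t) * xsq 1 3 C * xsq 2 4 C + of_real t * xsq 1 4 C * xsq 2 3 C"
proof -
  define s where "s k = fst C $ k - fst C $ 2" for k
  define p where "p k = snd C $ k - snd C $ 2" for k
  obtain f :: "real^'n \<Rightarrow> real^3" where f: "linear f"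
    "\<And>x. x \<in> span {p 1, p 3, p 4} \<Longrightarrow> norm (f x) = norm x"
    using isometry_three_vectors[of "p 1" "p 3" "p 4"] by blast
  have sp: "p 1 \<in> span {p 1, p 3, p 4}" "p 3 \<in> span {p 1, p 3, p 4}" "p 4 \<in> span {p 1, p 3, p 4}"
    by (simp_all add: span_base)
  have norm3: "(norm y)\<^sup>2 = (y$1)\<^sup>2 + (y$2)\<^sup>2 + (y$3)\<^sup>2" for y :: "real^3"
    unfolding power2_norm_eq_inner by (simp add: inner_vec_def sum_3 power2_eq_square)
  have n1: "(norm (p k))\<^sup>2 = (f (p k) $ 1)\<^sup>2 + (f (p k) $ 2)\<^sup>2 + (f (p k) $ 3)\<^sup>2"
    if "k = 1 \<or> k = 3 \<or> k = 4" for k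
    using that f(2)[of "p k"] sp norm3[of "f (p k)"] by metis
  have n2: "(norm (p j - p k))\<^sup>2 = (f (p j) $ 1 - f (p k) $ 1)\<^sup>2 + (f (p j) $ 2 - f (p k) $ 2)\<^sup>2
      + (f (p j) $ 3 - f (p k) $ 3)\<^sup>2"
    if "j = 1 \<or> j = 3 \<or> j = 4" "k = 1 \<or> k = 3 \<or> k = 4" for j k
  proof -
    have "p j - p k \<in> span {p 1, p 3, p 4}"
      using that sp by (metis span_diff)
    then have "(norm (p j - p k))\<^sup>2 = (norm (f (p j) - f (p k)))\<^sup>2"
      using f by (metis linear_diff)
    then show ?thesis by (simp add: norm3)
  qed
  have x12: "xsq 1 2 C = (s 1)\<^sup>2 + of_real ((norm (p 1))\<^sup>2)"
    by (simp add: xsq_def s_def p_def)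
  have x23: "xsq 2 3 C = (s 3)\<^sup>2 + of_real ((norm (p 3))\<^sup>2)"
    by (subst xsq_sym) (simp add: xsq_def s_def p_def)
  have x24: "xsq 2 4 C = (s 4)\<^sup>2 + of_real ((norm (p 4))\<^sup>2)"
    by (subst xsq_sym) (simp add: xsq_def s_def p_def)
  have xx: "xsq j k C = (s j - s k)\<^sup>2 + of_real ((norm (p j - p k))\<^sup>2)" for j k
    by (simp add: xsq_def s_def p_def)
  define m where "m = max (Re (s 3)) (Re (s 4))"
  have m: "Re (s 3) \<le> m" "Re (s 4) \<le> m" "m < 0" "m < Re (s 1)"
    using assms(1) by (auto simp: Dom_def m_def s_def)
  show ?thesis
    unfolding x12 x23 x24 xx[of 1 3] xx[of 1 4] xx[of 3 4] n1[of 1, simplified] n1[of 3, simplified]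
      n1[of 4, simplified] n2[of 1 3, simplified] n2[of 1 4, simplified] n2[of 3 4, simplified]
    by (rule pauli_separation[OF assms(2,3) m])
qed

text \<open>Elimination of \<open>zb\<close> with denominators cleared. Divided by z^2 it becomes
  the relation excluded by \<open>cross_ratio_separation\<close>, with t = 1 / z.\<close>

lemma zzbar_root:
  assumes "is_zzbar C z zb" "xsq 1 3 C \<noteq> 0" "xsq 2 4 C \<noteq> 0"
  shows "xsq 1 3 C * xsq 2 4 C * z * (z - 1) + xsq 1 4 C * xsq 2 3 C * z - xsq 1 2 C * xsq 3 4 C * (z - 1) = 0"
proof -
  have "xsq 1 2 C * xsq 3 4 C = xsq 1 3 C * xsq 2 4 C * (z * zb)"
       "xsq 1 4 C * xsq 2 3 C = xsq 1 3 C * xsq 2 4 C * ((1 - z) * (1 - zb))"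
    using assms by (auto simp: is_zzbar_def cr_u_def cr_v_def divide_simps)
  then show ?thesis by algebra
qed

lemma is_zzbar_commute: "is_zzbar C z zb \<longleftrightarrow> is_zzbar C zb z"
  by (simp add: is_zzbar_def mult.commute)

lemma Dom_zzbar:
  assumes "C \<in> Dom" "is_zzbar C z zb"
  shows "z \<notin> one_to_inf" "z \<noteq> 0" "z \<noteq> 1"
proof -
  note nz = xsq_Dom_nonzero[OF assms(1)]
  note root = zzbar_root[OF assms(2)]
  show z: "z \<noteq> 0" "z \<noteq> 1"
    using assms(2) nz by (auto simp: is_zzbar_def cr_u_def cr_v_def)
  show "z \<notin> one_to_inf"
  proof
    assume "z \<in> one_to_inf"
    then obtain r where r: "z = complex_of_real r" "r \<ge> 1" by (auto simp: one_to_inf_def)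
    with z have "r > 1" by (metis le_less of_real_1)
    define t where "t = 1 / r"
    have t: "0 < t" "t < 1" using \<open>r > 1\<close> by (auto simp: t_def)
    have zt: "z * of_real t = 1" using \<open>r > 1\<close> by (simp add: t_def r)
    define T where "T = complex_of_real t"
    have "xsq 1 3 C * xsq 2 4 C * z * (z - 1) + xsq 1 4 C * xsq 2 3 C * z
        - xsq 1 2 C * xsq 3 4 C * (z - 1) = 0"
      using root nz by simp
    moreover have "z * T = 1" using zt by (simp add: T_def)
    ultimately have "T * (1 - T) * xsq 1 2 C * xsq 3 4 C
        = (1 - T) * xsq 1 3 C * xsq 2 4 C + T * xsq 1 4 C * xsq 2 3 C"
      by algebra
    then show False
      using cross_ratio_separation[OF assms(1) t] by (simp add: T_def)
  qed
qed

subsection \<open>Connectedness off the locus where the cross-ratio variables coincide\<close>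

lemma continuous_on_xsq [continuous_intros]:
  "continuous_on A (\<lambda>C. xsq i j (C :: 'n::finite config))"
  unfolding xsq_def by (intro continuous_intros)

text \<open>The equation of \<open>Gamma_set\<close> cleared of denominators: a polynomial in the
  times, symmetric in the three products x12^2 x34^2, x13^2 x24^2, x14^2 x23^2.\<close>

definition disc :: "'n::finite config \<Rightarrow> complex" where
  "disc C = 4 * (xsq 1 2 C * xsq 3 4 C) * (xsq 1 3 C * xsq 2 4 C)
     - (xsq 1 3 C * xsq 2 4 C + xsq 1 2 C * xsq 3 4 C - xsq 1 4 C * xsq 2 3 C)\<^sup>2"

lemma disc_eq:
  assumes "xsq 1 3 C \<noteq> 0" "xsq 2 4 C \<noteq> 0"
  shows "4 * cr_u C - (1 + cr_u C - cr_v C)\<^sup>2 = disc C / (xsq 1 3 C * xsq 2 4 C)\<^sup>2"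
  using assms by (simp add: disc_def cr_u_def cr_v_def field_simps power2_eq_square)

lemma Gamma_set_eq: "Gamma_set = {C \<in> (Dom :: 'n::finite config set). disc C = 0}"
proof -
  have "4 * cr_u C - (1 + cr_u C - cr_v C)\<^sup>2 = 0 \<longleftrightarrow> disc C = 0" if "C \<in> Dom" for C :: "'n config"
    using that by (subst disc_eq) (auto simp: xsq_Dom_nonzero)
  then show ?thesis unfolding Gamma_set_def by blast
qed

lemma continuous_on_disc [continuous_intros]:
  "continuous_on A (\<lambda>C. disc (C :: 'n::finite config))"
  unfolding disc_def by (intro continuous_intros)

lemma open_Dom: "open (Dom :: 'n::finite config set)"
  unfolding Dom_def by (intro open_Collect_conj open_Collect_less continuous_intros)

lemma open_Dom_minus_Gamma: "open (Dom - Gamma_set :: 'n::finite config set)"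
proof -
  have "Dom - Gamma_set = (Dom :: 'n config set) \<inter> {C. disc C \<noteq> 0}"
    by (auto simp: Gamma_set_eq)
  moreover have "open {C :: 'n config. disc C \<noteq> 0}"
    by (intro open_Collect_neq continuous_intros)
  ultimately show ?thesis by (metis open_Dom open_Int)
qed

lemma convex_Dom: "convex (Dom :: 'n::finite config set)"
proof -
  have lt: "u * a + v * b < u * a' + v * b'"
    if "a < a'" "b < b'" "0 \<le> u" "0 \<le> v" "u + v = 1" for a a' b b' u v :: real
    using that by (smt (verit) mult_left_mono mult_strict_left_mono)
  show ?thesis
    unfolding convex_def Dom_def by (auto simp: intro!: lt)
qed

text \<open>The three products are then squares of products of time differences, linked by t12 t34 -
  t13 t24 + t14 t23 = 0, which makes the form vanish. Such spatial quadruples have an empty fibre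
  off the locus and are left out of the base of the fibration.\<close>

lemma disc_all_equal:
  assumes "\<And>i j. snd C $ i = snd C $ j"
  shows "disc C = 0"
proof -
  have "xsq i j C = (fst C $ i - fst C $ j)\<^sup>2" for i j
    unfolding xsq_def using assms[of i j] by simp
  note X = this
  show ?thesis unfolding disc_def X by algebra
qed

lemma continuous_on_vector_smult [continuous_intros]:
  fixes f :: "'b::topological_space \<Rightarrow> complex" and g :: "'b \<Rightarrow> complex ^ 'n"
  assumes "continuous_on A f" "continuous_on A g"
  shows "continuous_on A (\<lambda>x. f x *s g x)"
  unfolding vector_scalar_mult_def by (intro continuous_intros assms)

text \<open>A nonzero polynomial in one variable has finitely many roots: this is how complex lines
  avoid the locus \<open>disc = 0\<close>.\<close>

lemma disc_line_poly:
  fixes a b :: "complex^4" and x :: "(real^'n::finite)^4"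
  obtains P where "\<And>\<zeta>. disc (a + \<zeta> *s b, x) = poly P \<zeta>"
proof -
  define X where "X i j = [:a $ i - a $ j, b $ i - b $ j:]\<^sup>2 + [:of_real ((norm (x $ i - x $ j))\<^sup>2):]"
    for i j
  have X: "xsq i j (a + \<zeta> *s b, x) = poly (X i j) \<zeta>" for i j \<zeta>
    by (simp add: xsq_def X_def algebra_simps)
  show ?thesis
    by (rule that[of "4 * (X 1 2 * X 3 4) * (X 1 3 * X 2 4) - (X 1 3 * X 2 4 + X 1 2 * X 3 4 - X 1 4 * X 2 3)\<^sup>2"])
      (simp add: disc_def X)
qed

text \<open>The form 4 p q - (p + q - r)^2 is symmetric in p, q, r, so any labelling of the points
  may be used to evaluate it.\<close>

lemma disc_permute:
  fixes C :: "'n::finite config"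
  assumes "distinct [i, j, k, l]"
  shows "disc C = 4 * (xsq i j C * xsq k l C) * (xsq i k C * xsq j l C)
     - (xsq i k C * xsq j l C + xsq i j C * xsq k l C - xsq i l C * xsq j k C)\<^sup>2"
proof -
  define D where "D p q r = 4 * p * q - (q + p - r)\<^sup>2" for p q r :: complex
  have D1: "D p q r = D q p r" for p q r by (simp add: D_def add.commute mult.commute)
  have D2: "D p q r = D p r q" for p q r by (simp add: D_def power2_eq_square algebra_simps)
  note s = xsq_sym[of 2 1] xsq_sym[of 3 1] xsq_sym[of 4 1] xsq_sym[of 3 2] xsq_sym[of 4 2] xsq_sym[of 4 3]
  have l: "l = 1 \<or> l = 2 \<or> l = 3 \<or> l = 4" and k: "k = 1 \<or> k = 2 \<or> k = 3 \<or> k = 4"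
    and j: "j = 1 \<or> j = 2 \<or> j = 3 \<or> j = 4" and i: "i = 1 \<or> i = 2 \<or> i = 3 \<or> i = 4"
    using exhaust_4 by blast+
  have "D (xsq 1 2 C * xsq 3 4 C) (xsq 1 3 C * xsq 2 4 C) (xsq 1 4 C * xsq 2 3 C)
      = D (xsq i j C * xsq k l C) (xsq i k C * xsq j l C) (xsq i l C * xsq j k C)"
    using i assms
    apply (elim disjE)
    subgoal using j by (elim disjE; simp; use k l in \<open>elim disjE; simp add: s mult.commute D1 D2\<close>)
    subgoal using j by (elim disjE; simp; use k l in \<open>elim disjE; simp add: s mult.commute D1 D2\<close>)
    subgoal using j by (elim disjE; simp; use k l in \<open>elim disjE; simp add: s mult.commute D1 D2\<close>)
    subgoal using j by (elim disjE; simp; use k l in \<open>elim disjE; simp add: s mult.commute D1 D2\<close>)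
    done
  then show ?thesis by (simp add: disc_def D_def)
qed

lemma ex_4_distinct: "\<exists>l::4. l \<noteq> i \<and> l \<noteq> j \<and> l \<noteq> k"
proof -
  have "card {i, j, k} < card (UNIV :: 4 set)"
    by (simp add: card_insert_if)
  then have "{i, j, k} \<noteq> UNIV" by fastforce
  then show ?thesis by auto
qed

text \<open>Null separations of the points \<open>i\<close>, \<open>j\<close> and of \<open>i\<close>, \<open>k\<close> reduce the discriminant to a product.\<close>
lemma disc_nonzero_exists:
  fixes x :: "(real^'n::finite)^4"
  assumes "x $ a \<noteq> x $ b"
  obtains \<tau> where "disc (\<tau>, x) \<noteq> 0"
proof -
  obtain k where k: "k \<noteq> a" "k \<noteq> b"
    using ex_4_distinct by metis
  \<comment> \<open>Among three points that are not all equal some point differs from both others;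
    it becomes the common vertex i.\<close>
  obtain i j where ij: "i \<noteq> j" "k \<noteq> i" "k \<noteq> j" "x $ i \<noteq> x $ j" "x $ i \<noteq> x $ k"
    using assms k by metis
  obtain l where l: "l \<noteq> i" "l \<noteq> j" "l \<noteq> k"
    using ex_4_distinct by metis
  define r where "r p q = norm (x $ p - x $ q)" for p q
  have pos: "r i j > 0" "r i k > 0" using ij by (auto simp: r_def)
  \<comment> \<open>Both signs of \<sigma> make x_ik^2 vanish; they change (r_ij - \<sigma>)^2 by 4
    r_ij r_ik, which is nonzero, so one of them keeps x_jk^2 nonzero.\<close>
  obtain \<sigma> :: real where \<sigma>: "\<sigma>\<^sup>2 = (r i k)\<^sup>2" "(r i j - \<sigma>)\<^sup>2 \<noteq> (r j k)\<^sup>2"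
  proof (cases "(r i j - r i k)\<^sup>2 = (r j k)\<^sup>2")
    case True
    have "(r i j + r i k)\<^sup>2 - (r i j - r i k)\<^sup>2 = 4 * (r i j * r i k)"
      by (simp add: power2_eq_square algebra_simps)
    with True pos have "(r i j - (- r i k))\<^sup>2 \<noteq> (r j k)\<^sup>2"
      by (smt (verit) mult_pos_pos)
    then show ?thesis by (intro that[of "- r i k"]) auto
  next
    case False then show ?thesis by (intro that[of "r i k"]) auto
  qed
  \<comment> \<open>Imaginary times equal to spatial distances give null separations; the real time
    of l keeps x_il^2 positive, the summand 1 covering the case of equal spatial points.\<close>
  define \<tau> where "\<tau> = (\<chi> p. if p = j then - \<i> * of_real (r i j) else if p = k then - \<i> * of_real \<sigma>
      else if p = l then of_real (1 + r i l) else (0::complex))"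
  have \<tau>: "\<tau> $ i = 0" "\<tau> $ j = - \<i> * of_real (r i j)" "\<tau> $ k = - \<i> * of_real \<sigma>" "\<tau> $ l = of_real (1 + r i l)"
    using ij l by (auto simp: \<tau>_def)
  have x1: "xsq i j (\<tau>, x) = 0" 
    by (simp add: xsq_def \<tau> r_def power2_eq_square algebra_simps)
  have "complex_of_real (\<sigma>\<^sup>2) = of_real ((r i k)\<^sup>2)" using \<sigma>(1) by simp
  then have x2: "xsq i k (\<tau>, x) = 0"
    by (simp add: xsq_def \<tau> r_def power_mult_distrib)
  have "xsq i l (\<tau>, x) = of_real ((1 + r i l)\<^sup>2 + (r i l)\<^sup>2)"
    by (simp add: xsq_def \<tau> r_def power2_eq_square algebra_simps)
  moreover have "(1 + r i l)\<^sup>2 + (r i l)\<^sup>2 > 0"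
    by (smt (verit, best) norm_ge_zero r_def zero_le_power2 zero_less_power)
  ultimately have x3: "xsq i l (\<tau>, x) \<noteq> 0"
    by (metis less_irrefl of_real_eq_0_iff)
  have "xsq j k (\<tau>, x) = of_real ((r j k)\<^sup>2 - (r i j - \<sigma>)\<^sup>2)"
    by (simp add: xsq_def \<tau> r_def power2_eq_square algebra_simps)
  then have x4: "xsq j k (\<tau>, x) \<noteq> 0"
    using \<sigma>(2) by (metis eq_iff_diff_eq_0 of_real_eq_0_iff)
  have "disc (\<tau>, x) \<noteq> 0"
    using ij l x3 x4 by (subst disc_permute[of i j k l]) (auto simp: x1 x2)
  then show ?thesis by (rule that)
qed

text \<open>Two points of a fibre lie on a complex line. Its parameters that stay in
  \<open>Dom\<close> form an open convex planar set, and the line meets \<open>disc = 0\<close> in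
  finitely many points only; removing these does not disconnect the set.\<close>

lemma Dom_slice_connected:
  fixes x :: "(real^'n::finite)^4"
  shows "connected ((Dom - Gamma_set) \<inter> snd -` {x})"
  unfolding connected_iff_connected_component
proof (intro ballI)
  fix C C' :: "'n config"
  assume C: "C \<in> (Dom - Gamma_set) \<inter> snd -` {x}" and C': "C' \<in> (Dom - Gamma_set) \<inter> snd -` {x}"
  define f where "f \<zeta> = (fst C + \<zeta> *s (fst C' - fst C), x)" for \<zeta>
  have f: "f 0 = C" "f 1 = C'" using C C' by (auto simp: f_def prod_eq_iff)
  obtain P where P: "\<And>\<zeta>. disc (f \<zeta>) = poly P \<zeta>"
    unfolding f_def using disc_line_poly by blast
  have "disc (f 0) \<noteq> 0" using C by (auto simp: f Gamma_set_eq)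
  then have "P \<noteq> 0" using P[of 0] by auto
  then have fin: "finite {\<zeta>. disc (f \<zeta>) = 0}"
    unfolding P by (rule poly_roots_finite)
  define V where "V = {\<zeta>. f \<zeta> \<in> Dom}"
  have "continuous_on UNIV f"
    unfolding f_def by (intro continuous_intros)
  note contf = this
  have "open V"
    unfolding V_def using open_Dom contf by (metis (no_types) open_vimage vimage_def)
  have "convex V"
  proof (rule convexI)
    fix \<zeta> \<xi> u v assume *: "\<zeta> \<in> V" "\<xi> \<in> V" "0 \<le> (u::real)" "0 \<le> v" "u + v = 1"
    have "f (u *\<^sub>R \<zeta> + v *\<^sub>R \<xi>) = u *\<^sub>R f \<zeta> + v *\<^sub>R f \<xi>"
    proof -
      have u: "u = 1 - v" using * by simp
      show ?thesis
        unfolding u by (simp add: f_def prod_eq_iff vec_eq_iff scaleR_conv_of_real[where 'a = complex] algebra_simps)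
    qed
    then show "u *\<^sub>R \<zeta> + v *\<^sub>R \<xi> \<in> V"
      using * convexD[OF convex_Dom] unfolding V_def by fastforce
  qed
  have "connected (V - {\<zeta>. disc (f \<zeta>) = 0})"
    by (intro connected_open_diff_countable)
      (use \<open>convex V\<close> \<open>open V\<close> fin in \<open>auto simp: convex_connected countable_finite\<close>)
  then have "connected (f ` (V - {\<zeta>. disc (f \<zeta>) = 0}))"
    using contf by (meson connected_continuous_image continuous_on_subset subset_UNIV)
  moreover have "f ` (V - {\<zeta>. disc (f \<zeta>) = 0}) \<subseteq> (Dom - Gamma_set) \<inter> snd -` {x}"
    by (auto simp: V_def Gamma_set_eq) (auto simp: f_def)
  moreover have "C \<in> f ` (V - {\<zeta>. disc (f \<zeta>) = 0})"
    using C by (intro image_eqI[of _ _ 0]) (auto simp: f V_def Gamma_set_eq)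
  moreover have "C' \<in> f ` (V - {\<zeta>. disc (f \<zeta>) = 0})"
    using C' by (intro image_eqI[of _ _ 1]) (auto simp: f V_def Gamma_set_eq)
  ultimately show "connected_component ((Dom - Gamma_set) \<inter> snd -` {x}) C C'"
    unfolding connected_component_def by blast
qed

text \<open>A small step on the complex line towards a point with nonzero \<open>disc\<close> leaves
  the finite zero set.\<close>

lemma Dom_minus_Gamma_dense_slice:
  fixes x :: "(real^'n::finite)^4"
  assumes "x $ a \<noteq> x $ b" "open U" "(\<tau>, x) \<in> U"
  obtains \<tau>' where "(\<tau>', x) \<in> U" "disc (\<tau>', x) \<noteq> 0"
proof -
  obtain \<tau>1 where 1: "disc (\<tau>1, x) \<noteq> 0" using disc_nonzero_exists[OF assms(1)] .
  define f where "f \<zeta> = (\<tau> + \<zeta> *s (\<tau>1 - \<tau>), x)" for \<zeta>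
  have f: "f 0 = (\<tau>, x)" "f 1 = (\<tau>1, x)" by (auto simp: f_def)
  obtain P where P: "\<And>\<zeta>. disc (f \<zeta>) = poly P \<zeta>"
    unfolding f_def using disc_line_poly by blast
  have "P \<noteq> 0" using 1 P[of 1] f by auto
  then have fin: "finite {\<zeta>. disc (f \<zeta>) = 0}"
    unfolding P by (rule poly_roots_finite)
  have "continuous_on UNIV f"
    unfolding f_def by (intro continuous_intros)
  then have "open (f -` U)" using assms(2) by (metis open_vimage)
  moreover have "0 \<in> f -` U" using assms(3) f by auto
  ultimately have "infinite (f -` U)"
    using finite_imp_not_open by blast
  then obtain \<zeta> where "f \<zeta> \<in> U" "disc (f \<zeta>) \<noteq> 0"
    using fin by (metis (mono_tags, lifting) finite_subset mem_Collect_eq subsetI vimageI2 vimage_eq)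
  then show ?thesis using that unfolding f_def by blast
qed

text \<open>If all spatial points coincide, no change of the times leaves the locus, so points 1 and
  2 are first separated in space by a small displacement.\<close>

lemma Dom_minus_Gamma_dense:
  assumes "open U" "C \<in> U" "C \<in> (Dom :: 'n::finite config set)"
  obtains C' where "C' \<in> U" "C' \<in> Dom - Gamma_set"
proof -
  have U: "open (U \<inter> Dom)" "C \<in> U \<inter> Dom" using assms open_Dom by auto
  define f where "f t = (fst C, snd C + t *\<^sub>R (\<chi> k. if k = 1 then axis undefined 1 else 0))" for t :: real
  have "continuous_on UNIV f" unfolding f_def by (intro continuous_intros)
  then have "open (f -` (U \<inter> Dom))" using U(1) by (metis open_vimage)
  moreover have "0 \<in> f -` (U \<inter> Dom)" using U by (auto simp: f_def)
  ultimately have "infinite (f -` (U \<inter> Dom))"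
    using finite_imp_not_open by blast
  then have "infinite (f -` (U \<inter> Dom) - {0})" by simp
  then have "f -` (U \<inter> Dom) - {0} \<noteq> {}" by (metis finite.emptyI)
  then obtain t1 where t1: "t1 \<in> f -` (U \<inter> Dom)" "t1 \<noteq> 0" by blast
  have inj: "t = t'" if "snd (f t) $ 1 = snd (f t) $ 2" "snd (f t') $ 1 = snd (f t') $ 2" for t t'
  proof -
    have "snd C $ 1 + t *\<^sub>R axis undefined 1 = snd C $ 1 + t' *\<^sub>R axis undefined (1::real)"
      using that by (simp add: f_def)
    then show ?thesis by (simp add: axis_eq_0_iff)
  qed
  obtain t where t: "f t \<in> U \<inter> Dom" "snd (f t) $ 1 \<noteq> snd (f t) $ 2"
  proof (cases "snd (f 0) $ 1 = snd (f 0) $ 2")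
    case True
    with inj[of t1 0] t1 show ?thesis by (intro that[of t1]) auto
  next
    case False
    with \<open>0 \<in> f -` (U \<inter> Dom)\<close> show ?thesis by (intro that[of 0]) auto
  qed
  then obtain \<tau>' where "(\<tau>', snd (f t)) \<in> U \<inter> Dom" "disc (\<tau>', snd (f t)) \<noteq> 0"
    using Dom_minus_Gamma_dense_slice[of "snd (f t)" 1 2 "U \<inter> Dom" "fst (f t)"] U(1) by auto
  then show ?thesis using that[of "(\<tau>', snd (f t))"] by (auto simp: Gamma_set_eq)
qed

text \<open>The removed diagonal has codimension at least 3; explicitly, every point is joined by a
  segment to a fixed vector supported in the first slot or to its negative.\<close>

lemma connected_not_all_equal:
  "connected {x :: 'a::real_normed_vector ^ 4. \<exists>i j. x $ i \<noteq> x $ j}"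
proof (cases "\<exists>e :: 'a. e \<noteq> 0")
  case False
  then have "x $ i = x $ j" for x :: "'a ^ 4" and i j by metis
  then have "{x :: 'a ^ 4. \<exists>i j. x $ i \<noteq> x $ j} = {}" by blast
  then show ?thesis by simp
next
  case True
  then obtain e :: 'a where e: "e \<noteq> 0" by blast
  let ?N = "{x :: 'a ^ 4. \<exists>i j. x $ i \<noteq> x $ j}"
  have seg: "connected_component ?N x y"
    if "\<And>s. 0 \<le> s \<Longrightarrow> s \<le> 1 \<Longrightarrow> \<exists>i j. ((1 - s) *\<^sub>R x + s *\<^sub>R y) $ i \<noteq> ((1 - s) *\<^sub>R x + s *\<^sub>R y) $ j" for x y :: "'a^4"
  proof -
    have "closed_segment x y \<subseteq> ?N" using that by (auto simp: closed_segment_def)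
    then show ?thesis
      unfolding connected_component_def by (meson connected_segment ends_in_segment)
  qed
  define ax where "ax j = (\<chi> k. if k = j then e else 0)" for j :: 4
  have ax: "ax j $ k = (if k = j then e else 0)" for j k by (simp add: ax_def)
  have s1: "connected_component ?N (ax 1) (ax 2)"
  proof (rule seg)
    fix s :: real
    show "\<exists>i j. ((1 - s) *\<^sub>R ax 1 + s *\<^sub>R ax 2) $ i \<noteq> ((1 - s) *\<^sub>R ax 1 + s *\<^sub>R ax 2) $ j"
    proof (cases "s = 0")
      case True then show ?thesis by (intro exI[of _ 1] exI[of _ 2]) (simp add: ax e)
    next
      case False then show ?thesis by (intro exI[of _ 2] exI[of _ 3]) (simp add: ax e)
    qed
  qed
  have s2: "connected_component ?N (- ax 1) (ax 2)"
  proof (rule seg)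
    fix s :: real
    show "\<exists>i j. ((1 - s) *\<^sub>R (- ax 1) + s *\<^sub>R ax 2) $ i \<noteq> ((1 - s) *\<^sub>R (- ax 1) + s *\<^sub>R ax 2) $ j"
    proof (cases "s = 0")
      case True then show ?thesis by (intro exI[of _ 1] exI[of _ 2]) (simp add: ax e)
    next
      case False then show ?thesis by (intro exI[of _ 2] exI[of _ 3]) (simp add: ax e)
    qed
  qed
  have s3: "connected_component ?N x (ax 2)" if x: "x \<in> ?N" for x
  proof -
    have "connected_component ?N x (ax 1) \<or> connected_component ?N x (- ax 1)"
    proof (rule ccontr)
      \<comment> \<open>If both segments met the diagonal, x would modulo constant vectors be both a
        nonpositive and a nonnegative multiple of \<open>ax 1\<close>.\<close>
      assume "\<not> ?thesis"
      then obtain s s' where s: "0 \<le> s" "s \<le> 1"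
        "\<And>i j. ((1 - s) *\<^sub>R x + s *\<^sub>R ax 1) $ i = ((1 - s) *\<^sub>R x + s *\<^sub>R ax 1) $ j"
        and s': "0 \<le> s'" "s' \<le> 1"
        "\<And>i j. ((1 - s') *\<^sub>R x + s' *\<^sub>R (- ax 1)) $ i = ((1 - s') *\<^sub>R x + s' *\<^sub>R (- ax 1)) $ j"
        using seg by (metis (no_types, lifting))
      have "s \<noteq> 0" "s' \<noteq> 0" using x s(3) s'(3) by auto
      then have pos: "s > 0" "s' > 0" using s s' by auto
      obtain i j where ij: "x $ i \<noteq> x $ j" using x by auto
      have e1: "(1 - s) *\<^sub>R (x $ i - x $ j) = - (s *\<^sub>R (ax 1 $ i - ax 1 $ j))"
        using s(3)[of i j] by (simp add: algebra_simps)
      have e2: "(1 - s') *\<^sub>R (x $ i - x $ j) = s' *\<^sub>R (ax 1 $ i - ax 1 $ j)"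
        using s'(3)[of i j] by (simp add: algebra_simps)
      have "(s' * (1 - s) + s * (1 - s')) *\<^sub>R (x $ i - x $ j)
          = s' *\<^sub>R ((1 - s) *\<^sub>R (x $ i - x $ j)) + s *\<^sub>R ((1 - s') *\<^sub>R (x $ i - x $ j))"
        by (simp add: scaleR_left_distrib)
      also have "\<dots> = 0" unfolding e1 e2 by (simp add: mult.commute)
      finally have "(s' * (1 - s) + s * (1 - s')) *\<^sub>R (x $ i - x $ j) = 0" .
      then have "s' * (1 - s) + s * (1 - s') = 0" using ij by simp
      moreover have "s' * (1 - s) \<ge> 0" "s * (1 - s') \<ge> 0" using s s' by auto
      ultimately have "s' * (1 - s) = 0" by linarith
      then have "s = 1" using pos by simp
      then show False using e s(3)[of 1 2] by (simp add: ax)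
    qed
    then show ?thesis
      using connected_component_trans[OF _ s1] connected_component_trans[OF _ s2] by blast
  qed
  show ?thesis unfolding connected_iff_connected_component
    by (intro ballI) (rule connected_component_trans[OF s3 connected_component_sym[OF s3]])
qed

text \<open>The projection to the spatial points is open with connected fibres over a connected
  base, the spatial quadruples that are not all equal.\<close>

lemma Dom_minus_Gamma_path_connected: "path_connected (Dom - Gamma_set :: 'n::finite config set)"
proof -
  define E where "E = (Dom - Gamma_set :: 'n config set)"
  define N where "N = {x :: (real^'n)^4. \<exists>i j. x $ i \<noteq> x $ j}"
  have "open E" unfolding E_def by (rule open_Dom_minus_Gamma)
  have op: "open (snd ` W)" if "open W" for W :: "'n config set"
    using that by (rule open_image_snd)
  have im: "snd ` E = N"
  proof
    show "snd ` E \<subseteq> N"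
      using disc_all_equal by (fastforce simp: E_def N_def Gamma_set_eq)
    show "N \<subseteq> snd ` E"
    proof
      fix x assume "x \<in> N"
      then obtain a b where ab: "x $ a \<noteq> x $ b" by (auto simp: N_def)
      define \<tau> where "\<tau> = (\<chi> k::4. if k = 1 then 3 else if k = 2 then 2 else if k = 3 then 1 else (0::complex))"
      have "(\<tau>, x) \<in> Dom" by (simp add: Dom_def \<tau>_def)
      then obtain \<tau>' where "(\<tau>', x) \<in> Dom" "disc (\<tau>', x) \<noteq> 0"
        using Dom_minus_Gamma_dense_slice[OF ab open_Dom] by metis
      then show "x \<in> snd ` E" by (force simp: E_def Gamma_set_eq)
    qed
  qed
  have "connected (E \<inter> snd -` N)"
  proof (rule connected_open_monotone_preimage[of E snd N])
    show "continuous_on E snd" by (intro continuous_intros)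
    show "snd ` E = N" by (rule im)
    fix W assume "openin (top_of_set E) W"
    then have "open W" "W \<subseteq> E" using \<open>open E\<close> by (auto simp: openin_open_eq)
    then show "openin (top_of_set N) (snd ` W)"
      using im op by (metis image_mono open_openin_trans \<open>open E\<close>)
  next
    fix y show "connected (E \<inter> snd -` {y})"
      unfolding E_def by (rule Dom_slice_connected)
  next
    show "connected N" unfolding N_def by (rule connected_not_all_equal)
  qed auto
  then have "connected E" using im by (metis image_subset_iff_subset_vimage inf.absorb1 order_refl)
  with \<open>open E\<close> show ?thesis
    unfolding E_def by (metis connected_open_path_connected)
qed

subsection \<open>The uniformising variable and the channel transformation\<close>

definition rho_t :: "complex \<Rightarrow> complex" where
  "rho_t z = (1 - csqrt z) / (1 + csqrt z)"

text \<open>Closed form of \<Phi>: the squared Cayley transform of q = exp (i w / 2) is the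
  coordinate of 1 - z. Unlike the inverse function it is directly meaningful and continuous on the
  real segments of \<open>S_ext\<close>.\<close>

definition Phi_ext :: "complex \<Rightarrow> complex" where
  "Phi_ext w = - 2 * \<i> * Ln ((1 - exp (\<i> * w / 2)) / (1 + exp (\<i> * w / 2)))"

definition log_ratio :: "complex \<Rightarrow> complex" where
  "log_ratio w = Ln 4 + \<i> * w - 2 * Ln (1 - exp (\<i> * w))"

text \<open>The added real segments are where z lies in (1,oo); the point 0, where z = 1, is left
  out.\<close>

definition S_ext :: "complex set" where
  "S_ext = {w. - pi < Re w \<and> Re w < pi \<and> Im w \<ge> 0 \<and> w \<noteq> 0}"

lemma S_strip_subset_S_ext: "w \<in> S_strip \<Longrightarrow> w \<in> S_ext"
  by (auto simp: S_strip_def S_ext_def)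

lemma Re_cayley: "Re ((1 - q) / (1 + q)) = (1 - (cmod q)\<^sup>2) / (cmod (1 + q))\<^sup>2"
  unfolding cmod_power2 Re_divide by (simp add: power2_eq_square algebra_simps)

lemma cmod_less_iff_square: "cmod a < cmod b \<longleftrightarrow> (cmod a)\<^sup>2 < (cmod b)\<^sup>2"
  using power2_less_imp_less[of "cmod a" "cmod b"] power_strict_mono[of "cmod a" "cmod b" 2] by auto

lemma one_minus_koebe:
  assumes "1 + r \<noteq> (0::complex)"
  shows "1 - 4 * r / (1 + r)\<^sup>2 = ((1 - r) / (1 + r))\<^sup>2"
proof -
  have "((1 - r) / (1 + r))\<^sup>2 = ((1 + r)\<^sup>2 - 4 * r) / (1 + r)\<^sup>2"
    by (simp add: power_divide) (simp add: power2_eq_square algebra_simps)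
  then show ?thesis using assms by (simp add: diff_divide_distrib)
qed

text \<open>For |r| < 1 the Cayley transform (1 - r) / (1 + r) lies in the right half plane and is
  therefore the principal root of 1 - z.\<close>

lemma cayley_square_bij:
  fixes r :: complex
  assumes "cmod r < 1"
  shows "csqrt (1 - 4 * r / (1 + r)\<^sup>2) = (1 - r) / (1 + r)" and "rho (4 * r / (1 + r)\<^sup>2) = r"
    and "4 * r / (1 + r)\<^sup>2 \<notin> one_to_inf"
proof -
  have r: "1 + r \<noteq> 0" using assms by (metis add_eq_0_iff norm_minus_cancel norm_one less_irrefl)
  have pos: "Re ((1 - r) / (1 + r)) > 0"
    unfolding Re_cayley using assms r by (simp add: abs_square_less_1)
  note eq = one_minus_koebe[OF r]
  show 1: "csqrt (1 - 4 * r / (1 + r)\<^sup>2) = (1 - r) / (1 + r)"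
    unfolding eq using pos by (intro csqrt_square) auto
  have 2: "1 - (1 - r) / (1 + r) = 2 * r / (1 + r)" using r by (simp add: field_simps)
  show "rho (4 * r / (1 + r)\<^sup>2) = r"
    unfolding rho_def 1 2 using r by (cases "r = 0") (simp_all add: power_divide power2_eq_square)
  show "4 * r / (1 + r)\<^sup>2 \<notin> one_to_inf"
  proof
    assume "4 * r / (1 + r)\<^sup>2 \<in> one_to_inf"
    then obtain x where "4 * r / (1 + r)\<^sup>2 = of_real x" "x \<ge> 1" by (auto simp: one_to_inf_def)
    then have "((1 - r) / (1 + r))\<^sup>2 = of_real (1 - x)" "1 - x \<le> 0"
      using eq by auto
    then show False
      using pos square_plus_real_nonneg_notin_nonpos_Reals[of "(1 - r) / (1 + r)" 0]
      by (metis add.right_neutral less_irrefl nonpos_Reals_of_real_iff of_real_0 order_refl)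
  qed
qed

lemma csqrt_Re_pos:
  assumes "x \<notin> \<real>\<^sub>\<le>\<^sub>0" shows "Re (csqrt x) > 0"
proof (rule ccontr)
  assume "\<not> ?thesis"
  with csqrt_principal[of x] have *: "Re (csqrt x) = 0" by linarith
  have "x = (csqrt x)\<^sup>2" by simp
  then have "Im x = 0" "Re x \<le> 0" using * by (metis Im_power2 mult_zero_left mult_zero_right,
      metis Re_power2 diff_0 neg_le_0_iff_le power_zero_numeral zero_le_power2)
  with assms show False by (simp add: complex_nonpos_Reals_iff)
qed

lemma one_minus_nonpos_Reals_iff: "1 - z \<in> \<real>\<^sub>\<le>\<^sub>0 \<longleftrightarrow> z \<in> one_to_inf"
proof
  assume "1 - z \<in> \<real>\<^sub>\<le>\<^sub>0"
  then obtain x where "1 - z = of_real x" "x \<le> 0" by (auto elim: nonpos_Reals_cases)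
  then have "z = of_real (1 - x)" "1 - x \<ge> 1" by (auto simp: algebra_simps)
  then show "z \<in> one_to_inf" unfolding one_to_inf_def by blast
next
  assume "z \<in> one_to_inf"
  then obtain x where "z = of_real x" "x \<ge> 1" by (auto simp: one_to_inf_def)
  then have "1 - z = of_real (1 - x)" "1 - x \<le> 0" by auto
  then show "1 - z \<in> \<real>\<^sub>\<le>\<^sub>0" by (metis nonpos_Reals_of_real_iff)
qed

lemma rho_inverse:
  assumes "z \<notin> one_to_inf" "z \<noteq> 0"
  shows "cmod (rho z) < 1" "rho z \<noteq> 0" "z * (1 + rho z)\<^sup>2 = 4 * rho z"
proof -
  define s where "s = csqrt (1 - z)"
  have s2: "s\<^sup>2 = 1 - z" by (simp add: s_def)
  have "1 - z \<notin> \<real>\<^sub>\<le>\<^sub>0" using assms(1) by (simp only: one_minus_nonpos_Reals_iff not_False_eq_True)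
  then have s: "Re s > 0"
    unfolding s_def by (rule csqrt_Re_pos)
  have "Re (1 + s) > 0" using s by simp
  then have s1: "1 + s \<noteq> 0" by (metis less_irrefl zero_complex.sel(1))
  have s1': "s \<noteq> 1" using s2 assms(2) by auto
  have z: "z = (1 - s) * (1 + s)" using s2 by (simp add: power2_eq_square algebra_simps)
  have r: "rho z = (1 - s) / (1 + s)"
  proof -
    have "rho z = (1 - s)\<^sup>2 / ((1 - s) * (1 + s))"
      unfolding z[symmetric] by (simp add: rho_def s_def)
    then show ?thesis using s1' by (simp add: power2_eq_square)
  qed
  show "rho z \<noteq> 0" using r s1 s1' by auto
  have "cmod (1 - s) < cmod (1 + s)"
    unfolding cmod_less_iff_square cmod_power2 using s by (simp add: power2_eq_square algebra_simps)
  then show "cmod (rho z) < 1"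
    unfolding r norm_divide using s1 by (simp add: divide_less_eq_1_pos)
  show "z * (1 + rho z)\<^sup>2 = 4 * rho z"
  proof -
    have "1 + rho z = 2 / (1 + s)" unfolding r using s1 by (simp add: field_simps)
    then have "z * (1 + rho z)\<^sup>2 = (1 - s) * (1 + s) * (2 / (1 + s))\<^sup>2" using z by simp
    then show ?thesis unfolding r using s1 by (simp add: power_divide power2_eq_square)
  qed
qed

text \<open>On the unit circle (1 + r)^2 = r |1 + r|^2, so z = 4 / |1 + r|^2. This is what keeps Im
  chi positive at an end point inside \<open>Dom\<close>.\<close>

lemma unit_rho_one_to_inf:
  assumes "z * (1 + r)\<^sup>2 = 4 * r" "cmod r = 1"
  shows "z \<in> one_to_inf"
proof -
  have rr: "r * cnj r = 1" using assms(2) by (simp add: complex_norm_square[symmetric])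
  have "1 + r \<noteq> 0" using assms by auto
  then have pos: "(cmod (1 + r))\<^sup>2 > 0" by simp
  have "(1 + r)\<^sup>2 = r * ((1 + r) * cnj (1 + r))"
    using rr by (simp add: power2_eq_square algebra_simps)
  also have "\<dots> = r * of_real ((cmod (1 + r))\<^sup>2)"
    by (simp only: complex_norm_square)
  finally have "z * (r * of_real ((cmod (1 + r))\<^sup>2)) = 4 * r" using assms(1) by simp
  moreover have "r \<noteq> 0" using assms(2) by auto
  ultimately have "z * of_real ((cmod (1 + r))\<^sup>2) = 4" by simp
  then have z: "z = of_real (4 / (cmod (1 + r))\<^sup>2)" using pos by (simp add: field_simps)
  have "cmod (1 + r) \<le> 2" using assms(2) norm_triangle_ineq[of 1 r] by simp
  then have "(cmod (1 + r))\<^sup>2 \<le> 2\<^sup>2" by (intro power_mono) auto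
  then have "4 / (cmod (1 + r))\<^sup>2 \<ge> 1" using pos by (simp add: field_simps)
  with z show ?thesis unfolding one_to_inf_def by blast
qed

lemma upper_exp_less_1: "Im w > 0 \<Longrightarrow> cmod (exp (\<i> * w)) < 1"
  by (simp add: norm_exp_eq_Re)

lemma Re_one_minus_exp_pos:
  assumes "Im w > 0" shows "Re (1 - exp (\<i> * w)) > 0"
proof -
  have "Re (exp (\<i> * w)) < 1"
    using upper_exp_less_1[OF assms] complex_Re_le_cmod[of "exp (\<i> * w)"] by linarith
  then show ?thesis by simp
qed

lemma one_minus_exp_notin_nonpos_Reals: "Im w > 0 \<Longrightarrow> 1 - exp (\<i> * w) \<notin> \<real>\<^sub>\<le>\<^sub>0"
  using Re_one_minus_exp_pos[of w] unfolding complex_nonpos_Reals_iff by linarith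

lemma
  assumes w: "Im w > 0"
  shows rho_z_of_chi: "rho (z_of_chi w) = exp (\<i> * w)"
    and z_of_chi_notin_one_to_inf: "z_of_chi w \<notin> one_to_inf"
    and z_of_chi_nonzero: "z_of_chi w \<noteq> 0"
    and z_of_chi_neq_1: "z_of_chi w \<noteq> 1"
proof -
  show "rho (z_of_chi w) = exp (\<i> * w)"
    unfolding z_of_chi_def by (rule cayley_square_bij(2)[OF upper_exp_less_1[OF w]])
  show 1: "z_of_chi w \<notin> one_to_inf"
    unfolding z_of_chi_def by (rule cayley_square_bij(3)[OF upper_exp_less_1[OF w]])
  have "1 + exp (\<i> * w) \<noteq> 0"
    using upper_exp_less_1[OF w] by (metis add_eq_0_iff norm_minus_cancel norm_one less_irrefl)
  then show "z_of_chi w \<noteq> 0" by (auto simp: z_of_chi_def)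
  show "z_of_chi w \<noteq> 1" using 1 by (auto simp: one_to_inf_def intro: image_eqI[of _ _ 1])
qed

lemma log_ratio_shift: "log_ratio (w + 2 * of_int n * of_real pi) = log_ratio w + 2 * of_int n * of_real pi * \<i>"
proof -
  have "exp (\<i> * (w + 2 * of_int n * of_real pi)) = exp (\<i> * w) * exp (2 * of_int n * of_real pi * \<i>)"
    by (simp add: exp_add[symmetric] algebra_simps)
  also have "exp (2 * of_int n * of_real pi * \<i>) = (1::complex)"
    using exp_integer_2pi[of "of_int n"] by (simp add: algebra_simps)
  finally show ?thesis by (simp add: log_ratio_def algebra_simps)
qed

lemma exp_log_ratio:
  assumes "Im w > 0"
  shows "exp (log_ratio w) = z_of_chi w / (1 - z_of_chi w)"
proof -
  define r where "r = exp (\<i> * w)"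
  have r: "cmod r < 1" unfolding r_def by (rule upper_exp_less_1[OF assms])
  have nz: "1 + r \<noteq> 0" "1 - r \<noteq> 0" using r by (metis add_eq_0_iff norm_minus_cancel norm_one less_irrefl, auto)
  have "exp (log_ratio w) = 4 * r / (1 - r)\<^sup>2"
    using nz(2) unfolding log_ratio_def r_def[symmetric] exp_diff exp_add exp_double
    by (simp add: r_def[symmetric])
  moreover have "z_of_chi w = 4 * r / (1 + r)\<^sup>2" by (simp add: z_of_chi_def r_def)
  moreover note one_minus_koebe[OF nz(1), unfolded power_divide]
  ultimately show ?thesis using nz by simp
qed

lemma log_ratio_minus_cnj: "Im w > 0 \<Longrightarrow> log_ratio (- cnj w) = cnj (log_ratio w)"
proof -
  assume w: "Im w > 0"
  have "1 - exp (\<i> * w) \<notin> \<real>\<^sub>\<le>\<^sub>0" by (rule one_minus_exp_notin_nonpos_Reals[OF w])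
  then have "Ln (cnj (1 - exp (\<i> * w))) = cnj (Ln (1 - exp (\<i> * w)))" by (rule cnj_Ln[symmetric])
  moreover have "cnj (exp (\<i> * w)) = exp (\<i> * (- cnj w))" by (simp add: exp_cnj)
  moreover have "Ln 4 = complex_of_real (ln 4)" by (metis Ln_of_real of_real_numeral zero_less_numeral)
  ultimately show ?thesis by (simp add: log_ratio_def)
qed

lemma Ln_square:
  assumes "Re y > 0" shows "Ln (y\<^sup>2) = 2 * Ln y"
proof -
  have "y \<noteq> 0" using assms by auto
  moreover have "\<bar>Im (Ln y)\<bar> < pi / 2" using assms \<open>y \<noteq> 0\<close> Re_Ln_pos_lt by blast
  ultimately show ?thesis
    by (intro Ln_unique) (auto simp: exp_double)
qed

lemma Re_two_divide_pos: "Re x > 0 \<Longrightarrow> Re (2 / x) > 0"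
  by (auto simp: Re_divide intro!: divide_pos_pos add_pos_nonneg)

lemma half_exp_S_ext:
  assumes "w \<in> S_ext"
  defines "q \<equiv> exp (\<i> * w / 2)"
  shows "Re q > 0" "cmod q \<le> 1" "q \<noteq> 1" "q \<noteq> 0" "1 + q \<noteq> 0" "1 + q\<^sup>2 \<noteq> 0" "exp (\<i> * w) = q\<^sup>2"
proof -
  show q: "Re q > 0"
    unfolding q_def Re_exp using assms by (auto simp: S_ext_def intro!: mult_pos_pos cos_gt_zero_pi)
  show "cmod q \<le> 1" unfolding q_def using assms by (simp add: norm_exp_eq_Re S_ext_def)
  show "q \<noteq> 1"
  proof
    assume "q = 1"
    then obtain n :: int where n: "Im w = 0" "Re w / 2 = of_int (2 * n) * pi"
      unfolding q_def exp_eq_1 by auto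
    then have "Re w = of_int (4 * n) * pi" by simp
    then have "\<bar>real_of_int (4 * n)\<bar> * pi < 1 * pi" using assms by (auto simp: S_ext_def abs_mult)
    then have "\<bar>real_of_int (4 * n)\<bar> < 1" by (simp add: mult_less_cancel_right_disj)
    then have "n = 0" by linarith
    with n assms show False by (auto simp: S_ext_def complex_eq_iff)
  qed
  show "q \<noteq> 0" by (simp add: q_def)
  show "1 + q \<noteq> 0" using q by (auto simp: add_eq_0_iff)
  show "1 + q\<^sup>2 \<noteq> 0"
    using square_plus_real_nonneg_notin_nonpos_Reals[of q 1] q
    by (metis add.commute less_irrefl nonpos_Reals_zero_I of_real_1 zero_le_one)
  show "exp (\<i> * w) = q\<^sup>2" by (simp add: q_def exp_double[symmetric])
qed

text \<open>The candidate root equals 2 / (q + 1/q), and q and 1/q both lie in the right half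
  plane.\<close>

lemma csqrt_z_of_chi:
  assumes "w \<in> S_ext"
  defines "q \<equiv> exp (\<i> * w / 2)"
  shows "csqrt (z_of_chi w) = 2 * q / (1 + q\<^sup>2)"
proof -
  note h = half_exp_S_ext[OF assms(1), folded q_def]
  have z: "z_of_chi w = (2 * q / (1 + q\<^sup>2))\<^sup>2"
    unfolding z_of_chi_def h(7) by (simp add: power_divide power_mult_distrib)
  have "Re (q + 1 / q) > 0"
    using h by (simp add: Re_divide add_pos_nonneg)
  moreover have "2 * q / (1 + q\<^sup>2) = 2 / (q + 1 / q)"
    using h by (simp add: field_simps power2_eq_square)
  ultimately have "Re (2 * q / (1 + q\<^sup>2)) > 0"
    by (metis Re_two_divide_pos)
  then show ?thesis unfolding z by (intro csqrt_square) auto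
qed

lemma divide_divide_cancel: "c \<noteq> 0 \<Longrightarrow> (a / c) / (b / c) = a / (b :: complex)"
  by simp

lemma rho_t_z_of_chi:
  assumes "w \<in> S_ext"
  defines "q \<equiv> exp (\<i> * w / 2)"
  shows "rho_t (z_of_chi w) = ((1 - q) / (1 + q))\<^sup>2"
proof -
  note h = half_exp_S_ext[OF assms(1), folded q_def]
  have 1: "1 + 2 * q / (1 + q\<^sup>2) = (1 + q)\<^sup>2 / (1 + q\<^sup>2)"
    and 2: "1 - 2 * q / (1 + q\<^sup>2) = (1 - q)\<^sup>2 / (1 + q\<^sup>2)"
    using h(6) by (simp_all add: field_simps power2_eq_square)
  show ?thesis
    unfolding rho_t_def csqrt_z_of_chi[OF assms(1), folded q_def] 1 2 power_divide
    by (rule divide_divide_cancel[OF h(6)])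
qed

lemma i_times_Phi_ext: "\<i> * Phi_ext w = 2 * Ln ((1 - exp (\<i> * w / 2)) / (1 + exp (\<i> * w / 2)))"
proof -
  have "\<i> * (- 2 * \<i> * x) = 2 * x" for x by simp
  then show ?thesis unfolding Phi_ext_def .
qed

lemma exp_Phi_ext:
  assumes "w \<in> S_ext"
  shows "exp (\<i> * Phi_ext w) = rho_t (z_of_chi w)"
proof -
  define q where "q = exp (\<i> * w / 2)"
  note h = half_exp_S_ext[OF assms(1), folded q_def]
  have 1: "\<i> * Phi_ext w = 2 * Ln ((1 - q) / (1 + q))"
    unfolding q_def by (rule i_times_Phi_ext)
  have "(1 - q) / (1 + q) \<noteq> 0" using h(3,5) by simp
  then show ?thesis
    unfolding rho_t_z_of_chi[OF assms, folded q_def] 1 exp_double by (metis exp_Ln)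
qed

lemma Im_Phi_ext_pos:
  assumes "w \<in> S_ext"
  shows "Im (Phi_ext w) > 0"
proof -
  define q where "q = exp (\<i> * w / 2)"
  note h = half_exp_S_ext[OF assms(1), folded q_def]
  have "cmod (1 - q) < cmod (1 + q)"
    unfolding cmod_less_iff_square cmod_power2 using h by (simp add: power2_eq_square algebra_simps)
  then have "cmod ((1 - q) / (1 + q)) < 1" using h by (simp add: norm_divide)
  moreover have "(1 - q) / (1 + q) \<noteq> 0" using h by auto
  ultimately have "Re (Ln ((1 - q) / (1 + q))) < 0"
    by (simp add: ln_less_zero)
  then show ?thesis by (simp add: Phi_ext_def q_def)
qed

lemma cayley_notin_nonpos_Reals:
  assumes "w \<in> S_ext"
  shows "(1 - exp (\<i> * w / 2)) / (1 + exp (\<i> * w / 2)) \<notin> \<real>\<^sub>\<le>\<^sub>0"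
proof -
  define q where "q = exp (\<i> * w / 2)"
  note h = half_exp_S_ext[OF assms(1), folded q_def]
  have "Re ((1 - q) / (1 + q)) \<ge> 0"
    unfolding Re_cayley using h by (simp add: power_le_one)
  moreover have "(1 - q) / (1 + q) \<noteq> 0" using h by auto
  ultimately show ?thesis
    unfolding q_def[symmetric] by (metis complex_eq_iff complex_nonpos_Reals_iff order_antisym zero_complex.sel)
qed

lemma isCont_Phi_ext: "w \<in> S_ext \<Longrightarrow> isCont Phi_ext w"
  unfolding Phi_ext_def
  using cayley_notin_nonpos_Reals half_exp_S_ext(5) by (intro continuous_intros) auto

lemma holomorphic_on_Phi_ext: "Phi_ext holomorphic_on S_strip"
  unfolding Phi_ext_def
  using cayley_notin_nonpos_Reals half_exp_S_ext(5) S_strip_subset_S_ext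
  by (intro holomorphic_intros) auto

lemma holomorphic_on_log_ratio: "log_ratio holomorphic_on {w. Im w > 0}"
  unfolding log_ratio_def using one_minus_exp_notin_nonpos_Reals
  by (intro holomorphic_intros) auto

lemma S_strip_cayley:
  assumes "w \<in> S_strip"
  shows "Re ((1 - exp (\<i> * w / 2)) / (1 + exp (\<i> * w / 2))) > 0"
proof -
  note h = half_exp_S_ext[OF S_strip_subset_S_ext[OF assms]]
  have "cmod (exp (\<i> * w / 2)) < 1" using assms by (simp add: norm_exp_eq_Re S_strip_def)
  then show ?thesis unfolding Re_cayley using h by (simp add: abs_square_less_1)
qed

lemma Phi_ext_eq_Ln:
  assumes "w \<in> S_strip"
  shows "\<i> * Phi_ext w = Ln (rho_t (z_of_chi w))"
  unfolding rho_t_z_of_chi[OF S_strip_subset_S_ext[OF assms]] Ln_square[OF S_strip_cayley[OF assms]]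
  by (rule i_times_Phi_ext)

lemma Phi_ext_in_S_strip:
  assumes "w \<in> S_strip"
  shows "Phi_ext w \<in> S_strip"
proof -
  define y where "y = (1 - exp (\<i> * w / 2)) / (1 + exp (\<i> * w / 2))"
  have "Re y > 0" using S_strip_cayley[OF assms] by (simp only: y_def)
  moreover from this have "y \<noteq> 0" by auto
  ultimately have "\<bar>Im (Ln y)\<bar> < pi / 2" using Re_Ln_pos_lt by blast
  moreover have "Phi_ext w = - 2 * \<i> * Ln y" unfolding Phi_ext_def y_def ..
  ultimately have "- pi < Re (Phi_ext w)" "Re (Phi_ext w) < pi" by auto
  then show ?thesis
    using Im_Phi_ext_pos[OF S_strip_subset_S_ext[OF assms]] by (simp add: S_strip_def)
qed

lemma z_of_chi_Phi_ext:
  assumes "w \<in> S_ext"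
  shows "z_of_chi (Phi_ext w) = 1 - z_of_chi w"
proof -
  define q where "q = exp (\<i> * w / 2)"
  note h = half_exp_S_ext[OF assms, folded q_def]
  define y where "y = (1 - q) / (1 + q)"
  have 1: "1 + y\<^sup>2 = 2 * (1 + q\<^sup>2) / (1 + q)\<^sup>2"
  proof -
    have "1 + y\<^sup>2 = ((1 + q)\<^sup>2 + (1 - q)\<^sup>2) / (1 + q)\<^sup>2"
      using h(5) by (simp add: y_def power_divide add_divide_distrib)
    also have "(1 + q)\<^sup>2 + (1 - q)\<^sup>2 = 2 * (1 + q\<^sup>2)" by algebra
    finally show ?thesis .
  qed
  have "z_of_chi (Phi_ext w) = 4 * y\<^sup>2 / (1 + y\<^sup>2)\<^sup>2"
    using exp_Phi_ext[OF assms] rho_t_z_of_chi[OF assms] by (simp add: z_of_chi_def[of "Phi_ext w"] y_def q_def)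
  also have "\<dots> = ((1 - q\<^sup>2) / (1 + q\<^sup>2))\<^sup>2"
  proof -
    have gen: "2 * (c / a) / (2 * b / a\<^sup>2) = c * a / b" if "a \<noteq> 0" "b \<noteq> 0" for a b c :: complex
      using that by (simp add: field_simps power2_eq_square)
    have "2 * y / (1 + y\<^sup>2) = (1 - q) * (1 + q) / (1 + q\<^sup>2)"
      unfolding 1 unfolding y_def using h(5,6) by (rule gen)
    also have "(1 - q) * (1 + q) = 1 - q\<^sup>2" by algebra
    finally have "2 * y / (1 + y\<^sup>2) = (1 - q\<^sup>2) / (1 + q\<^sup>2)" .
    then have "(2 * y / (1 + y\<^sup>2))\<^sup>2 = ((1 - q\<^sup>2) / (1 + q\<^sup>2))\<^sup>2" by simp
    then show ?thesis by (simp add: power_divide power_mult_distrib)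
  qed
  also have "\<dots> = 1 - 4 * q\<^sup>2 / (1 + q\<^sup>2)\<^sup>2"
    by (rule one_minus_koebe[OF h(6), symmetric])
  also have "\<dots> = 1 - z_of_chi w" by (simp add: z_of_chi_def h(7))
  finally show ?thesis .
qed

lemma exp_eq_S_strip:
  assumes "w \<in> S_strip" "w' \<in> S_strip" "exp (\<i> * w) = exp (\<i> * w')"
  shows "w = w'"
proof -
  obtain n :: int where n: "\<i> * w = \<i> * w' + of_int (2 * n) * of_real pi * \<i>"
    using assms(3) unfolding exp_eq by auto
  then have "Re w = Re w' + of_int (2 * n) * pi" "Im w = Im w'"
    by (auto simp: complex_eq_iff)
  moreover have "- pi < Re w" "Re w < pi" "- pi < Re w'" "Re w' < pi"
    using assms(1,2) by (auto simp: S_strip_def)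
  ultimately have *: "Re w = Re w' + 2 * (real_of_int n * pi)" "Im w = Im w'"
    "real_of_int n * pi < 1 * pi" "- 1 * pi < real_of_int n * pi" by linarith+
  then have "real_of_int n < 1" "- 1 < real_of_int n"
    by (simp_all only: mult_less_cancel_right_pos pi_gt_zero)
  then have "n = 0" by linarith
  with * show ?thesis by (simp add: complex_eq_iff)
qed

lemma inj_on_z_of_chi: "inj_on z_of_chi S_strip"
proof (rule inj_onI)
  fix w w' assume w: "w \<in> S_strip" "w' \<in> S_strip" "z_of_chi w = z_of_chi w'"
  then have "exp (\<i> * w) = exp (\<i> * w')"
    using rho_z_of_chi[of w] rho_z_of_chi[of w'] by (simp add: S_strip_def)
  with w show "w = w'" using exp_eq_S_strip by blast
qed

lemma Phi_S_eq:
  assumes "w \<in> S_strip"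
  shows "Phi_S w = Phi_ext w"
  unfolding Phi_S_def z_of_chi_Phi_ext[OF S_strip_subset_S_ext[OF assms], symmetric]
  using the_inv_into_f_f[OF inj_on_z_of_chi Phi_ext_in_S_strip[OF assms]] .

lemma S_ext_islimpt:
  assumes "w \<in> S_ext"
  shows "at w within S_strip \<noteq> bot"
proof -
  have "((\<lambda>n. w + \<i> * of_real (inverse (real (Suc n)))) \<longlongrightarrow> w + \<i> * of_real 0) sequentially"
    by (intro tendsto_intros LIMSEQ_inverse_real_of_nat)
  moreover have "w + \<i> * of_real (inverse (real (Suc n))) \<in> S_strip - {w}" for n
    using assms by (auto simp: S_strip_def S_ext_def simp del: of_nat_Suc intro: add_nonneg_pos)
  ultimately have "w islimpt S_strip"
    unfolding islimpt_sequential by (metis (no_types, lifting) add.right_neutral mult_zero_right of_real_0)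
  then show ?thesis by (simp add: trivial_limit_within)
qed

text \<open>The limit that defines \<Phi> on the boundary segments is evaluated through the
  continuity of the closed form.\<close>

lemma Phi_eq:
  assumes "w \<in> S_ext"
  shows "Phi w = Phi_ext w"
proof (cases "w \<in> S_strip")
  case True then show ?thesis by (simp add: Phi_def Phi_S_eq)
next
  case False
  have "(Phi_ext \<longlongrightarrow> Phi_ext w) (at w within S_strip)"
    using isCont_Phi_ext[OF assms] by (simp add: isCont_def tendsto_within_subset[of _ _ _ UNIV])
  then have "(Phi_S \<longlongrightarrow> Phi_ext w) (at w within S_strip)"
    by (rule Lim_transform_eventually) (auto simp: eventually_at_topological Phi_S_eq)
  then have "Lim (at w within S_strip) Phi_S = Phi_ext w"
    using S_ext_islimpt[OF assms] by (intro tendsto_Lim)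
  with False show ?thesis by (simp add: Phi_def)
qed

text \<open>The half L of the logarithm is principal: |Im L| < pi, since |Re w| / 2 and |arg (1 -
  q^2)| are below pi / 2. Moreover exp L = 2 / (1/q - q) has positive real part, so doubling does
  not leave the principal branch.\<close>

lemma log_ratio_eq_Ln:
  assumes "w \<in> S_strip"
  shows "log_ratio w = Ln (z_of_chi w / (1 - z_of_chi w))"
proof -
  define q where "q = exp (\<i> * w / 2)"
  have up: "Im w > 0" using assms by (simp add: S_strip_def)
  note h = half_exp_S_ext[OF S_strip_subset_S_ext[OF assms], folded q_def]
  have q1: "cmod (q\<^sup>2) < 1" using upper_exp_less_1[OF up] by (simp add: h(7))
  have re: "Re (1 - q\<^sup>2) > 0" using q1 complex_Re_le_cmod[of "q\<^sup>2"] by simp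
  then have nz: "1 - q\<^sup>2 \<noteq> 0" by auto
  have im: "\<bar>Im (Ln (1 - q\<^sup>2))\<bar> < pi / 2" using re nz Re_Ln_pos_lt by blast
  define L where "L = Ln 2 + \<i> * w / 2 - Ln (1 - q\<^sup>2)"
  have ln2: "Ln 2 = complex_of_real (ln 2)" by (metis Ln_of_real of_real_numeral zero_less_numeral)
  have "Im L = Re w / 2 - Im (Ln (1 - q\<^sup>2))" by (simp add: L_def ln2)
  then have imL: "- pi < Im L" "Im L < pi" using im assms by (auto simp: S_strip_def)
  have expL: "exp L = 2 * q / (1 - q\<^sup>2)" using nz by (simp add: L_def exp_add exp_diff q_def[symmetric])
  have ln4: "Ln 4 = 2 * Ln 2"
  proof -
    have "ln (4::real) = 2 * ln 2" using ln_realpow[of 2 2] by simp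
    moreover have "Ln 4 = complex_of_real (ln 4)" by (metis Ln_of_real of_real_numeral zero_less_numeral)
    ultimately show ?thesis by (simp add: ln2)
  qed
  have l: "log_ratio w = 2 * L" by (simp add: log_ratio_def L_def ln4 h(7))
  have "Re (1 / q - q) > 0"
  proof -
    have "Re (1 / q - q) = Re q * (1 / (cmod q)\<^sup>2 - 1)"
      unfolding cmod_power2 Re_divide by (simp add: Re_divide algebra_simps)
    moreover have "(cmod q)\<^sup>2 < 1" "(cmod q)\<^sup>2 > 0" using q1 h by (auto simp: norm_power)
    ultimately show ?thesis using h(1) by (simp add: mult_pos_pos)
  qed
  moreover have "2 * q / (1 - q\<^sup>2) = 2 / (1 / q - q)"
    using h nz by (simp add: field_simps power2_eq_square)
  ultimately have "Re (2 * q / (1 - q\<^sup>2)) > 0"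
    by (metis Re_two_divide_pos)
  then have "Re (exp L) > 0" by (simp add: expL)
  then have "Ln ((exp L)\<^sup>2) = 2 * Ln (exp L)" by (rule Ln_square)
  also have "Ln (exp L) = L" using imL by (intro Ln_exp) auto
  finally have "Ln ((exp L)\<^sup>2) = log_ratio w" by (simp add: l)
  moreover have "(exp L)\<^sup>2 = exp (log_ratio w)" by (simp add: l exp_double)
  ultimately show ?thesis using exp_log_ratio[OF up] by simp
qed

subsection \<open>Continuation along admissible paths\<close>

lemma isCont_rho:
  assumes "z \<notin> one_to_inf" "z \<noteq> 0"
  shows "isCont rho z"
  unfolding rho_def using assms one_minus_nonpos_Reals_iff[of z]
  by (intro continuous_intros isCont_o2[OF _ continuous_at_csqrt, of _ "\<lambda>z. 1 - z"]) auto

lemma continuous_on_cr [continuous_intros]: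
  assumes "A \<subseteq> (Dom :: 'n::finite config set)"
  shows "continuous_on A cr_u" "continuous_on A cr_v"
  using assms unfolding cr_u_def[abs_def] cr_v_def[abs_def]
  by (auto intro!: continuous_intros simp: xsq_Dom_nonzero subset_iff)

lemma path_logarithm:
  fixes f :: "real \<Rightarrow> complex"
  assumes "continuous_on {0..1} f" "\<And>s. s \<in> {0..1} \<Longrightarrow> f s \<noteq> 0" "f 0 = exp w"
  obtains g where "continuous_on {0..1} g" "g 0 = w" "\<And>s. s \<in> {0..1} \<Longrightarrow> f s = exp (g s)"
proof -
  obtain g where g: "continuous_on {0..1} g" "\<And>s. s \<in> {0..1} \<Longrightarrow> f s = exp (g s)"
    using continuous_logarithm_on_contractible[OF assms(1) convex_imp_contractible assms(2)]
    by (metis convex_real_interval(5))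
  show ?thesis
  proof (rule that[of "\<lambda>s. g s + (w - g 0)"])
    show "continuous_on {0..1} (\<lambda>s. g s + (w - g 0))" using g(1) by (intro continuous_intros)
    fix s :: real assume "s \<in> {0..1}"
    then show "f s = exp (g s + (w - g 0))"
      using g(2)[of s] g(2)[of 0] assms(3) by (simp add: exp_add exp_diff)
  qed simp
qed

lemma is_zzbar_sum: "is_zzbar C z zb \<Longrightarrow> z + zb = 1 + cr_u C - cr_v C"
  by (simp add: is_zzbar_def algebra_simps)

lemma is_zzbar_quadratic: "z + zb = 1 + cr_u C - cr_v C \<Longrightarrow> z * zb = cr_u C \<Longrightarrow> is_zzbar C z zb"
  by (simp add: is_zzbar_def algebra_simps)

text \<open>Off the locus the discriminant (z - zb)^2 has no zero, so its root lifts along the path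
  and separates z from zb. Both avoid 0 and [1,oo), so rho is continuous and nonzero along them and
  chi, chib lift as well.\<close>

lemma exists_lift:
  fixes \<gamma> :: "real \<Rightarrow> 'n::finite config"
  assumes "path \<gamma>" "path_image \<gamma> \<subseteq> Dom - Gamma_set"
    and 0: "is_zzbar (\<gamma> 0) z0 zb0" "rho z0 = exp (\<i> * chi0)" "rho zb0 = exp (\<i> * chib0)"
  obtains z zb chi chib where "continuous_on {0..1} z" "continuous_on {0..1} zb"
    "continuous_on {0..1} chi" "continuous_on {0..1} chib"
    "z 0 = z0" "zb 0 = zb0" "chi 0 = chi0" "chib 0 = chib0"
    "\<And>s. s \<in> {0..1} \<Longrightarrow> is_zzbar (\<gamma> s) (z s) (zb s)"
    "\<And>s. s \<in> {0..1} \<Longrightarrow> rho (z s) = exp (\<i> * chi s)"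
    "\<And>s. s \<in> {0..1} \<Longrightarrow> rho (zb s) = exp (\<i> * chib s)"
proof -
  have cont\<gamma>: "continuous_on {0..1} \<gamma>" using assms(1) by (simp add: path_def)
  have im: "\<gamma> s \<in> Dom - Gamma_set" if "s \<in> {0..1}" for s
    using that assms(2) unfolding path_image_def by blast
  define t where "t s = 1 + cr_u (\<gamma> s) - cr_v (\<gamma> s)" for s
  define D where "D s = (t s)\<^sup>2 - 4 * cr_u (\<gamma> s)" for s
  have sub: "\<gamma> ` {0..1} \<subseteq> Dom" using im by auto
  have contu: "continuous_on {0..1} (\<lambda>s. cr_u (\<gamma> s))" "continuous_on {0..1} (\<lambda>s. cr_v (\<gamma> s))"
    using continuous_on_compose[OF cont\<gamma>] continuous_on_cr[OF sub] by (auto simp: o_def)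
  then have contt: "continuous_on {0..1} t" unfolding t_def by (intro continuous_intros)
  then have contD: "continuous_on {0..1} D" unfolding D_def using contu by (intro continuous_intros)
  have Dnz: "D s \<noteq> 0" if "s \<in> {0..1}" for s
    using im[OF that] by (auto simp: D_def t_def Gamma_set_def)
  have D0: "D 0 = (z0 - zb0)\<^sup>2"
  proof -
    have "t 0 = z0 + zb0" "cr_u (\<gamma> 0) = z0 * zb0"
      using is_zzbar_sum[OF 0(1)] 0(1) by (auto simp: t_def is_zzbar_def)
    then show ?thesis unfolding D_def by algebra
  qed
  then have "z0 \<noteq> zb0" using Dnz[of 0] by auto
  \<comment> \<open>This starting value of the logarithm makes the lifted root start at
    \<open>z0 - zb0\<close> and not at its negative, which fixes the labelling.\<close>
  then have "D 0 = exp (2 * Ln (z0 - zb0))" by (simp add: exp_double D0)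
  then obtain l where l: "continuous_on {0..1} l" "l 0 = 2 * Ln (z0 - zb0)"
    "\<And>s. s \<in> {0..1} \<Longrightarrow> D s = exp (l s)"
    using path_logarithm[OF contD Dnz] by metis
  define r where "r s = exp (l s / 2)" for s
  have r2: "(r s)\<^sup>2 = D s" if "s \<in> {0..1}" for s
    using l(3)[OF that] by (simp add: r_def exp_double[symmetric])
  have r0: "r 0 = z0 - zb0" using l(2) \<open>z0 \<noteq> zb0\<close> by (simp add: r_def)
  define z where "z s = (t s + r s) / 2" for s
  define zb where "zb s = (t s - r s) / 2" for s
  have contr: "continuous_on {0..1} r" unfolding r_def by (intro continuous_intros l(1)) auto
  have contz: "continuous_on {0..1} z" "continuous_on {0..1} zb"
    unfolding z_def zb_def using contt contr by (auto intro!: continuous_intros)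
  have t0: "t 0 = z0 + zb0" using is_zzbar_sum[OF 0(1)] by (simp add: t_def)
  have z0: "z 0 = z0" "zb 0 = zb0" unfolding z_def zb_def t0 r0 by simp_all
  have zz: "is_zzbar (\<gamma> s) (z s) (zb s)" if "s \<in> {0..1}" for s
  proof (rule is_zzbar_quadratic)
    show "z s + zb s = 1 + cr_u (\<gamma> s) - cr_v (\<gamma> s)"
      by (simp add: z_def zb_def t_def field_simps)
    have "4 * (a / 2 * (b / 2)) = a * b" for a b :: complex by simp
    then have "4 * (z s * zb s) = (t s + r s) * (t s - r s)" unfolding z_def zb_def .
    also have "\<dots> = (t s)\<^sup>2 - (r s)\<^sup>2" by algebra
    finally have "4 * (z s * zb s) = (t s)\<^sup>2 - (r s)\<^sup>2" .
    then show "z s * zb s = cr_u (\<gamma> s)" unfolding r2[OF that] D_def by simp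
  qed
  have ok: "z s \<notin> one_to_inf" "z s \<noteq> 0" "zb s \<notin> one_to_inf" "zb s \<noteq> 0" if "s \<in> {0..1}" for s
    using Dom_zzbar[of "\<gamma> s"] zz[OF that] is_zzbar_commute im[OF that] by blast+
  have lift: "\<exists>g. continuous_on {0..1} g \<and> g 0 = w \<and> (\<forall>s\<in>{0..1}. rho (f s) = exp (\<i> * g s))"
    if f: "continuous_on {0..1} f" "\<And>s. s \<in> {0..1} \<Longrightarrow> f s \<notin> one_to_inf \<and> f s \<noteq> 0"
      "rho (f 0) = exp (\<i> * w)" for f :: "real \<Rightarrow> complex" and w
  proof -
    have "continuous_on (f ` {0..1}) rho"
      using isCont_rho f(2) by (intro continuous_at_imp_continuous_on) auto
    then have "continuous_on {0..1} (\<lambda>s. rho (f s))"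
      using f(1) continuous_on_compose by (fastforce simp: o_def)
    then obtain g where g: "continuous_on {0..1} g" "g 0 = \<i> * w" "\<And>s. s \<in> {0..1} \<Longrightarrow> rho (f s) = exp (g s)"
      using path_logarithm[of "\<lambda>s. rho (f s)" "\<i> * w"] rho_inverse(2) f(2,3) by metis
    have "continuous_on {0..1} (\<lambda>s. - \<i> * g s)" by (intro continuous_intros g(1))
    moreover have "- \<i> * g 0 = w" using g(2) by simp
    moreover have "rho (f s) = exp (\<i> * (- \<i> * g s))" if "s \<in> {0..1}" for s
      using g(3)[OF that] by simp
    ultimately show ?thesis by blast
  qed
  obtain chi where chi: "continuous_on {0..1} chi" "chi 0 = chi0" "\<forall>s\<in>{0..1}. rho (z s) = exp (\<i> * chi s)"
    using lift[of z chi0] contz ok z0 0 by auto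
  obtain chib where chib: "continuous_on {0..1} chib" "chib 0 = chib0" "\<forall>s\<in>{0..1}. rho (zb s) = exp (\<i> * chib s)"
    using lift[of zb chib0] contz ok z0 0 by auto
  show ?thesis using that[OF contz chi(1) chib(1) z0 chi(2) chib(2)] zz chi chib by blast
qed

text \<open>The Euclidean start is borrowed from the given path, so its labelling and the windows
  for chi and chib at s = 0 carry over unchanged.\<close>

lemma exists_admissible_path:
  fixes C :: "'n::finite config" and \<gamma>0 :: "real \<Rightarrow> 'n config"
  assumes "admissible_path \<gamma>0" "continuation \<gamma>0 z0 zb0 chi0 chib0" "C \<in> Dom - Gamma_set"
  obtains \<gamma> :: "real \<Rightarrow> 'n config" and z zb chi chib
  where "admissible_path \<gamma>" "pathfinish \<gamma> = C" "continuation \<gamma> z zb chi chib"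
proof -
  have start: "\<gamma>0 0 \<in> Dom_E - Gamma_set" using assms(1) by (simp add: admissible_path_def pathstart_def)
  then have "\<gamma>0 0 \<in> Dom - Gamma_set" by (auto simp: Dom_E_def)
  then obtain \<gamma> where \<gamma>: "path \<gamma>" "path_image \<gamma> \<subseteq> Dom - Gamma_set" "pathstart \<gamma> = \<gamma>0 0" "pathfinish \<gamma> = C"
    using Dom_minus_Gamma_path_connected assms(3) unfolding path_connected_def by metis
  have c0: "is_zzbar (\<gamma> 0) (z0 0) (zb0 0)" "rho (z0 0) = exp (\<i> * chi0 0)" "rho (zb0 0) = exp (\<i> * chib0 0)"
    using assms(2) \<gamma>(3) by (auto simp: continuation_def pathstart_def)
  obtain z zb chi chib where l: "continuous_on {0..1} z" "continuous_on {0..1} zb"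
    "continuous_on {0..1} chi" "continuous_on {0..1} chib"
    "z 0 = z0 0" "zb 0 = zb0 0" "chi 0 = chi0 0" "chib 0 = chib0 0"
    "\<And>s. s \<in> {0..1} \<Longrightarrow> is_zzbar (\<gamma> s) (z s) (zb s)"
    "\<And>s. s \<in> {0..1} \<Longrightarrow> rho (z s) = exp (\<i> * chi s)"
    "\<And>s. s \<in> {0..1} \<Longrightarrow> rho (zb s) = exp (\<i> * chib s)"
    using exists_lift[OF \<gamma>(1,2) c0] by metis
  have "continuation \<gamma> z zb chi chib"
    using assms(2) l unfolding continuation_def by auto
  moreover have "admissible_path \<gamma>"
    unfolding admissible_path_def
  proof (intro conjI)
    show "path_image \<gamma> \<subseteq> closure Dom" using \<gamma>(2) closure_subset by blast
    show "pathstart \<gamma> \<in> Dom_E - Gamma_set" using start \<gamma>(3) by simp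
    show "\<forall>s\<in>{0..<1}. \<gamma> s \<in> Dom - Gamma_set" using \<gamma>(2) unfolding path_image_def by (meson atLeastAtMost_iff atLeastLessThan_iff image_eqI less_imp_le subsetD)
  qed (rule \<gamma>(1))
  ultimately show ?thesis using that \<gamma>(4) by blast
qed

text \<open>The values lie in 2 pi i Z, which is discrete.\<close>

lemma continuous_exp_eq_1_constant:
  fixes h :: "'a::topological_space \<Rightarrow> complex"
  assumes "connected S" "continuous_on S h" "\<And>x. x \<in> S \<Longrightarrow> exp (h x) = 1" "a \<in> S" "x \<in> S"
  shows "h x = h a"
proof -
  have "h constant_on S"
  proof (rule continuous_discrete_range_constant[OF assms(1,2)])
    fix x assume x: "x \<in> S"
    have "1 \<le> norm (h y - h x)" if y: "y \<in> S" "h y \<noteq> h x" for y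
    proof -
      have "exp (h y) = exp (h x)" using assms(3) x y by simp
      then obtain n :: int where "h y = h x + of_int (2 * n) * of_real pi * \<i>"
        unfolding exp_eq by auto
      then have n: "h y - h x = of_int (2 * n) * of_real pi * \<i>" by simp
      with y have "n \<noteq> 0" by auto
      then have "1 * 1 \<le> \<bar>real_of_int (2 * n)\<bar> * pi" using pi_gt3 by (intro mult_mono) auto
      then show ?thesis unfolding n by (simp add: norm_mult abs_mult)
    qed
    then show "\<exists>e>0. \<forall>y. y \<in> S \<and> h y \<noteq> h x \<longrightarrow> e \<le> norm (h y - h x)"
      by (intro exI[of _ 1]) auto
  qed
  then show ?thesis using assms(4,5) by (auto simp: constant_on_def)
qed

text \<open>The branch of log (u / v) that is continuous on \<open>Dom\<close> and real on
  \<open>Dom_E\<close>.\<close>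

definition log_cross :: "'n::finite config \<Rightarrow> complex" where
  "log_cross C = Ln (xsq 1 2 C) + Ln (xsq 3 4 C) - Ln (xsq 2 3 C) - Ln (xsq 1 4 C)"

lemma continuous_on_Ln_xsq:
  "i \<noteq> j \<Longrightarrow> continuous_on Dom (\<lambda>C. Ln (xsq i j (C :: 'n::finite config)))"
  using xsq_Dom_notin_nonpos_Reals by (intro continuous_intros) auto

lemma continuous_on_log_cross: "continuous_on Dom (log_cross :: 'n::finite config \<Rightarrow> complex)"
  unfolding log_cross_def by (intro continuous_intros continuous_on_Ln_xsq) auto

lemma exp_log_cross:
  assumes nz: "\<And>i j. i \<noteq> j \<Longrightarrow> xsq i j C \<noteq> 0" and "is_zzbar C z zb"
  shows "exp (log_cross C) = z / (1 - z) * (zb / (1 - zb))"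
proof -
  have "exp (log_cross C) = xsq 1 2 C * xsq 3 4 C / (xsq 2 3 C * xsq 1 4 C)"
    by (simp add: log_cross_def exp_diff exp_add nz)
  also have "\<dots> = cr_u C / cr_v C"
    by (simp add: cr_u_def cr_v_def nz mult.commute)
  also have "\<dots> = z / (1 - z) * (zb / (1 - zb))"
    using assms(2) by (simp add: is_zzbar_def)
  finally show ?thesis .
qed

lemma z_of_chi_rho:
  assumes "z * (1 + r)\<^sup>2 = 4 * r" "r \<noteq> 0" "r = exp (\<i> * w)"
  shows "1 + r \<noteq> 0" "z = z_of_chi w"
proof -
  show "1 + r \<noteq> 0" using assms(1,2) by auto
  then show "z = z_of_chi w"
    unfolding z_of_chi_def using assms by (simp add: field_simps)
qed

lemma rho_exp_Im_pos:
  assumes "z \<notin> one_to_inf" "z \<noteq> 0" "rho z = exp (\<i> * w)"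
  shows "Im w > 0" "z = z_of_chi w"
proof -
  show "Im w > 0" using rho_inverse(1)[OF assms(1,2)] unfolding assms(3) by (simp add: norm_exp_eq_Re)
  show "z = z_of_chi w"
    using rho_inverse[OF assms(1,2)] assms(3) z_of_chi_rho(2)[of z "rho z" w] by simp
qed

lemma continuation_before_end:
  assumes "admissible_path \<gamma>" "continuation \<gamma> z zb chi chib" "s \<in> {0..<1}"
  shows "\<gamma> s \<in> Dom" "Im (chi s) > 0" "Im (chib s) > 0" "z s = z_of_chi (chi s)" "zb s = z_of_chi (chib s)"
proof -
  show D: "\<gamma> s \<in> Dom" using assms(1,3) by (auto simp: admissible_path_def)
  have zz: "is_zzbar (\<gamma> s) (z s) (zb s)" and r: "rho (z s) = exp (\<i> * chi s)" "rho (zb s) = exp (\<i> * chib s)"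
    using assms(2,3) by (auto simp: continuation_def)
  note zz' = zz[THEN is_zzbar_commute[THEN iffD1]]
  show "Im (chi s) > 0" "z s = z_of_chi (chi s)"
    by (rule rho_exp_Im_pos[OF Dom_zzbar(1,2)[OF D zz] r(1)])+
  show "Im (chib s) > 0" "zb s = z_of_chi (chib s)"
    by (rule rho_exp_Im_pos[OF Dom_zzbar(1,2)[OF D zz'] r(2)])+
qed

text \<open>At s = 1 the relation with \<open>rho\<close> is not imposed, but z (1 + r)^2 = 4 r for
  r = exp (i chi) is polynomial and passes to the limit. As r is nonzero, it excludes r =
  -1.\<close>

lemma continuation_end:
  assumes "admissible_path \<gamma>" "continuation \<gamma> z zb chi chib"
  shows "z 1 = z_of_chi (chi 1)" "zb 1 = z_of_chi (chib 1)"
    "1 + exp (\<i> * chi 1) \<noteq> 0" "1 + exp (\<i> * chib 1) \<noteq> 0" "Im (chi 1) \<ge> 0" "Im (chib 1) \<ge> 0"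
    "z 1 * (1 + exp (\<i> * chi 1))\<^sup>2 = 4 * exp (\<i> * chi 1)"
    "zb 1 * (1 + exp (\<i> * chib 1))\<^sup>2 = 4 * exp (\<i> * chib 1)"
proof -
  note int = continuation_before_end(2-5)[OF assms]
  have cont: "continuous_on {0..1} z" "continuous_on {0..1} zb" "continuous_on {0..1} chi" "continuous_on {0..1} chib"
    using assms(2) by (auto simp: continuation_def)
  have cl: "closure {0..<1::real} = {0..1}" by simp
  have lim: "z' 1 * (1 + exp (\<i> * chi' 1))\<^sup>2 - 4 * exp (\<i> * chi' 1) = 0 \<and> Im (chi' 1) \<ge> 0"
    if c: "continuous_on {0..1} z'" "continuous_on {0..1} chi'"
      and h: "\<And>s. s \<in> {0..<1} \<Longrightarrow> Im (chi' s) > 0 \<and> z' s = z_of_chi (chi' s)" for z' chi' :: "real \<Rightarrow> complex"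
  proof
    have "z' s * (1 + exp (\<i> * chi' s))\<^sup>2 - 4 * exp (\<i> * chi' s) = 0" if "s \<in> {0..<1}" for s
    proof -
      have "1 + exp (\<i> * chi' s) \<noteq> 0"
        using upper_exp_less_1[of "chi' s"] h[OF that]
        by (metis add_eq_0_iff norm_minus_cancel norm_one less_irrefl)
      moreover have "4 * r / (1 + r)\<^sup>2 * (1 + r)\<^sup>2 - 4 * r = 0" if "1 + r \<noteq> 0" for r :: complex
        using that by simp
      ultimately show ?thesis using h[OF that] unfolding z_of_chi_def by metis
    qed
    moreover have F: "continuous_on {0..1} (\<lambda>s. z' s * (1 + exp (\<i> * chi' s))\<^sup>2 - 4 * exp (\<i> * chi' s))"
      using c by (intro continuous_intros)
    ultimately show "z' 1 * (1 + exp (\<i> * chi' 1))\<^sup>2 - 4 * exp (\<i> * chi' 1) = 0"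
      using continuous_constant_on_closure[of "{0..<1}" "\<lambda>s. z' s * (1 + exp (\<i> * chi' s))\<^sup>2 - 4 * exp (\<i> * chi' s)" 0 1]
      unfolding cl by (metis F atLeastAtMost_iff order_refl zero_le_one)
    have G: "continuous_on {0..1} (\<lambda>s. Im (chi' s))" using c by (intro continuous_intros)
    show "Im (chi' 1) \<ge> 0"
      using continuous_ge_on_closure[of "{0..<1}" "\<lambda>s. Im (chi' s)" 1 0] G h less_imp_le
      unfolding cl by (metis atLeastAtMost_iff order_refl zero_le_one)
  qed
  have "z 1 * (1 + exp (\<i> * chi 1))\<^sup>2 - 4 * exp (\<i> * chi 1) = 0 \<and> Im (chi 1) \<ge> 0"
    by (rule lim[OF cont(1,3)]) (intro conjI int(1,3))
  then show l1: "z 1 * (1 + exp (\<i> * chi 1))\<^sup>2 = 4 * exp (\<i> * chi 1)" and "Im (chi 1) \<ge> 0"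
    unfolding right_minus_eq by blast+
  have "zb 1 * (1 + exp (\<i> * chib 1))\<^sup>2 - 4 * exp (\<i> * chib 1) = 0 \<and> Im (chib 1) \<ge> 0"
    by (rule lim[OF cont(2,4)]) (intro conjI int(2,4))
  then show l2: "zb 1 * (1 + exp (\<i> * chib 1))\<^sup>2 = 4 * exp (\<i> * chib 1)" and "Im (chib 1) \<ge> 0"
    unfolding right_minus_eq by blast+
  show "z 1 = z_of_chi (chi 1)" "zb 1 = z_of_chi (chib 1)"
    "1 + exp (\<i> * chi 1) \<noteq> 0" "1 + exp (\<i> * chib 1) \<noteq> 0"
    using z_of_chi_rho[OF l1 exp_not_eq_zero refl] z_of_chi_rho[OF l2 exp_not_eq_zero refl] by blast+
qed

lemma continuation_interior:
  assumes "admissible_path \<gamma>" "continuation \<gamma> z zb chi chib" "s \<in> {0..1}" "s < 1 \<or> \<gamma> s \<in> Dom"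
  shows "\<gamma> s \<in> Dom" "Im (chi s) > 0" "Im (chib s) > 0" "z s = z_of_chi (chi s)" "zb s = z_of_chi (chib s)"
proof -
  have "\<gamma> s \<in> Dom \<and> Im (chi s) > 0 \<and> Im (chib s) > 0 \<and> z s = z_of_chi (chi s) \<and> zb s = z_of_chi (chib s)"
  proof (cases "s < 1")
    case True
    then have "s \<in> {0..<1}" using assms(3) by simp
    from continuation_before_end[OF assms(1,2) this] show ?thesis by (intro conjI)
  next
    case False
    then have s: "s = 1" and D: "\<gamma> 1 \<in> Dom" using assms(3,4) by auto
    note e = continuation_end[OF assms(1,2)]
    have "is_zzbar (\<gamma> 1) (z 1) (zb 1)" using assms(2) by (simp add: continuation_def)
    note zz = this this[THEN is_zzbar_commute[THEN iffD1]]
    have "norm (exp (\<i> * chi 1)) \<noteq> 1"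
      using unit_rho_one_to_inf[OF e(7)] Dom_zzbar(1)[OF D zz(1)] by blast
    then have "Im (chi 1) \<noteq> 0" by (simp add: norm_exp_eq_Re)
    moreover have "norm (exp (\<i> * chib 1)) \<noteq> 1"
      using unit_rho_one_to_inf[OF e(8)] Dom_zzbar(1)[OF D zz(2)] by blast
    then have "Im (chib 1) \<noteq> 0" by (simp add: norm_exp_eq_Re)
    ultimately show ?thesis unfolding s using e(1,2,5,6) D by (intro conjI) simp_all
  qed
  then show "\<gamma> s \<in> Dom" "Im (chi s) > 0" "Im (chib s) > 0" "z s = z_of_chi (chi s)" "zb s = z_of_chi (chib s)"
    by simp_all
qed

lemma xsq_Dom_E:
  assumes "C \<in> Dom_E" "i \<noteq> j"
  obtains x where "xsq i j C = of_real x" "x > 0"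
proof -
  obtain a b where "fst C $ i = of_real a" "fst C $ j = of_real b"
    using assms(1) by (auto simp: Dom_E_def elim!: Reals_cases) (metis Reals_cases)
  then have "xsq i j C = of_real ((a - b)\<^sup>2 + (norm (snd C $ i - snd C $ j))\<^sup>2)"
    by (simp add: xsq_def)
  moreover have "C \<in> Dom" using assms(1) unfolding Dom_E_def by blast
  then have "xsq i j C \<noteq> 0" using assms(2) by (rule xsq_Dom_nonzero)
  ultimately show ?thesis
    using that by (metis add_nonneg_nonneg less_le of_real_0 zero_le_power2)
qed

lemma z_of_chi_minus_cnj: "z_of_chi (- cnj w) = cnj (z_of_chi w)"
  by (simp add: z_of_chi_def exp_cnj)

text \<open>The difference of the two sides has exponential 1 and so is constant along the path; at
  the start zb is the conjugate of z and the difference is real, hence 0.\<close>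

lemma continuation_log_cross:
  assumes "admissible_path \<gamma>" "continuation \<gamma> z zb chi chib" "s \<in> {0..1}" "s < 1 \<or> \<gamma> s \<in> Dom"
  shows "log_ratio (chi s) + log_ratio (chib s) = log_cross (\<gamma> s)"
proof -
  \<comment> \<open>The end point is included only if it lies in \<open>Dom\<close>:
    \<open>T\<close> is [0,1) or [0,1], connected in both cases.\<close>
  define T where "T = {s \<in> {0..1}. \<gamma> s \<in> Dom}"
  define h where "h s = log_ratio (chi s) + log_ratio (chib s) - log_cross (\<gamma> s)" for s
  have T01: "s \<in> T" if "s \<in> {0..<1}" for s
  proof -
    have s: "s \<in> {0..1}" "s < 1" using that by auto
    have "\<gamma> s \<in> Dom"
      by (rule continuation_interior(1)[OF assms(1,2) s(1) disjI1[OF s(2)]])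
    with s(1) show ?thesis
      unfolding T_def by simp
  qed
  have sub: "{0..<1} \<subseteq> T" using T01 by (rule subsetI)
  have "T \<subseteq> {0..1}" unfolding T_def by (rule Collect_restrict)
  moreover have ins: "{0..1::real} = insert 1 {0..<1}" by auto
  ultimately have sup: "T \<subseteq> insert 1 {0..<1}" by simp
  have "T = A \<or> T = insert a A" if "A \<subseteq> T" "T \<subseteq> insert a A" for A :: "real set" and a
    using that by blast
  from this[OF sub sup] have "T = {0..<1} \<or> T = {0..1}" unfolding ins .
  then have conn: "connected T" by (elim disjE) simp_all
  have int: "Im (chi s) > 0" "Im (chib s) > 0" "z s = z_of_chi (chi s)" "zb s = z_of_chi (chib s)"
    if "s \<in> T" for s
  proof -
    have s: "s \<in> {0..1}" "\<gamma> s \<in> Dom" using that by (auto simp: T_def)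
    show "Im (chi s) > 0" "Im (chib s) > 0" "z s = z_of_chi (chi s)" "zb s = z_of_chi (chib s)"
      by (fact continuation_interior[OF assms(1,2) s(1) disjI2[OF s(2)]])+
  qed
  have cont: "continuous_on T chi" "continuous_on T chib" "continuous_on T \<gamma>"
    using assms(1,2) unfolding continuation_def admissible_path_def path_def
    by (auto intro: continuous_on_subset simp: T_def)
  have cl: "continuous_on {w. Im w > 0} log_ratio"
    using holomorphic_on_log_ratio by (rule holomorphic_on_imp_continuous_on)
  have "continuous_on T h"
    unfolding h_def
    by (intro continuous_intros continuous_on_compose2[OF cl] continuous_on_compose2[OF continuous_on_log_cross] cont)
       (use int in \<open>auto simp: T_def\<close>)
  moreover have "exp (h s) = 1" if "s \<in> T" for s
  proof -
    have zz: "is_zzbar (\<gamma> s) (z s) (zb s)" "\<gamma> s \<in> Dom" using assms(2) that by (auto simp: continuation_def T_def)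
    have "exp (h s) = (z s / (1 - z s) * (zb s / (1 - zb s))) / exp (log_cross (\<gamma> s))"
      using int[OF that] by (simp add: h_def exp_diff exp_add exp_log_ratio)
    then show ?thesis using exp_log_cross[OF xsq_Dom_nonzero[OF zz(2)] zz(1)] by (metis divide_self exp_not_eq_zero)
  qed
  moreover have "0 \<in> T" "s \<in> T" using T01[of 0] T01[of s] assms(3,4) by (auto simp: T_def)
  ultimately have "h s = h 0" and "exp (h 0) = 1"
    using continuous_exp_eq_1_constant[OF conn, of h 0 s] by auto
  moreover have "h 0 \<in> \<real>"
  proof -
    have E: "\<gamma> 0 \<in> Dom_E" using assms(1) by (auto simp: admissible_path_def pathstart_def)
    have "Ln (xsq i j (\<gamma> 0)) \<in> \<real>" if "i \<noteq> j" for i j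
      using xsq_Dom_E[OF E that] by (metis Ln_of_real Reals_of_real)
    then have lc: "log_cross (\<gamma> 0) \<in> \<real>" unfolding log_cross_def by (intro Reals_add Reals_diff) auto
    have xr: "xsq i j (\<gamma> 0) \<in> \<real>" if "i \<noteq> j" for i j
      using xsq_Dom_E[OF E that] by (metis Reals_of_real)
    have "cr_u (\<gamma> 0) \<in> \<real>" "cr_v (\<gamma> 0) \<in> \<real>" unfolding cr_u_def cr_v_def using xr by auto
    moreover have zz: "is_zzbar (\<gamma> 0) (z 0) (zb 0)" and im0: "Im (z 0) > 0"
      using assms(2) by (auto simp: continuation_def)
    ultimately have "Im (z 0 + zb 0) = 0" "Im (z 0 * zb 0) = 0"
      using is_zzbar_sum[OF zz] by (auto simp: is_zzbar_def complex_is_Real_iff)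
    then have im: "Im (zb 0) = - Im (z 0)" and "Re (z 0) * Im (zb 0) + Im (z 0) * Re (zb 0) = 0"
      by auto
    then have "Im (z 0) * (Re (zb 0) - Re (z 0)) = 0" unfolding im by (simp add: algebra_simps)
    with im0 im have zb: "zb 0 = cnj (z 0)" by (simp add: complex_eq_iff)
    have r0: "rho (zb 0) = exp (\<i> * chib 0)" using assms(2) by (auto simp: continuation_def)
    have i0: "Im (chi 0) > 0" "z 0 = z_of_chi (chi 0)" using int[OF \<open>0 \<in> T\<close>] by auto
    have "rho (zb 0) = exp (\<i> * (- cnj (chi 0)))"
      unfolding zb i0(2) z_of_chi_minus_cnj[symmetric] by (rule rho_z_of_chi) (simp add: i0(1))
    with r0 have "exp (\<i> * chib 0) = exp (\<i> * (- cnj (chi 0)))" by simp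
    then obtain n :: int where n: "\<i> * chib 0 = \<i> * (- cnj (chi 0)) + of_int (2 * n) * of_real pi * \<i>"
      unfolding exp_eq by auto
    then have n': "Re (chib 0) = - Re (chi 0) + 2 * (real_of_int n * pi)" "Im (chib 0) = Im (chi 0)"
      by (auto simp: complex_eq_iff)
    moreover have "0 \<le> Re (chi 0)" "Re (chi 0) \<le> pi" "- pi \<le> Re (chib 0)" "Re (chib 0) \<le> 0"
      using assms(2) by (auto simp: continuation_def)
    \<comment> \<open>The windows at s = 0 give |Re chi + Re chib| <= pi, while this sum is 2 n
      pi.\<close>
    ultimately have "real_of_int n * pi < 1 * pi" "- 1 * pi < real_of_int n * pi"
      using pi_gt_zero by linarith+
    then have "real_of_int n < 1" "- 1 < real_of_int n"
      by (simp_all only: mult_less_cancel_right_pos pi_gt_zero)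
    then have "n = 0" by linarith
    with n' have "chib 0 = - cnj (chi 0)" by (simp add: complex_eq_iff)
    then have "log_ratio (chib 0) = cnj (log_ratio (chi 0))" using log_ratio_minus_cnj[OF i0(1)] by simp
    then show ?thesis unfolding h_def using lc
      by (auto simp: complex_is_Real_iff)
  qed
  ultimately have "h s = 0"
    by (auto elim!: Reals_cases) (metis exp_eq_one_iff exp_of_real of_real_eq_1_iff)
  then show ?thesis by (simp add: h_def)
qed

subsection \<open>The series and its crossing symmetry\<close>

text \<open>The clauses of \<open>euclidean_four_point\<close> that concern \<open>b\<close> alone,
  free of the configuration space and its dimension.\<close>

definition ope_coeff :: "(real \<Rightarrow> real \<Rightarrow> real) \<Rightarrow> bool" where
  "ope_coeff b \<longleftrightarrow>
     (\<forall>h\<ge>0. \<forall>hb\<ge>0. b h hb \<ge> 0 \<and> (b h hb \<noteq> 0 \<longrightarrow> h - hb \<in> \<int>)) \<and>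
     (\<forall>r rb. 0 < r \<and> r < 1 \<and> 0 < rb \<and> rb < 1 \<longrightarrow>
        (\<lambda>(h, hb). b h hb * r powr h * rb powr hb) summable_on ({0..} \<times> {0..}))"

definition g_majorant :: "(real \<Rightarrow> real \<Rightarrow> real) \<Rightarrow> real \<Rightarrow> real \<times> real \<Rightarrow> real" where
  "g_majorant b y = (\<lambda>(h, hb). b h hb * exp (- y) powr h * exp (- y) powr hb)"

lemma g_majorant_summable: "ope_coeff b \<Longrightarrow> y > 0 \<Longrightarrow> g_majorant b y summable_on ({0..} \<times> {0..})"
  unfolding ope_coeff_def g_majorant_def by auto

lemma norm_g_term_le:
  assumes "ope_coeff b" "x \<in> {0..} \<times> {0..}" "y \<le> Im w" "y \<le> Im wb"
  shows "norm (g_term b w wb x) \<le> g_majorant b y x"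
proof -
  obtain h hb where x: "x = (h, hb)" "h \<ge> 0" "hb \<ge> 0" using assms(2) by (cases x) auto
  have b: "b h hb \<ge> 0" using assms(1) x by (auto simp: ope_coeff_def)
  have "norm (g_term b w wb x) = b h hb * exp (- h * Im w - hb * Im wb)"
    using b by (simp add: x g_term_def norm_mult)
  also have "\<dots> \<le> b h hb * exp (- h * y - hb * y)"
  proof -
    have "h * y \<le> h * Im w" "hb * y \<le> hb * Im wb" using assms x by (auto intro: mult_left_mono)
    then show ?thesis using b by (intro mult_left_mono) auto
  qed
  also have "\<dots> = g_majorant b y x"
    by (simp add: x g_majorant_def exp_powr_real mult_exp_exp algebra_simps)
  finally show ?thesis .
qed

lemma g_term_summable:
  assumes "ope_coeff b" "Im w > 0" "Im wb > 0"
  shows "g_term b w wb summable_on ({0..} \<times> {0..})"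
proof -
  define y where "y = min (Im w) (Im wb)"
  have "(\<lambda>x. norm (g_term b w wb x)) summable_on ({0..} \<times> {0..})"
    by (rule Infinite_Sum.abs_summable_on_comparison_test'[OF g_majorant_summable[of b y]])
       (use assms in \<open>auto simp: y_def intro!: norm_g_term_le\<close>)
  then show ?thesis by (rule abs_summable_summable)
qed

text \<open>Opposite shifts multiply the term (h,hb) by exp (2 pi i n (h - hb)), which is 1 because
  h - hb is an integer wherever b is nonzero.\<close>

lemma g_series_shift:
  assumes "ope_coeff b"
  shows "g_series b (w + 2 * of_int n * of_real pi) (wb - 2 * of_int n * of_real pi) = g_series b w wb"
proof -
  have "g_term b (w + 2 * of_int n * of_real pi) (wb - 2 * of_int n * of_real pi) x = g_term b w wb x"
    if x0: "x \<in> {0..} \<times> {0..}" for x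
  proof -
    obtain h hb where x: "x = (h, hb)" "h \<ge> 0" "hb \<ge> 0" using x0 by (cases x) auto
    show ?thesis
    proof (cases "b h hb = 0")
      case True then show ?thesis by (simp add: x g_term_def)
    next
      case False
      then have "h - hb \<in> \<int>" using assms x unfolding ope_coeff_def by blast
      then obtain m where "h - hb = real_of_int m" by (rule Ints_cases)
      then have h: "h = hb + of_int m" by simp
      have e1: "\<i> * of_real h * (w + 2 * of_int n * of_real pi) + \<i> * of_real hb * (wb - 2 * of_int n * of_real pi)
          = (\<i> * of_real h * w + \<i> * of_real hb * wb) + 2 * of_int (m * n) * of_real pi * \<i>"
        by (simp add: h algebra_simps)
      have e2: "exp (2 * of_int (m * n) * of_real pi * \<i>) = (1::complex)"
        using exp_integer_2pi[of "of_int (m * n)"] by (simp add: algebra_simps)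
      show ?thesis
        unfolding x g_term_def prod.case e1 by (subst exp_add) (simp only: e2 mult_1_right)
    qed
  qed
  then show ?thesis unfolding g_series_def by (rule infsum_cong)
qed

text \<open>Formulated along one-variable holomorphic maps because the identity theorem is applied
  to one variable at a time. On a closed disc the smallest imaginary part is attained and positive,
  which gives one summable majorant for the whole disc.\<close>

lemma g_series_holomorphic:
  assumes "ope_coeff b" "open V" "f holomorphic_on V" "k holomorphic_on V"
    and pos: "\<And>\<zeta>. \<zeta> \<in> V \<Longrightarrow> Im (f \<zeta>) > 0 \<and> Im (k \<zeta>) > 0"
  shows "(\<lambda>\<zeta>. g_series b (f \<zeta>) (k \<zeta>)) holomorphic_on V"
proof -
  have "\<exists>e>0. (\<lambda>\<zeta>. g_series b (f \<zeta>) (k \<zeta>)) holomorphic_on ball \<zeta>0 e" if \<zeta>0: "\<zeta>0 \<in> V" for \<zeta>0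
  proof -
    have "\<exists>e>0. cball \<zeta>0 e \<subseteq> V" using assms(2) \<zeta>0 unfolding open_contains_cball by (rule bspec)
    then obtain e where e: "e > 0" "cball \<zeta>0 e \<subseteq> V" by (elim exE conjE)
    have contf: "continuous_on (cball \<zeta>0 e) f"
      by (rule holomorphic_on_imp_continuous_on[OF holomorphic_on_subset[OF assms(3) e(2)]])
    have contk: "continuous_on (cball \<zeta>0 e) k"
      by (rule holomorphic_on_imp_continuous_on[OF holomorphic_on_subset[OF assms(4) e(2)]])
    have cont: "continuous_on (cball \<zeta>0 e) (\<lambda>\<zeta>. min (Im (f \<zeta>)) (Im (k \<zeta>)))"
      by (intro continuous_intros contf contk)
    have "cball \<zeta>0 e \<noteq> {}" using e(1) by simp
    from continuous_attains_inf[OF compact_cball this cont] obtain \<zeta>1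
      where \<zeta>1: "\<zeta>1 \<in> cball \<zeta>0 e"
        "\<forall>\<zeta>\<in>cball \<zeta>0 e. min (Im (f \<zeta>1)) (Im (k \<zeta>1)) \<le> min (Im (f \<zeta>)) (Im (k \<zeta>))"
      by blast
    define y where "y = min (Im (f \<zeta>1)) (Im (k \<zeta>1))"
    have "\<zeta>1 \<in> V" using \<zeta>1(1) e(2) by blast
    then have y: "y > 0" using pos[of \<zeta>1] by (simp add: y_def)
    have ylef: "y \<le> Im (f \<zeta>)" "y \<le> Im (k \<zeta>)" if "\<zeta> \<in> cball \<zeta>0 e" for \<zeta>
      using bspec[OF \<zeta>1(2) that] by (simp_all add: y_def)
    have ul: "uniform_limit (cball \<zeta>0 e) (\<lambda>X \<zeta>. \<Sum>x\<in>X. g_term b (f \<zeta>) (k \<zeta>) x)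
        (\<lambda>\<zeta>. g_series b (f \<zeta>) (k \<zeta>)) (finite_subsets_at_top ({0..} \<times> {0..}))"
      unfolding g_series_def
      by (rule Weierstrass_m_test_general[OF _ g_majorant_summable[OF assms(1) y]])
        (rule norm_g_term_le[OF assms(1) _ ylef])
    have hol: "(\<lambda>\<zeta>. \<Sum>x\<in>X. g_term b (f \<zeta>) (k \<zeta>) x) holomorphic_on cball \<zeta>0 e" for X
      unfolding g_term_def case_prod_unfold
      by (intro holomorphic_intros holomorphic_on_subset[OF assms(3) e(2)] holomorphic_on_subset[OF assms(4) e(2)])
    have "eventually (\<lambda>X. continuous_on (cball \<zeta>0 e) (\<lambda>\<zeta>. \<Sum>x\<in>X. g_term b (f \<zeta>) (k \<zeta>) x) \<and>
        (\<lambda>\<zeta>. \<Sum>x\<in>X. g_term b (f \<zeta>) (k \<zeta>) x) holomorphic_on ball \<zeta>0 e) (finite_subsets_at_top ({0..} \<times> {0..}))"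
      by (intro always_eventually allI conjI holomorphic_on_imp_continuous_on[OF hol]
          holomorphic_on_subset[OF hol ball_subset_cball])
    from holomorphic_uniform_limit[OF this ul] have "(\<lambda>\<zeta>. g_series b (f \<zeta>) (k \<zeta>)) holomorphic_on ball \<zeta>0 e"
      by (simp add: finite_subsets_at_top_neq_bot)
    with e(1) show ?thesis by (intro exI[of _ e] conjI)
  qed
  then have "(\<lambda>\<zeta>. g_series b (f \<zeta>) (k \<zeta>)) analytic_on V" unfolding analytic_on_def by (intro ballI)
  then show ?thesis by (rule analytic_imp_holomorphic)
qed

section \<open>The identity theorem on the Euclidean slice, and crossing\<close>

definition strip :: "real \<Rightarrow> complex set" where
  "strip A = {w. \<bar>Re w\<bar> < A \<and> Im w > 0}"

text \<open>The substitution \<open>w = \<alpha> + \<i> \<beta>\<close>, \<open>wb = -\<alpha> + \<i> \<beta>\<close> turns the totally real slice \<open>wb = - cnj w\<close> into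
  real \<open>\<alpha>\<close>, \<open>\<beta>\<close>, so that the one-variable identity theorem can be applied first in \<open>\<alpha>\<close>, then in \<open>\<beta>\<close>.\<close>
lemma strip_slice_identity:
  fixes H :: "complex \<Rightarrow> complex \<Rightarrow> complex"
  assumes hol: "\<And>f k V. open V \<Longrightarrow> f holomorphic_on V \<Longrightarrow> k holomorphic_on V \<Longrightarrow>
      f ` V \<subseteq> strip A \<Longrightarrow> k ` V \<subseteq> strip A \<Longrightarrow> (\<lambda>\<zeta>. H (f \<zeta>) (k \<zeta>)) holomorphic_on V"
    and slice: "\<And>w. w \<in> strip A \<Longrightarrow> H w (- cnj w) = 0"
    and w: "w \<in> strip A" "wb \<in> strip A"
  shows "H w wb = 0"
proof -
  have A: "A > 0" using w by (auto simp: strip_def)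
  \<comment> \<open>For fixed real \<beta> the slice consists of real \<alpha>; the identity theorem
    extends the vanishing to complex \<alpha>.\<close>
  have step1: "H (\<alpha> + \<i> * of_real \<beta>) (- \<alpha> + \<i> * of_real \<beta>) = 0" if \<alpha>: "\<bar>Re \<alpha>\<bar> < A" "\<bar>Im \<alpha>\<bar> < \<beta>" for \<alpha> \<beta>
  proof -
    define V where "V = {\<zeta>. \<bar>Re \<zeta>\<bar> < A \<and> \<bar>Im \<zeta>\<bar> < \<beta>}"
    have V: "V = {\<zeta>. Re \<zeta> < A} \<inter> {\<zeta>. Re \<zeta> > - A} \<inter> {\<zeta>. Im \<zeta> < \<beta>} \<inter> {\<zeta>. Im \<zeta> > - \<beta>}"
      by (auto simp: V_def)
    have "open V" unfolding V by (intro open_Int open_halfspace_Re_lt open_halfspace_Re_gt open_halfspace_Im_lt open_halfspace_Im_gt)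
    have "convex V" unfolding V by (intro convex_Int convex_halfspace_Re_lt convex_halfspace_Re_gt convex_halfspace_Im_lt convex_halfspace_Im_gt)
    define U where "U = complex_of_real ` {0..<A}"
    show ?thesis
    proof (rule analytic_continuation[of "\<lambda>\<zeta>. H (\<zeta> + \<i> * of_real \<beta>) (- \<zeta> + \<i> * of_real \<beta>)" V U 0 \<alpha>])
      show "(\<lambda>\<zeta>. H (\<zeta> + \<i> * of_real \<beta>) (- \<zeta> + \<i> * of_real \<beta>)) holomorphic_on V"
        by (rule hol[OF \<open>open V\<close>]) (auto intro!: holomorphic_intros simp: V_def strip_def)
      show "open V" "connected V" using \<open>open V\<close> \<open>convex V\<close> convex_connected by auto
      show "U \<subseteq> V" "0 \<in> V" "\<alpha> \<in> V" using \<alpha> A by (auto simp: U_def V_def)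
      show "0 islimpt U"
        unfolding islimpt_approachable
      proof (intro allI impI)
        fix e :: real assume "e > 0"
        then show "\<exists>x'\<in>U. x' \<noteq> 0 \<and> dist x' 0 < e"
          using A by (intro bexI[of _ "of_real (min (A / 2) (e / 2))"]) (auto simp: U_def min_def)
      qed
      fix \<zeta> assume "\<zeta> \<in> U"
      then obtain x where x: "\<zeta> = of_real x" "0 \<le> x" "x < A" by (auto simp: U_def)
      have "\<zeta> + \<i> * of_real \<beta> \<in> strip A" using x \<alpha> by (auto simp: strip_def)
      from slice[OF this] show "H (\<zeta> + \<i> * of_real \<beta>) (- \<zeta> + \<i> * of_real \<beta>) = 0"
        by (simp add: x)
    qed
  qed
  define \<alpha> where "\<alpha> = (w - wb) / 2"
  define \<beta> where "\<beta> = - (\<i> * ((w + wb) / 2))"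
  have wab: "\<alpha> + \<i> * \<beta> = w" "- \<alpha> + \<i> * \<beta> = wb" by (simp_all add: \<alpha>_def \<beta>_def algebra_simps) (simp_all add: field_simps)
  have re\<alpha>: "\<bar>Re \<alpha>\<bar> < A" using w by (auto simp: strip_def \<alpha>_def)
  define m where "m = \<bar>Im \<alpha>\<bar>"
  define a where "a = A - \<bar>Re \<alpha>\<bar>"
  have a: "a > 0" using re\<alpha> by (simp add: a_def)
  \<comment> \<open>For these \<zeta> both \<alpha> + i \<zeta> and - \<alpha> + i \<zeta> lie in
    the strip; for the real ones \<open>step1\<close> applies.\<close>
  define V where "V = {\<zeta>. m < Re \<zeta> \<and> \<bar>Im \<zeta>\<bar> < a}"
  have V: "V = {\<zeta>. Re \<zeta> > m} \<inter> {\<zeta>. Im \<zeta> < a} \<inter> {\<zeta>. Im \<zeta> > - a}"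
    by (auto simp: V_def)
  have "open V" unfolding V by (intro open_Int open_halfspace_Re_gt open_halfspace_Im_lt open_halfspace_Im_gt)
  have "convex V" unfolding V by (intro convex_Int convex_halfspace_Re_gt convex_halfspace_Im_lt convex_halfspace_Im_gt)
  define U where "U = complex_of_real ` {m<..}"
  have "H (\<alpha> + \<i> * \<beta>) (- \<alpha> + \<i> * \<beta>) = 0"
  proof (rule analytic_continuation[of "\<lambda>\<zeta>. H (\<alpha> + \<i> * \<zeta>) (- \<alpha> + \<i> * \<zeta>)" V U "of_real (m + 1)" \<beta>])
    show "(\<lambda>\<zeta>. H (\<alpha> + \<i> * \<zeta>) (- \<alpha> + \<i> * \<zeta>)) holomorphic_on V"
      by (rule hol[OF \<open>open V\<close>]) (auto intro!: holomorphic_intros simp: V_def strip_def m_def a_def)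
    show "open V" "connected V" using \<open>open V\<close> \<open>convex V\<close> convex_connected by auto
    show "U \<subseteq> V" "of_real (m + 1) \<in> V" using a by (auto simp: U_def V_def)
    show "\<beta> \<in> V"
    proof -
      have "Re w = Re \<alpha> - Im \<beta>" "Im w = Im \<alpha> + Re \<beta>" "Re wb = - Re \<alpha> - Im \<beta>" "Im wb = - Im \<alpha> + Re \<beta>"
        unfolding wab[symmetric] by simp_all
      then have "2 * Re \<beta> = Im w + Im wb" "2 * Im \<beta> = - Re w - Re wb"
        "2 * Re \<alpha> = Re w - Re wb" "2 * Im \<alpha> = Im w - Im wb"
        by linarith+
      moreover have "\<bar>Re w\<bar> < A" "\<bar>Re wb\<bar> < A" "Im w > 0" "Im wb > 0"
        using w by (simp_all add: strip_def)
      moreover have "\<bar>p\<bar> < q \<and> \<bar>r\<bar> < A - \<bar>s\<bar>"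
        if "2 * q = x + y" "2 * r = - a - b" "2 * s = a - b" "2 * p = x - y"
          "\<bar>a\<bar> < A" "\<bar>b\<bar> < A" "x > 0" "y > 0" for a b x y p q r s :: real
        using that by linarith
      ultimately show ?thesis
        unfolding V_def m_def a_def mem_Collect_eq by blast
    qed
    show "of_real (m + 1) islimpt U"
      unfolding islimpt_approachable
    proof (intro allI impI)
      fix e :: real assume "e > 0"
      then show "\<exists>x'\<in>U. x' \<noteq> of_real (m + 1) \<and> dist x' (of_real (m + 1)) < e"
        unfolding U_def bex_simps by (intro bexI[of _ "m + 1 + e / 2"]) (auto simp: dist_norm norm_divide)
    qed
    fix \<zeta> assume "\<zeta> \<in> U"
    then obtain x where "\<zeta> = of_real x" "m < x" by (auto simp: U_def)
    then show "H (\<alpha> + \<i> * \<zeta>) (- \<alpha> + \<i> * \<zeta>) = 0" using step1[of \<alpha> x] re\<alpha> by (simp add: m_def)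
  qed
  then show ?thesis unfolding wab .
qed

text \<open>The points 0, P, 1, -1 of a plane spanned by time and one spatial direction have z = 2 P
  / (P + 1), so P = z / (2 - z). The value z = 2 would put P at infinity; it lies in [1,oo), outside
  the values of \<open>z_of_chi\<close> on the upper half plane.\<close>

lemma Euclid_with_cross_ratio:
  assumes "z \<noteq> 0" "z \<noteq> 1" "z \<noteq> 2"
  obtains C :: "'n::finite config" where "C \<in> Euclid" "is_zzbar C z (cnj z)"
    "\<And>i j. i \<noteq> j \<Longrightarrow> \<exists>x>0. xsq i j C = of_real x"
proof -
  define p where "p = (\<chi> k::4. if k = 1 then 0 else if k = 2 then z / (2 - z) else if k = 3 then 1 else (- 1 :: complex))"
  define C where "C = ((\<chi> k. complex_of_real (Re (p $ k))), (\<chi> k. Im (p $ k) *\<^sub>R (axis undefined 1 :: real^'n)))"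
  have z2: "2 - z \<noteq> 0" using assms by auto
  have p: "p $ 1 = 0" "p $ 2 = z / (2 - z)" "p $ 3 = 1" "p $ 4 = - 1" by (simp_all add: p_def)
  have p2: "p $ 2 + 1 = 2 / (2 - z)" "1 - p $ 2 = 2 * (1 - z) / (2 - z)"
    using z2 by (simp_all add: p field_simps)
  have dd: "p $ 2 \<noteq> 0" "p $ 2 + 1 \<noteq> 0" "1 - p $ 2 \<noteq> 0"
    unfolding p2 using assms z2 by (simp_all add: p)
  then have d12: "p $ 2 \<noteq> 0" "p $ 2 \<noteq> 1" "p $ 2 \<noteq> - 1" by (auto simp: add_eq_0_iff)
  have inj: "p $ i \<noteq> p $ j" if "i \<noteq> j" for i j
  proof -
    have n: "(0::complex) \<noteq> 1" "(0::complex) \<noteq> - 1" "(1::complex) \<noteq> - 1" by simp_all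
    show ?thesis
      using exhaust_4[of i] exhaust_4[of j]
      by (elim disjE; metis n d12 p(1,3,4) that)
  qed
  have x: "xsq i j C = of_real ((cmod (p $ i - p $ j))\<^sup>2)" for i j
  proof -
    have "norm (Im (p $ i) *\<^sub>R (axis undefined 1 :: real^'n) - Im (p $ j) *\<^sub>R axis undefined 1) = \<bar>Im (p $ i) - Im (p $ j)\<bar>"
      by (simp add: scaleR_diff_left[symmetric] norm_axis_1)
    then show ?thesis by (simp add: xsq_def C_def cmod_power2)
  qed
  have cnj_sq: "of_real ((cmod w)\<^sup>2) = w * cnj w" for w by (rule complex_norm_square)
  have "C \<in> Euclid"
    unfolding Euclid_def
  proof (intro CollectI conjI allI impI)
    fix i j :: 4 assume "i \<noteq> j"
    then have "xsq i j C \<noteq> 0" using inj by (simp add: x)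
    then show "(fst C $ i, snd C $ i) \<noteq> (fst C $ j, snd C $ j)" by (auto simp: xsq_def)
  qed (simp add: C_def)
  moreover have "is_zzbar C z (cnj z)"
  proof -
    define P where "P = p $ 2"
    have d: "2 - z \<noteq> 0" "2 - cnj z \<noteq> 0" using z2 by (auto simp: complex_eq_iff)
    have P1: "P + 1 \<noteq> 0" using dd(2) by (simp only: P_def not_False_eq_True)
    have zP: "z = 2 * P / (P + 1)" unfolding P_def p2 using z2 by (simp add: p)
    have zP': "1 - z = (1 - P) / (P + 1)" unfolding zP using P1 by (simp add: field_simps)
    have u: "cr_u C = of_real ((cmod (2 * P / (P + 1)))\<^sup>2)"
      by (simp add: cr_u_def x p(1,3,4) P_def[symmetric] norm_divide norm_mult power_divide power_mult_distrib norm_minus_commute add.commute)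
    have v: "cr_v C = of_real ((cmod ((1 - P) / (P + 1)))\<^sup>2)"
      by (simp add: cr_v_def x p(1,3,4) P_def[symmetric] norm_divide norm_mult power_divide power_mult_distrib norm_minus_commute add.commute)
    show ?thesis unfolding is_zzbar_def u v zP[symmetric] zP'[symmetric] cnj_sq by simp
  qed
  moreover have "\<exists>y>0. xsq i j C = of_real y" if "i \<noteq> j" for i j
    using inj[OF that] by (intro exI[of _ "(cmod (p $ i - p $ j))\<^sup>2"]) (simp add: x)
  ultimately show ?thesis by (rule that)
qed

lemma euclidean_ope_coeff: "euclidean_four_point \<Delta> GE g c b \<Longrightarrow> ope_coeff b"
  unfolding euclidean_four_point_def ope_coeff_def by (elim conjE) (intro conjI)

lemma euclidean_g_series:
  fixes C :: "'n::finite config" and GE :: "'n config \<Rightarrow> complex"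
  assumes "euclidean_four_point \<Delta> GE g c b" "C \<in> Euclid"
    "is_zzbar C (z_of_chi w) (cnj (z_of_chi w))" "Im w > 0"
  shows "g (cr_u C) (cr_v C) = g_series b w (- cnj w)"
proof -
  have "\<forall>C\<in>(Euclid :: 'n config set). \<forall>z chi. is_zzbar C z (cnj z) \<and> z \<notin> one_to_inf \<and>
        rho z = exp (\<i> * chi) \<longrightarrow> g (cr_u C) (cr_v C) = g_series b chi (- cnj chi)"
    using assms(1) unfolding euclidean_four_point_def by (elim conjE)
  then show ?thesis
    using assms(2,3) z_of_chi_notin_one_to_inf[OF assms(4)] rho_z_of_chi[OF assms(4)] by metis
qed

lemma z_of_chi_neq_2: "Im w > 0 \<Longrightarrow> z_of_chi w \<noteq> 2"
proof
  assume "Im w > 0" "z_of_chi w = 2"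
  moreover have "2 \<in> one_to_inf" unfolding one_to_inf_def by (rule image_eqI[of _ _ 2]) auto
  ultimately show False using z_of_chi_notin_one_to_inf by metis
qed

text \<open>On the slice the exchange replaces z by its conjugate, which is the other labelling of
  the same Euclidean configuration. The width \<open>A\<close> is chosen to contain both
  arguments.\<close>

lemma g_series_symmetric:
  fixes GE :: "'n::finite config \<Rightarrow> complex"
  assumes "euclidean_four_point \<Delta> GE g c b" "Im w > 0" "Im wb > 0"
  shows "g_series b w wb = g_series b wb w"
proof -
  define A where "A = \<bar>Re w\<bar> + \<bar>Re wb\<bar> + 1"
  have b: "ope_coeff b" by (rule euclidean_ope_coeff[OF assms(1)])
  have "g_series b w wb - g_series b wb w = 0"
  proof (rule strip_slice_identity[of A "\<lambda>w wb. g_series b w wb - g_series b wb w"])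
    fix f k and V :: "complex set"
    assume *: "open V" "f holomorphic_on V" "k holomorphic_on V" "f ` V \<subseteq> strip A" "k ` V \<subseteq> strip A"
    then have pos: "Im (f \<zeta>) > 0" "Im (k \<zeta>) > 0" if "\<zeta> \<in> V" for \<zeta>
      using that unfolding strip_def by (auto simp: image_subset_iff)
    show "(\<lambda>\<zeta>. g_series b (f \<zeta>) (k \<zeta>) - g_series b (k \<zeta>) (f \<zeta>)) holomorphic_on V"
      using pos by (intro holomorphic_on_diff g_series_holomorphic b * conjI)
  next
    fix w assume "w \<in> strip A"
    then have w: "Im w > 0" "Im (- cnj w) > 0" by (auto simp: strip_def)
    obtain C :: "'n config" where C: "C \<in> Euclid" "is_zzbar C (z_of_chi w) (cnj (z_of_chi w))"
      using Euclid_with_cross_ratio z_of_chi_nonzero[OF w(1)] z_of_chi_neq_1[OF w(1)] z_of_chi_neq_2[OF w(1)] by metis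
    have "is_zzbar C (z_of_chi (- cnj w)) (cnj (z_of_chi (- cnj w)))"
      using C(2) unfolding z_of_chi_minus_cnj complex_cnj_cnj by (rule is_zzbar_commute[THEN iffD1])
    from euclidean_g_series[OF assms(1) C(1) this w(2)] euclidean_g_series[OF assms(1) C w(1)]
    show "g_series b w (- cnj w) - g_series b (- cnj w) w = 0" by simp
  next
    show "w \<in> strip A" "wb \<in> strip A" using assms by (auto simp: strip_def A_def)
  qed
  then show ?thesis by simp
qed

lemma permute_config_Euclid:
  assumes "C \<in> Euclid" "p permutes UNIV"
  shows "permute_config p C \<in> Euclid"
  using assms permutes_inj[OF assms(2)] unfolding Euclid_def permute_config_def
  by (auto simp: inj_eq)

lemma xsq_permute: "xsq i j (permute_config p C) = xsq (p i) (p j) C"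
  by (simp add: xsq_def permute_config_def)

lemma Phi_ext_minus_cnj:
  assumes "w \<in> S_strip"
  shows "Phi_ext (- cnj w) = - cnj (Phi_ext w)"
proof -
  define y where "y = (1 - exp (\<i> * w / 2)) / (1 + exp (\<i> * w / 2))"
  have "exp (\<i> * (- cnj w) / 2) = cnj (exp (\<i> * w / 2))" by (simp add: exp_cnj)
  then have "(1 - exp (\<i> * (- cnj w) / 2)) / (1 + exp (\<i> * (- cnj w) / 2)) = cnj y"
    unfolding y_def by simp
  moreover have "Ln (cnj y) = cnj (Ln y)"
    unfolding y_def by (rule cnj_Ln[symmetric, OF cayley_notin_nonpos_Reals[OF S_strip_subset_S_ext[OF assms]]])
  moreover have "- 2 * \<i> * cnj x = - cnj (- 2 * \<i> * x)" for x by simp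
  ultimately show ?thesis unfolding Phi_ext_def y_def[symmetric] by metis
qed

text \<open>On the slice this is the exchange of the points 1 and 3.\<close>
lemma crossing_slice:
  fixes GE :: "'n::finite config \<Rightarrow> complex"
  assumes E: "euclidean_four_point \<Delta> GE g c b" and w: "w \<in> S_strip"
  shows "g_series b w (- cnj w) = exp (of_real \<Delta> * (log_ratio w + log_ratio (- cnj w)))
      * g_series b (Phi_ext w) (Phi_ext (- cnj w))"
proof -
  define z where "z = z_of_chi w"
  have iw: "Im w > 0" using w by (simp add: S_strip_def)
  have iP: "Im (Phi_ext w) > 0" using Phi_ext_in_S_strip[OF w] by (simp add: S_strip_def)
  obtain C :: "'n config" where C: "C \<in> Euclid" "is_zzbar C z (cnj z)"
    "\<And>i j. i \<noteq> j \<Longrightarrow> \<exists>x>0. xsq i j C = of_real x"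
    using Euclid_with_cross_ratio z_of_chi_nonzero[OF iw] z_of_chi_neq_1[OF iw] z_of_chi_neq_2[OF iw]
    unfolding z_def by metis
  \<comment> \<open>This transposition exchanges u and v, hence z and 1 - z.\<close>
  define p where "p = Transposition.transpose 1 (3::4)"
  have p: "p permutes UNIV" unfolding p_def by (rule permutes_swap_id) auto
  have pk: "p 1 = 3" "p 2 = 2" "p 3 = 1" "p 4 = 4" by (simp_all add: p_def Transposition.transpose_def)
  define C' where "C' = permute_config p C"
  have C'E: "C' \<in> Euclid" unfolding C'_def using C(1) p by (rule permute_config_Euclid)
  have x': "xsq i j C' = xsq (p i) (p j) C" for i j by (simp add: C'_def xsq_permute)
  have uv: "cr_u C' = cr_v C" "cr_v C' = cr_u C"
    by (simp_all add: cr_u_def cr_v_def x' pk xsq_sym[of 3 2] xsq_sym[of 3 1] xsq_sym[of 2 1] mult.commute)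
  have zz: "is_zzbar C' (1 - z) (cnj (1 - z))" using C(2) by (simp add: is_zzbar_def uv)
  have GE1: "GE D = g (cr_u D) (cr_v D) / (xsq 1 2 D powr of_real \<Delta> * xsq 3 4 D powr of_real \<Delta>)"
    if "D \<in> Euclid" for D using E that unfolding euclidean_four_point_def by (elim conjE) (rule bspec)
  have GE2: "GE C' = GE C"
    using E C(1) p unfolding C'_def euclidean_four_point_def by (elim conjE) blast
  have g1: "g (cr_u C) (cr_v C) = g_series b w (- cnj w)"
    by (rule euclidean_g_series[OF E C(1) C(2)[unfolded z_def] iw])
  have "is_zzbar C' (z_of_chi (Phi_ext w)) (cnj (z_of_chi (Phi_ext w)))"
    unfolding z_of_chi_Phi_ext[OF S_strip_subset_S_ext[OF w]] using zz unfolding z_def .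
  from euclidean_g_series[OF E C'E this iP]
  have g2: "g (cr_u C') (cr_v C') = g_series b (Phi_ext w) (Phi_ext (- cnj w))"
    unfolding Phi_ext_minus_cnj[OF w] .
  have nz: "xsq i j C \<noteq> 0" if "i \<noteq> j" for i j using C(3)[OF that] by auto
  have pw: "xsq i j C powr of_real \<Delta> = exp (of_real \<Delta> * Ln (xsq i j C))" if "i \<noteq> j" for i j
    using nz[OF that] by (simp add: powr_def)
  have "g_series b w (- cnj w) / (xsq 1 2 C powr of_real \<Delta> * xsq 3 4 C powr of_real \<Delta>)
      = g_series b (Phi_ext w) (Phi_ext (- cnj w)) / (xsq 2 3 C powr of_real \<Delta> * xsq 1 4 C powr of_real \<Delta>)"
    using GE1[OF C(1)] GE1[OF C'E] GE2 unfolding g1 g2 x' pk xsq_sym[of 3 2] by simp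
  then have "g_series b w (- cnj w) = exp (of_real \<Delta> * Ln (xsq 1 2 C)) * exp (of_real \<Delta> * Ln (xsq 3 4 C))
      / (exp (of_real \<Delta> * Ln (xsq 2 3 C)) * exp (of_real \<Delta> * Ln (xsq 1 4 C)))
      * g_series b (Phi_ext w) (Phi_ext (- cnj w))"
    by (simp add: pw field_simps)
  also have "exp (of_real \<Delta> * Ln (xsq 1 2 C)) * exp (of_real \<Delta> * Ln (xsq 3 4 C))
      / (exp (of_real \<Delta> * Ln (xsq 2 3 C)) * exp (of_real \<Delta> * Ln (xsq 1 4 C))) = exp (of_real \<Delta> * log_cross C)"
    unfolding log_cross_def by (simp only: exp_add[symmetric] exp_diff[symmetric]) (simp add: algebra_simps)
  \<comment> \<open>Both sides are real on the slice, so equality of the exponentials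
    suffices.\<close>
  also have "log_cross C = log_ratio w + log_ratio (- cnj w)"
  proof -
    have "Ln (xsq i j C) \<in> \<real>" if "i \<noteq> j" for i j
      using C(3)[OF that] by (metis Ln_of_real Reals_of_real)
    then have "log_cross C \<in> \<real>" unfolding log_cross_def by (intro Reals_add Reals_diff) auto
    then obtain a where a: "log_cross C = of_real a" by (rule Reals_cases)
    have "log_ratio w + log_ratio (- cnj w) = of_real (2 * Re (log_ratio w))"
      unfolding log_ratio_minus_cnj[OF iw] by (rule complex_add_cnj)
    then obtain a' where a': "log_ratio w + log_ratio (- cnj w) = of_real a'" by blast
    have "exp (log_ratio w + log_ratio (- cnj w)) = z / (1 - z) * (cnj z / (1 - cnj z))"
      using iw by (simp add: exp_add exp_log_ratio z_of_chi_minus_cnj z_def)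
    also have "\<dots> = exp (log_cross C)" by (rule exp_log_cross[OF nz C(2), symmetric])
    finally have "exp a' = exp a" unfolding a a' exp_of_real of_real_eq_iff .
    then show ?thesis by (simp add: a a')
  qed
  finally show ?thesis .
qed

lemma crossing:
  fixes GE :: "'n::finite config \<Rightarrow> complex"
  assumes E: "euclidean_four_point \<Delta> GE g c b" and w: "w \<in> S_strip" "wb \<in> S_strip"
  shows "g_series b w wb = exp (of_real \<Delta> * (log_ratio w + log_ratio wb)) * g_series b (Phi_ext w) (Phi_ext wb)"
proof -
  have S: "S_strip = strip pi" unfolding S_strip_def strip_def by auto
  have b: "ope_coeff b" by (rule euclidean_ope_coeff[OF E])
  have "g_series b w wb - exp (of_real \<Delta> * (log_ratio w + log_ratio wb)) * g_series b (Phi_ext w) (Phi_ext wb) = 0"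
  proof (rule strip_slice_identity[of pi
        "\<lambda>w wb. g_series b w wb - exp (of_real \<Delta> * (log_ratio w + log_ratio wb)) * g_series b (Phi_ext w) (Phi_ext wb)"])
    fix f k and V :: "complex set"
    assume *: "open V" "f holomorphic_on V" "k holomorphic_on V" "f ` V \<subseteq> strip pi" "k ` V \<subseteq> strip pi"
    then have im: "f ` V \<subseteq> S_strip" "k ` V \<subseteq> S_strip" unfolding S by blast+
    then have pos: "Im (f \<zeta>) > 0" "Im (k \<zeta>) > 0" "Im (Phi_ext (f \<zeta>)) > 0" "Im (Phi_ext (k \<zeta>)) > 0" if "\<zeta> \<in> V" for \<zeta>
      using that Phi_ext_in_S_strip unfolding S_strip_def by (auto simp: image_subset_iff)
    have P: "(\<lambda>\<zeta>. Phi_ext (f' \<zeta>)) holomorphic_on V" if "f' holomorphic_on V" "f' ` V \<subseteq> S_strip" for f'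
      using holomorphic_on_compose_gen[OF that(1) holomorphic_on_Phi_ext that(2)] by (simp add: o_def)
    have L: "(\<lambda>\<zeta>. log_ratio (f' \<zeta>)) holomorphic_on V" if "f' holomorphic_on V" "f' ` V \<subseteq> S_strip" for f'
    proof -
      have "f' ` V \<subseteq> {w. Im w > 0}" using that(2) by (auto simp: S_strip_def)
      from holomorphic_on_compose_gen[OF that(1) holomorphic_on_log_ratio this] show ?thesis by (simp add: o_def)
    qed
    show "(\<lambda>\<zeta>. g_series b (f \<zeta>) (k \<zeta>) - exp (of_real \<Delta> * (log_ratio (f \<zeta>) + log_ratio (k \<zeta>)))
        * g_series b (Phi_ext (f \<zeta>)) (Phi_ext (k \<zeta>))) holomorphic_on V"
      by (intro holomorphic_intros g_series_holomorphic b *(1-3) conjI pos P L im)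
  next
    fix w assume "w \<in> strip pi"
    then show "g_series b w (- cnj w) - exp (of_real \<Delta> * (log_ratio w + log_ratio (- cnj w)))
        * g_series b (Phi_ext w) (Phi_ext (- cnj w)) = 0"
      using crossing_slice[OF E, of w] unfolding S by simp
  next
    show "w \<in> strip pi" "wb \<in> strip pi" using w unfolding S by auto
  qed
  then show ?thesis by simp
qed

subsection \<open>Symmetric functions of the roots and complex differentiability\<close>

text \<open>The unordered pair of roots depends continuously on sum and product: (z - z0) (z - zb0)
  equals z times the change of the sum minus the change of the product, and is small because z stays
  bounded.\<close>

lemma quadratic_roots_near:
  fixes z0 zb0 :: complex
  assumes "\<epsilon> > 0"
  obtains \<eta> where "\<eta> > 0" "\<And>z zb. cmod (z + zb - (z0 + zb0)) < \<eta> \<Longrightarrow> cmod (z * zb - z0 * zb0) < \<eta> \<Longrightarrow>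
    cmod (z - z0) < \<epsilon> \<and> cmod (zb - zb0) < \<epsilon> \<or> cmod (z - zb0) < \<epsilon> \<and> cmod (zb - z0) < \<epsilon>"
proof -
  \<comment> \<open>For |z| > 1, |z|^2 <= |s| |z| + |p| gives |z| <= |s| + |p|, where the sum s and
    the product p each move by at most 1; the rest is slack.\<close>
  define K where "K = cmod (z0 + zb0) + cmod (z0 * zb0) + 3"
  have K: "K > 0" by (simp add: K_def add_nonneg_pos)
  \<comment> \<open>The last bound puts z within \<epsilon>/2 of one of the roots; the middle one
    then puts zb within \<epsilon> of the other.\<close>
  define \<eta> where "\<eta> = min 1 (min (\<epsilon> / 2) ((\<epsilon> / 2)\<^sup>2 / (K + 1)))"
  have \<eta>: "\<eta> > 0" "\<eta> \<le> 1" "\<eta> \<le> \<epsilon> / 2" "\<eta> * (K + 1) \<le> (\<epsilon> / 2)\<^sup>2"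
  proof -
    have "\<eta> \<le> (\<epsilon> / 2)\<^sup>2 / (K + 1)" by (simp add: \<eta>_def)
    then show "\<eta> * (K + 1) \<le> (\<epsilon> / 2)\<^sup>2" using K by (simp add: pos_le_divide_eq)
    show "\<eta> > 0" using assms K by (simp add: \<eta>_def)
    show "\<eta> \<le> 1" "\<eta> \<le> \<epsilon> / 2"
      unfolding \<eta>_def by (meson min.cobounded1 min.cobounded2 order_trans)+
  qed
  show ?thesis
  proof (rule that[OF \<eta>(1)])
    fix z zb assume s: "cmod (z + zb - (z0 + zb0)) < \<eta>" and p: "cmod (z * zb - z0 * zb0) < \<eta>"
    have zK: "cmod z \<le> K"
    proof (cases "cmod z \<le> 1")
      case True then show ?thesis
        using norm_ge_zero[of "z0 + zb0"] norm_ge_zero[of "z0 * zb0"] unfolding K_def by linarith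
    next
      case False
      have "cmod (z + zb) \<le> cmod (z0 + zb0) + 1" "cmod (z * zb) \<le> cmod (z0 * zb0) + 1"
        using norm_triangle_sub[of "z + zb" "z0 + zb0"] norm_triangle_sub[of "z * zb" "z0 * zb0"] s p \<eta>(2)
        by linarith+
      have "cmod z * cmod z = cmod ((z + zb) * z - z * zb)"
        unfolding norm_mult[symmetric] by (simp add: algebra_simps)
      also have "\<dots> \<le> cmod (z + zb) * cmod z + cmod (z * zb)"
        using norm_triangle_ineq4[of "(z + zb) * z" "z * zb"] by (simp add: norm_mult)
      also have "\<dots> \<le> cmod (z + zb) * cmod z + cmod (z * zb) * cmod z"
        using False mult_left_mono[of 1 "cmod z" "cmod (z * zb)"] by simp
      finally have "cmod z * cmod z \<le> (cmod (z + zb) + cmod (z * zb)) * cmod z" by (simp add: algebra_simps)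
      then have "cmod z \<le> cmod (z + zb) + cmod (z * zb)"
        by (rule mult_right_le_imp_le) (use False in linarith)
      then show ?thesis using \<open>cmod (z + zb) \<le> _\<close> \<open>cmod (z * zb) \<le> _\<close> unfolding K_def by linarith
    qed
    have "(z - z0) * (z - zb0) = (z + zb - (z0 + zb0)) * z - (z * zb - z0 * zb0)" by (simp add: algebra_simps)
    then have "cmod (z - z0) * cmod (z - zb0) \<le> cmod (z + zb - (z0 + zb0)) * cmod z + cmod (z * zb - z0 * zb0)"
      by (metis norm_mult norm_triangle_ineq4)
    also have "\<dots> < \<eta> * K + \<eta>"
      using s p zK \<eta>(1) by (intro add_le_less_mono mult_mono) auto
    also have "\<dots> \<le> (\<epsilon> / 2)\<^sup>2" using \<eta>(4) by (simp add: algebra_simps)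
    finally have prod: "cmod (z - z0) * cmod (z - zb0) < (\<epsilon> / 2)\<^sup>2" .
    have "cmod (z - z0) < \<epsilon> / 2 \<or> cmod (z - zb0) < \<epsilon> / 2"
    proof (rule ccontr)
      assume "\<not> ?thesis"
      then have "(\<epsilon> / 2) * (\<epsilon> / 2) \<le> cmod (z - z0) * cmod (z - zb0)"
        using assms by (intro mult_mono) auto
      with prod show False by (simp add: power2_eq_square)
    qed
    then show "cmod (z - z0) < \<epsilon> \<and> cmod (zb - zb0) < \<epsilon> \<or> cmod (z - zb0) < \<epsilon> \<and> cmod (zb - z0) < \<epsilon>"
    proof
      assume a: "cmod (z - z0) < \<epsilon> / 2"
      have "zb - zb0 = (z + zb - (z0 + zb0)) - (z - z0)" by simp
      then have "cmod (zb - zb0) \<le> cmod (z + zb - (z0 + zb0)) + cmod (z - z0)" by (metis norm_triangle_ineq4)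
      then have "cmod (zb - zb0) < \<epsilon>" using a s \<eta>(3) by linarith
      moreover have "cmod (z - z0) < \<epsilon>" using a assms by linarith
      ultimately show ?thesis by simp
    next
      assume a: "cmod (z - zb0) < \<epsilon> / 2"
      have "zb - z0 = (z + zb - (z0 + zb0)) - (z - zb0)" by simp
      then have "cmod (zb - z0) \<le> cmod (z + zb - (z0 + zb0)) + cmod (z - zb0)" by (metis norm_triangle_ineq4)
      then have "cmod (zb - z0) < \<epsilon>" using a s \<eta>(3) by linarith
      moreover have "cmod (z - zb0) < \<epsilon>" using a assms by linarith
      ultimately show ?thesis by simp
    qed
  qed
qed

text \<open>The roots \<open>z\<close>, \<open>zb\<close> need not depend continuously on the parameter: they are only chosen pointwise.\<close>
lemma continuous_on_symmetric_sum:
  fixes z zb :: "'a::topological_space \<Rightarrow> complex" and f :: "complex \<Rightarrow> complex"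
  assumes s: "continuous_on W (\<lambda>x. z x + zb x)" and p: "continuous_on W (\<lambda>x. z x * zb x)"
    and f: "\<And>x. x \<in> W \<Longrightarrow> isCont f (z x)" "\<And>x. x \<in> W \<Longrightarrow> isCont f (zb x)"
  shows "continuous_on W (\<lambda>x. f (z x) + f (zb x))"
  unfolding continuous_on_def
proof
  fix x0 assume x0: "x0 \<in> W"
  show "((\<lambda>x. f (z x) + f (zb x)) \<longlongrightarrow> f (z x0) + f (zb x0)) (at x0 within W)"
  proof (rule tendstoI)
    fix e :: real assume "e > 0"
    then have e2: "e / 2 > 0" by simp
    obtain d1 where d1: "d1 > 0" "\<forall>w. dist w (z x0) < d1 \<longrightarrow> dist (f w) (f (z x0)) < e / 2"
      using f(1)[OF x0] e2 unfolding continuous_at_eps_delta by metis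
    obtain d2 where d2: "d2 > 0" "\<forall>w. dist w (zb x0) < d2 \<longrightarrow> dist (f w) (f (zb x0)) < e / 2"
      using f(2)[OF x0] e2 unfolding continuous_at_eps_delta by metis
    obtain \<eta> where \<eta>: "\<eta> > 0" "\<And>z' zb'. cmod (z' + zb' - (z x0 + zb x0)) < \<eta> \<Longrightarrow>
        cmod (z' * zb' - z x0 * zb x0) < \<eta> \<Longrightarrow>
        cmod (z' - z x0) < min d1 d2 \<and> cmod (zb' - zb x0) < min d1 d2 \<or>
        cmod (z' - zb x0) < min d1 d2 \<and> cmod (zb' - z x0) < min d1 d2"
      using quadratic_roots_near[of "min d1 d2" "z x0" "zb x0"] d1(1) d2(1) by (metis min_less_iff_conj)
    have "\<forall>\<^sub>F x in at x0 within W. dist (z x + zb x) (z x0 + zb x0) < \<eta>"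
      using s x0 \<eta>(1) unfolding continuous_on_def by (metis tendstoD)
    moreover have "\<forall>\<^sub>F x in at x0 within W. dist (z x * zb x) (z x0 * zb x0) < \<eta>"
      using p x0 \<eta>(1) unfolding continuous_on_def by (metis tendstoD)
    ultimately show "\<forall>\<^sub>F x in at x0 within W. dist (f (z x) + f (zb x)) (f (z x0) + f (zb x0)) < e"
    proof eventually_elim
      case (elim x)
      from \<eta>(2)[of "z x" "zb x"] elim
      have "dist (z x) (z x0) < min d1 d2 \<and> dist (zb x) (zb x0) < min d1 d2 \<or>
        dist (z x) (zb x0) < min d1 d2 \<and> dist (zb x) (z x0) < min d1 d2"
        unfolding dist_norm by blast
      then show ?case
      proof
        assume "dist (z x) (z x0) < min d1 d2 \<and> dist (zb x) (zb x0) < min d1 d2"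
        then have "dist (f (z x)) (f (z x0)) < e / 2" "dist (f (zb x)) (f (zb x0)) < e / 2"
          using d1(2) d2(2) by auto
        then show ?thesis
          using dist_triangle_add[of "f (z x)" "f (zb x)" "f (z x0)" "f (zb x0)"] by linarith
      next
        assume "dist (z x) (zb x0) < min d1 d2 \<and> dist (zb x) (z x0) < min d1 d2"
        then have "dist (f (zb x)) (f (z x0)) < e / 2" "dist (f (z x)) (f (zb x0)) < e / 2"
          using d1(2) d2(2) by auto
        then show ?thesis
          using dist_triangle_add[of "f (zb x)" "f (z x)" "f (z x0)" "f (zb x0)"] by (simp add: add.commute)
      qed
    qed
  qed
qed

section \<open>Complex differentiability in the four times\<close>

definition cdiff :: "(complex ^ 4 \<Rightarrow> complex) \<Rightarrow> complex ^ 4 \<Rightarrow> bool" where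
  "cdiff f \<tau> \<longleftrightarrow> (\<exists>L. (f has_derivative L) (at \<tau>) \<and> (\<forall>a w. L (a *s w) = a * L w))"

lemma cdiff_const: "cdiff (\<lambda>\<tau>. k) \<tau>"
  unfolding cdiff_def by (intro exI[of _ "\<lambda>_. 0"]) auto

lemma cdiff_nth: "cdiff (\<lambda>\<tau>. \<tau> $ i) \<tau>"
  unfolding cdiff_def
  by (intro exI[of _ "\<lambda>\<tau>. \<tau> $ i"]) (auto intro!: bounded_linear_imp_has_derivative bounded_linear_vec_nth)

lemma cdiff_compose:
  assumes "cdiff f \<tau>" "k field_differentiable (at (f \<tau>))"
  shows "cdiff (\<lambda>\<tau>. k (f \<tau>)) \<tau>"
proof -
  obtain L where L: "(f has_derivative L) (at \<tau>)" "\<forall>a w. L (a *s w) = a * L w"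
    using assms(1) unfolding cdiff_def by blast
  obtain D where "(k has_field_derivative D) (at (f \<tau>))"
    using assms(2) unfolding field_differentiable_def by blast
  then have "(k has_derivative (\<lambda>x. D * x)) (at (f \<tau>))" by (simp add: has_field_derivative_def)
  from has_derivative_compose[OF L(1) this]
  have "((\<lambda>\<tau>. k (f \<tau>)) has_derivative (\<lambda>w. D * L w)) (at \<tau>)" .
  then show ?thesis
    unfolding cdiff_def using L(2) by (intro exI[of _ "\<lambda>w. D * L w"]) auto
qed

lemma cdiffE:
  assumes "cdiff f \<tau>"
  obtains L where "(f has_derivative L) (at \<tau>)" "\<And>a w. L (a *s w) = a * L w"
  using assms unfolding cdiff_def by metis

lemma cdiff_add:
  assumes "cdiff f \<tau>" "cdiff k \<tau>" shows "cdiff (\<lambda>\<tau>. f \<tau> + k \<tau>) \<tau>"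
proof -
  obtain L where L: "(f has_derivative L) (at \<tau>)" "\<And>a w. L (a *s w) = a * L w"
    using cdiffE[OF assms(1)] by metis
  obtain L' where L': "(k has_derivative L') (at \<tau>)" "\<And>a w. L' (a *s w) = a * L' w"
    using cdiffE[OF assms(2)] by metis
  have "\<forall>a w. L (a *s w) + L' (a *s w) = a * (L w + L' w)"
    unfolding L(2) L'(2) by (simp add: distrib_left)
  with has_derivative_add[OF L(1) L'(1)] show ?thesis
    unfolding cdiff_def by (intro exI[of _ "\<lambda>w. L w + L' w"] conjI)
qed

lemma cdiff_mult:
  assumes "cdiff f \<tau>" "cdiff k \<tau>" shows "cdiff (\<lambda>\<tau>. f \<tau> * k \<tau>) \<tau>"
proof -
  obtain L where L: "(f has_derivative L) (at \<tau>)" "\<And>a w. L (a *s w) = a * L w"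
    using cdiffE[OF assms(1)] by metis
  obtain L' where L': "(k has_derivative L') (at \<tau>)" "\<And>a w. L' (a *s w) = a * L' w"
    using cdiffE[OF assms(2)] by metis
  have "\<forall>a w. f \<tau> * L' (a *s w) + L (a *s w) * k \<tau> = a * (f \<tau> * L' w + L w * k \<tau>)"
    unfolding L(2) L'(2) by (simp add: algebra_simps)
  with has_derivative_mult[OF L(1) L'(1)] show ?thesis
    unfolding cdiff_def by (intro exI[of _ "\<lambda>w. f \<tau> * L' w + L w * k \<tau>"] conjI)
qed

lemma cdiff_diff:
  assumes "cdiff f \<tau>" "cdiff k \<tau>" shows "cdiff (\<lambda>\<tau>. f \<tau> - k \<tau>) \<tau>"
  using cdiff_add[OF assms(1) cdiff_mult[OF cdiff_const[of "-1"] assms(2)]] by simp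

lemma cdiff_power: "cdiff f \<tau> \<Longrightarrow> cdiff (\<lambda>\<tau>. (f \<tau>) ^ n) \<tau>"
  by (induction n) (auto intro: cdiff_const cdiff_mult)

lemma cdiff_divide:
  assumes "cdiff f \<tau>" "cdiff k \<tau>" "k \<tau> \<noteq> 0" shows "cdiff (\<lambda>\<tau>. f \<tau> / k \<tau>) \<tau>"
proof -
  have "inverse field_differentiable (at (k \<tau>))"
    using assms(3) by (intro field_differentiable_inverse field_differentiable_ident)
  from cdiff_mult[OF assms(1) cdiff_compose[OF assms(2) this]] show ?thesis by (simp add: divide_inverse)
qed

lemma cdiff_cong:
  assumes "cdiff f \<tau>" "eventually (\<lambda>\<sigma>. f \<sigma> = k \<sigma>) (nhds \<tau>)"
  shows "cdiff k \<tau>"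
proof -
  obtain L where L: "(f has_derivative L) (at \<tau>)" "\<forall>a w. L (a *s w) = a * L w"
    using assms(1) unfolding cdiff_def by blast
  have "(k has_derivative L) (at \<tau>)"
  proof (rule has_derivative_transform_eventually[OF L(1)])
    show "\<forall>\<^sub>F x' in at \<tau>. f x' = k x'" using assms(2) by (simp add: eventually_nhds_conv_at)
    show "f \<tau> = k \<tau>" using assms(2) by (rule eventually_nhds_x_imp_x)
  qed simp
  then show ?thesis using L(2) unfolding cdiff_def by blast
qed

text \<open>Near the point a continuous root is its value there times the principal root of the
  normalised square, because the normalised root is close to 1. It serves roots that are known only
  through their continuity and their squares.\<close>

lemma cdiff_square_root:
  assumes "isCont f \<tau>0" "cdiff (\<lambda>\<tau>. (f \<tau>)\<^sup>2) \<tau>0" "f \<tau>0 \<noteq> 0"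
  shows "cdiff f \<tau>0"
proof (rule cdiff_cong)
  have "(\<lambda>x. x / (f \<tau>0)\<^sup>2) field_differentiable (at ((f \<tau>0)\<^sup>2))"
    using assms(3) by (intro field_differentiable_divide field_differentiable_ident field_differentiable_const) simp
  from cdiff_compose[OF assms(2) this] have 1: "cdiff (\<lambda>\<tau>. (f \<tau>)\<^sup>2 / (f \<tau>0)\<^sup>2) \<tau>0" .
  have "csqrt field_differentiable (at ((f \<tau>0)\<^sup>2 / (f \<tau>0)\<^sup>2))"
    using assms(3) by (intro field_differentiable_at_csqrt) simp
  from cdiff_mult[OF cdiff_const cdiff_compose[OF 1 this]]
  show "cdiff (\<lambda>\<tau>. f \<tau>0 * csqrt ((f \<tau>)\<^sup>2 / (f \<tau>0)\<^sup>2)) \<tau>0" .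
  have "(f \<longlongrightarrow> f \<tau>0) (nhds \<tau>0)"
    using assms(1) unfolding isCont_def tendsto_at_iff_tendsto_nhds .
  then have "((\<lambda>\<tau>. Re (f \<tau> / f \<tau>0)) \<longlongrightarrow> Re (f \<tau>0 / f \<tau>0)) (nhds \<tau>0)"
    using assms(3) by (intro tendsto_intros)
  then have "((\<lambda>\<tau>. Re (f \<tau> / f \<tau>0)) \<longlongrightarrow> 1) (nhds \<tau>0)" using assms(3) by simp
  then have "\<forall>\<^sub>F \<tau> in nhds \<tau>0. Re (f \<tau> / f \<tau>0) > 0"
    by (rule order_tendstoD) simp
  then show "\<forall>\<^sub>F \<tau> in nhds \<tau>0. f \<tau>0 * csqrt ((f \<tau>)\<^sup>2 / (f \<tau>0)\<^sup>2) = f \<tau>"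
  proof eventually_elim
    case (elim \<tau>)
    then have "csqrt ((f \<tau> / f \<tau>0)\<^sup>2) = f \<tau> / f \<tau>0" by (intro csqrt_square) auto
    then show ?case using assms(3) by (simp add: power_divide)
  qed
qed

lemma norm_vector_smult: "norm (\<zeta> *s w) = cmod \<zeta> * norm (w :: complex ^ 'n)"
  by (simp add: norm_vec_def norm_mult L2_set_right_distrib)

lemma holomorphic_line:
  assumes "\<And>\<tau>. \<tau> \<in> ball \<tau>0 r \<Longrightarrow> cdiff \<psi> \<tau>" "norm w * R \<le> r"
  shows "(\<lambda>\<zeta>. \<psi> (\<tau>0 + \<zeta> *s w)) holomorphic_on ball 0 R"
  unfolding holomorphic_on_def
proof
  fix \<zeta> :: complex assume "\<zeta> \<in> ball 0 R"
  then have \<zeta>: "cmod \<zeta> < R" by simp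
  have "norm (\<zeta> *s w) < r \<or> w = 0"
  proof (cases "w = 0")
    case False
    then have "cmod \<zeta> * norm w < R * norm w" using \<zeta> by (intro mult_strict_right_mono) auto
    then show ?thesis using assms(2) by (simp add: norm_vector_smult mult.commute)
  qed simp
  then show "(\<lambda>\<zeta>. \<psi> (\<tau>0 + \<zeta> *s w)) field_differentiable at \<zeta> within ball 0 R"
  proof
    assume "w = 0" then show ?thesis by simp
  next
    assume "norm (\<zeta> *s w) < r"
    then have "\<tau>0 + \<zeta> *s w \<in> ball \<tau>0 r" by (simp add: dist_norm)
    then obtain L where L: "(\<psi> has_derivative L) (at (\<tau>0 + \<zeta> *s w))" "\<forall>a w. L (a *s w) = a * L w"
      using assms(1) unfolding cdiff_def by blast
    have "bounded_linear (\<lambda>\<zeta>::complex. \<zeta> *s w)"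
      by (rule bounded_linear_intro[of _ "norm w"])
         (auto simp: vec_eq_iff algebra_simps norm_vector_smult scaleR_conv_of_real[where 'a = complex])
    then have "((\<lambda>\<zeta>. \<tau>0 + \<zeta> *s w) has_derivative (\<lambda>\<zeta>. \<zeta> *s w)) (at \<zeta>)"
      using has_derivative_add[OF has_derivative_const bounded_linear_imp_has_derivative] by fastforce
    from has_derivative_compose[OF this L(1)]
    have "((\<lambda>\<zeta>. \<psi> (\<tau>0 + \<zeta> *s w)) has_derivative (\<lambda>\<zeta>. \<zeta> * L w)) (at \<zeta>)" using L(2) by simp
    moreover have "(\<lambda>\<zeta>. \<zeta> * L w) = (*) (L w)" by (auto simp: fun_eq_iff)
    ultimately have "((\<lambda>\<zeta>. \<psi> (\<tau>0 + \<zeta> *s w)) has_field_derivative L w) (at \<zeta>)"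
      by (simp add: has_field_derivative_def)
    then show ?thesis
      using field_differentiable_at_within field_differentiable_def by blast
  qed
qed

text \<open>Cauchy's inequality with radius R/2 at 0, and with radius R/4 around points of the unit
  disc, where R >= 4 keeps these discs inside; 32 is 2! * 4^2.\<close>

lemma holomorphic_ball_taylor_bound:
  assumes hol: "\<phi> holomorphic_on ball 0 R" and M: "\<And>\<zeta>. \<zeta> \<in> ball 0 R \<Longrightarrow> cmod (\<phi> \<zeta>) \<le> M" and R: "R > 0"
  shows "cmod (deriv \<phi> 0) \<le> 2 * M / R"
    and "R \<ge> 4 \<Longrightarrow> cmod (\<phi> 1 - \<phi> 0 - deriv \<phi> 0) \<le> 32 * M / R\<^sup>2"
proof -
  have cauchy: "cmod ((deriv ^^ n) \<phi> \<xi>) \<le> fact n * M / r ^ n" if "r > 0" "cball \<xi> r \<subseteq> ball 0 R" for n \<xi> r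
  proof (rule Cauchy_inequality)
    show "\<phi> holomorphic_on ball \<xi> r" using hol that(2) by (meson ball_subset_cball holomorphic_on_subset subset_trans)
    show "continuous_on (cball \<xi> r) \<phi>" using hol that(2) by (meson holomorphic_on_imp_continuous_on continuous_on_subset)
    fix x assume "cmod (\<xi> - x) = r"
    then show "cmod (\<phi> x) \<le> M" using M that(2) by (simp add: subset_iff dist_norm)
  qed (rule that(1))
  have "cball (0::complex) (R / 2) \<subseteq> ball 0 R" using R by auto
  from cauchy[of "R / 2" 0 1, OF _ this] show "cmod (deriv \<phi> 0) \<le> 2 * M / R"
    using R by (simp add: mult.commute)
  assume R4: "R \<ge> 4"
  have sub: "cball \<zeta> (R / 4) \<subseteq> ball 0 R" if "\<zeta> \<in> cball 0 1" for \<zeta> :: complex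
  proof
    fix x assume "x \<in> cball \<zeta> (R / 4)"
    then have "dist x \<zeta> \<le> R / 4" "dist \<zeta> 0 \<le> 1" using that by (auto simp: dist_commute)
    then have "dist x 0 \<le> R / 4 + 1" using dist_triangle[of x 0 \<zeta>] by linarith
    then show "x \<in> ball 0 R" using R4 by (simp add: dist_commute)
  qed
  have d: "((deriv ^^ i) \<phi> has_field_derivative (deriv ^^ Suc i) \<phi> x) (at x within cball 0 1)" if "x \<in> cball 0 1" for i x
  proof -
    have "x \<in> ball 0 R" using that R4 by auto
    then have "((deriv ^^ i) \<phi>) field_differentiable (at x)"
      using holomorphic_higher_deriv[OF hol open_ball] by (metis holomorphic_on_imp_differentiable_at open_ball)
    then show ?thesis
      using DERIV_deriv_iff_field_differentiable has_field_derivative_at_within by fastforce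
  qed
  have "cmod ((deriv ^^ 0) \<phi> 1 - (\<Sum>i\<le>1. (deriv ^^ i) \<phi> 0 * (1 - 0) ^ i / fact i)) \<le> (32 * M / R\<^sup>2) * cmod (1 - 0) ^ Suc 1 / fact 1"
  proof (rule complex_Taylor[of "cball 0 1"])
    fix x :: complex assume "x \<in> cball 0 1"
    from cauchy[of "R / 4" x 2, OF _ sub[OF this]] R
    show "cmod ((deriv ^^ Suc 1) \<phi> x) \<le> 32 * M / R\<^sup>2"
      by (simp add: numeral_2_eq_2 power2_eq_square field_simps)
  qed (use d in auto)
  then show "cmod (\<phi> 1 - \<phi> 0 - deriv \<phi> 0) \<le> 32 * M / R\<^sup>2" by (simp add: diff_diff_eq)
qed

text \<open>Restriction to the line through \<open>\<tau>0\<close> in direction w, where w is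
  reached at \<zeta> = 1: the disc has radius R = r / |w|, and the bounds are uniform in the
  direction.\<close>

lemma cdiff_taylor_bound:
  assumes "\<And>\<tau>. \<tau> \<in> ball \<tau>0 r \<Longrightarrow> cdiff \<psi> \<tau>" "\<And>\<tau>. \<tau> \<in> ball \<tau>0 r \<Longrightarrow> cmod (\<psi> \<tau>) \<le> M" "r > 0"
    and L: "(\<psi> has_derivative L) (at \<tau>0)" "\<And>a w. L (a *s w) = a * L w"
  shows "cmod (L w) \<le> 2 * M / r * norm w"
    and "norm w \<le> r / 4 \<Longrightarrow> cmod (\<psi> (\<tau>0 + w) - \<psi> \<tau>0 - L w) \<le> 32 * M / r\<^sup>2 * (norm w)\<^sup>2"
proof -
  have L0: "L 0 = 0" using L(2)[of 0 0] by simp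
  define \<phi> where "\<phi> \<zeta> = \<psi> (\<tau>0 + \<zeta> *s w)" for \<zeta>
  have "cmod (L w) \<le> 2 * M / r * norm w \<and>
    (norm w \<le> r / 4 \<longrightarrow> cmod (\<psi> (\<tau>0 + w) - \<psi> \<tau>0 - L w) \<le> 32 * M / r\<^sup>2 * (norm w)\<^sup>2)"
  proof (cases "w = 0")
    case True then show ?thesis by (simp add: L0)
  next
    case False
    define R where "R = r / norm w"
    have R: "R > 0" "norm w * R = r" using False assms(3) by (auto simp: R_def)
    have hol: "\<phi> holomorphic_on ball 0 R"
      unfolding \<phi>_def using R by (intro holomorphic_line[OF assms(1)]) auto
    have bd: "cmod (\<phi> \<zeta>) \<le> M" if "\<zeta> \<in> ball 0 R" for \<zeta>
    proof -
      have "cmod \<zeta> * norm w < R * norm w" using that False by (intro mult_strict_right_mono) auto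
      then show ?thesis unfolding \<phi>_def using R by (intro assms(2)) (simp add: dist_norm norm_vector_smult mult.commute)
    qed
    have bl: "bounded_linear (\<lambda>\<zeta>::complex. \<zeta> *s w)"
      by (rule bounded_linear_intro[of _ "norm w"])
         (auto simp: vec_eq_iff algebra_simps norm_vector_smult scaleR_conv_of_real[where 'a = complex])
    have "((\<lambda>\<zeta>. \<tau>0 + \<zeta> *s w) has_derivative (\<lambda>\<zeta>. 0 + \<zeta> *s w)) (at 0)"
      by (rule has_derivative_add[OF has_derivative_const bounded_linear_imp_has_derivative[OF bl]])
    then have "((\<lambda>\<zeta>. \<tau>0 + \<zeta> *s w) has_derivative (\<lambda>\<zeta>. \<zeta> *s w)) (at 0)" by simp
    moreover have "(\<psi> has_derivative L) (at (\<tau>0 + 0 *s w))" using L(1) by simp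
    ultimately have "((\<lambda>\<zeta>. \<psi> (\<tau>0 + \<zeta> *s w)) has_derivative (\<lambda>\<zeta>. L (\<zeta> *s w))) (at 0)"
      by (rule has_derivative_compose)
    then have "(\<phi> has_derivative (\<lambda>\<zeta>. \<zeta> * L w)) (at 0)" unfolding \<phi>_def L(2) .
    moreover have "(\<lambda>\<zeta>. \<zeta> * L w) = (*) (L w)" by (auto simp: fun_eq_iff)
    ultimately have "(\<phi> has_field_derivative L w) (at 0)"
      by (simp add: has_field_derivative_def)
    then have d: "deriv \<phi> 0 = L w" by (rule DERIV_imp_deriv)
    have 1: "cmod (L w) \<le> 2 * M / R" using holomorphic_ball_taylor_bound(1)[OF hol bd R(1)] by (simp add: d)
    have 2: "cmod (\<psi> (\<tau>0 + w) - \<psi> \<tau>0 - L w) \<le> 32 * M / R\<^sup>2" if "norm w \<le> r / 4"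
    proof -
      have "R \<ge> 4" using that False by (simp add: R_def field_simps)
      from holomorphic_ball_taylor_bound(2)[OF hol bd R(1) this] show ?thesis unfolding d by (simp add: \<phi>_def)
    qed
    have "2 * M / R = 2 * M / r * norm w" "32 * M / R\<^sup>2 = 32 * M / r\<^sup>2 * (norm w)\<^sup>2"
      using False assms(3) by (simp_all add: R_def power_divide)
    with 1 2 show ?thesis by simp
  qed
  then show "cmod (L w) \<le> 2 * M / r * norm w"
    and "norm w \<le> r / 4 \<Longrightarrow> cmod (\<psi> (\<tau>0 + w) - \<psi> \<tau>0 - L w) \<le> 32 * M / r\<^sup>2 * (norm w)\<^sup>2"
    by blast+
qed

lemma has_sum_difference:
  fixes f g :: "'i \<Rightarrow> complex"
  assumes "(f has_sum a) A" "(g has_sum b) A"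
  shows "((\<lambda>x. f x - g x) has_sum (a - b)) A"
proof -
  have "((\<lambda>x. - g x) has_sum - b) A" using assms(2) by (simp add: has_sum_uminus)
  from has_sum_add[OF assms(1) this] show ?thesis by simp
qed

text \<open>The Weierstrass theorem: the derivatives are controlled by Cauchy estimates on complex lines.\<close>
lemma cdiff_infsum:
  fixes \<psi> :: "'i \<Rightarrow> complex ^ 4 \<Rightarrow> complex"
  assumes d: "\<And>i \<tau>. i \<in> I \<Longrightarrow> \<tau> \<in> ball \<tau>0 r \<Longrightarrow> cdiff (\<psi> i) \<tau>"
    and bd: "\<And>i \<tau>. i \<in> I \<Longrightarrow> \<tau> \<in> ball \<tau>0 r \<Longrightarrow> cmod (\<psi> i \<tau>) \<le> M i"
    and M: "M summable_on I" and r: "r > 0"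
  shows "cdiff (\<lambda>\<tau>. infsum (\<lambda>i. \<psi> i \<tau>) I) \<tau>0"
proof -
  have "\<forall>i\<in>I. \<exists>L. (\<psi> i has_derivative L) (at \<tau>0) \<and> (\<forall>a w. L (a *s w) = a * L w)"
    using d r unfolding cdiff_def by simp
  then obtain L where L: "\<And>i. i \<in> I \<Longrightarrow> (\<psi> i has_derivative L i) (at \<tau>0)"
    "\<And>i a w. i \<in> I \<Longrightarrow> L i (a *s w) = a * L i w"
    by (metis (no_types))
  have tb: "cmod (L i w) \<le> 2 * M i / r * norm w"
    "norm w \<le> r / 4 \<Longrightarrow> cmod (\<psi> i (\<tau>0 + w) - \<psi> i \<tau>0 - L i w) \<le> 32 * M i / r\<^sup>2 * (norm w)\<^sup>2"
    if "i \<in> I" for i w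
    using cdiff_taylor_bound[OF d[OF that] bd[OF that] r L(1)[OF that] L(2)[OF that]] by blast+
  have linL: "L i (w + w') = L i w + L i w'" "L i (s *\<^sub>R w) = s *\<^sub>R L i w" if "i \<in> I" for i w w' s
    using has_derivative_linear[OF L(1)[OF that]] by (auto simp: linear_add linear_scale)
  have sumM: "(\<lambda>i. k * M i) summable_on I" for k using M by (rule summable_on_cmult_right)
  have sum\<psi>: "(\<lambda>i. \<psi> i \<tau>) summable_on I" if "\<tau> \<in> ball \<tau>0 r" for \<tau>
    by (rule abs_summable_summable, rule Infinite_Sum.abs_summable_on_comparison_test'[OF M]) (rule bd[OF _ that])
  have bL: "cmod (L i w) \<le> (2 / r * norm w) * M i" if "i \<in> I" for i w
    using tb(1)[OF that, of w] by (simp add: mult.commute mult.left_commute)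
  have sumL: "(\<lambda>i. L i w) summable_on I" for w
    by (rule abs_summable_summable, rule Infinite_Sum.abs_summable_on_comparison_test'[OF sumM]) (rule bL)
  define T where "T = infsum M I"
  have M0: "M i \<ge> 0" if "i \<in> I" for i
    using bd[OF that, of \<tau>0] r norm_ge_zero[of "\<psi> i \<tau>0"] by (simp del: norm_ge_zero)
  have T0: "T \<ge> 0" unfolding T_def using M0 by (rule infsum_nonneg)
  define \<Lambda> where "\<Lambda> w = infsum (\<lambda>i. L i w) I" for w
  have infM: "infsum (\<lambda>i. k * M i) I = k * T" for k
    unfolding T_def using M by (intro infsum_cmult_right) auto
  have "bounded_linear \<Lambda>"
  proof (rule bounded_linear_intro[of _ "2 / r * T"])
    show "\<Lambda> (x + y) = \<Lambda> x + \<Lambda> y" for x y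
      unfolding \<Lambda>_def infsum_add[OF sumL sumL, symmetric] by (rule infsum_cong) (rule linL)
    show "\<Lambda> (s *\<^sub>R x) = s *\<^sub>R \<Lambda> x" for s x
      unfolding \<Lambda>_def infsum_scaleR_right[symmetric] by (rule infsum_cong) (rule linL)
    show "norm (\<Lambda> x) \<le> norm x * (2 / r * T)" for x
    proof -
      have "norm (\<Lambda> x) \<le> (\<Sum>\<^sub>\<infinity>i\<in>I. (2 / r * norm x) * M i)"
        unfolding \<Lambda>_def
        by (rule norm_infsum_le[OF has_sum_infsum[OF sumL] has_sum_infsum[OF sumM]]) (rule bL)
      then show ?thesis unfolding infM by (simp add: mult.commute mult.left_commute)
    qed
  qed
  moreover have "\<exists>\<delta>>0. \<forall>y. norm (y - \<tau>0) < \<delta> \<longrightarrow>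
      norm (infsum (\<lambda>i. \<psi> i y) I - infsum (\<lambda>i. \<psi> i \<tau>0) I - \<Lambda> (y - \<tau>0)) \<le> e * norm (y - \<tau>0)" if "e > 0" for e
  proof -
    define K where "K = 32 / r\<^sup>2 * T"
    have K: "K \<ge> 0" using T0 by (simp add: K_def)
    \<comment> \<open>r/4 is the range of the Taylor bound; e / (K + 1) turns the quadratic error K
      |w|^2 into at most e |w|, also for K = 0.\<close>
    define \<delta> where "\<delta> = min (r / 4) (e / (K + 1))"
    have \<delta>: "\<delta> > 0" using that r K by (simp add: \<delta>_def)
    have "norm (infsum (\<lambda>i. \<psi> i y) I - infsum (\<lambda>i. \<psi> i \<tau>0) I - \<Lambda> (y - \<tau>0)) \<le> e * norm (y - \<tau>0)"
      if y: "norm (y - \<tau>0) < \<delta>" for y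
    proof -
      define w where "w = y - \<tau>0"
      have w: "norm w < r / 4" "norm w < e / (K + 1)" using y by (auto simp: \<delta>_def w_def)
      have yb: "y \<in> ball \<tau>0 r" "\<tau>0 \<in> ball \<tau>0 r" using w(1) r by (auto simp: w_def dist_norm norm_minus_commute)
      have hs: "((\<lambda>i. \<psi> i y - \<psi> i \<tau>0 - L i w) has_sum
          (infsum (\<lambda>i. \<psi> i y) I - infsum (\<lambda>i. \<psi> i \<tau>0) I - \<Lambda> w)) I"
        unfolding \<Lambda>_def by (intro has_sum_difference has_sum_infsum sum\<psi> yb sumL)
      have "norm (infsum (\<lambda>i. \<psi> i y) I - infsum (\<lambda>i. \<psi> i \<tau>0) I - \<Lambda> w)
          \<le> (\<Sum>\<^sub>\<infinity>i\<in>I. (32 / r\<^sup>2 * (norm w)\<^sup>2) * M i)"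
      proof (rule norm_infsum_le[OF hs has_sum_infsum[OF sumM]])
        fix i assume i: "i \<in> I"
        have "\<tau>0 + w = y" by (simp add: w_def)
        with tb(2)[OF i, of w] w(1)
        show "norm (\<psi> i y - \<psi> i \<tau>0 - L i w) \<le> 32 / r\<^sup>2 * (norm w)\<^sup>2 * M i"
          by (simp add: mult.commute mult.left_commute)
      qed
      then have "norm (infsum (\<lambda>i. \<psi> i y) I - infsum (\<lambda>i. \<psi> i \<tau>0) I - \<Lambda> w) \<le> K * norm w * norm w"
        unfolding infM K_def by (simp add: power2_eq_square mult.commute mult.left_commute)
      also have "\<dots> \<le> e * norm w"
      proof (rule mult_right_mono)
        have "norm w * (K + 1) \<le> e" using w(2) K by (simp add: pos_less_divide_eq)
        moreover have "K * norm w \<le> norm w * (K + 1)" by (simp add: algebra_simps)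
        ultimately show "K * norm w \<le> e" by linarith
      qed simp
      finally show ?thesis by (simp add: w_def)
    qed
    with \<delta> show ?thesis by blast
  qed
  ultimately have "((\<lambda>\<tau>. infsum (\<lambda>i. \<psi> i \<tau>) I) has_derivative \<Lambda>) (at \<tau>0)"
    unfolding has_derivative_at_alt by blast
  moreover have "\<forall>a w. \<Lambda> (a *s w) = a * \<Lambda> w"
  proof (intro allI)
    fix a w
    have "\<Lambda> (a *s w) = infsum (\<lambda>i. a * L i w) I" unfolding \<Lambda>_def by (rule infsum_cong) (rule L(2))
    also have "\<dots> = a * \<Lambda> w" unfolding \<Lambda>_def by (rule infsum_cmult_right) (rule sumL)
    finally show "\<Lambda> (a *s w) = a * \<Lambda> w" .
  qed
  ultimately show ?thesis unfolding cdiff_def by blast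
qed

subsection \<open>The symmetrised series\<close>

text \<open>Newton's recursion for a^n + b^n in terms of s = a + b and p = a b.\<close>

fun power_sum :: "nat \<Rightarrow> complex \<Rightarrow> complex \<Rightarrow> complex" where
  "power_sum 0 s p = 2"
| "power_sum (Suc 0) s p = s"
| "power_sum (Suc (Suc n)) s p = s * power_sum (Suc n) s p - p * power_sum n s p"

lemma power_sum_eq: "power_sum n (a + b) (a * b) = a ^ n + b ^ n"
  by (induction n "a + b" "a * b" rule: power_sum.induct) (simp_all add: algebra_simps)

lemma cdiff_power_sum:
  assumes "cdiff s \<tau>" "cdiff p \<tau>"
  shows "cdiff (\<lambda>\<tau>. power_sum n (s \<tau>) (p \<tau>)) \<tau>"
proof (induction n rule: less_induct)
  case (less n)
  show ?case
  proof -
    consider "n = 0" | "n = Suc 0" | m where "n = Suc (Suc m)" by (metis not0_implies_Suc)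
    then show ?thesis
  proof cases
    case (3 m)
    then have "cdiff (\<lambda>\<tau>. power_sum (Suc m) (s \<tau>) (p \<tau>)) \<tau>" "cdiff (\<lambda>\<tau>. power_sum m (s \<tau>) (p \<tau>)) \<tau>"
      using less by auto
    then show ?thesis using 3 assms by (auto intro!: cdiff_diff cdiff_mult)
  qed (use assms cdiff_const in auto)
  qed
qed

lemma continuous_on_power_sum [continuous_intros]:
  assumes "continuous_on A s" "continuous_on A p"
  shows "continuous_on A (\<lambda>x. power_sum n (s x) (p x))"
proof (induction n rule: less_induct)
  case (less n)
  show ?case
  proof -
    consider "n = 0" | "n = Suc 0" | m where "n = Suc (Suc m)" by (metis not0_implies_Suc)
    then show ?thesis
  proof cases
    case (3 m)
    then have "continuous_on A (\<lambda>x. power_sum (Suc m) (s x) (p x))" "continuous_on A (\<lambda>x. power_sum m (s x) (p x))"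
      using less by auto
    then show ?thesis using 3 assms by (auto intro!: continuous_intros)
  qed (use assms in auto)
  qed
qed

text \<open>The term of the symmetrised series as a function of \<open>s = \<rho> + \<rho>b\<close>, \<open>p = \<rho> \<rho>b\<close> and
  a logarithm \<open>\<Theta>\<close> of \<open>p\<close>; unlike \<open>\<rho>\<close> and \<open>\<rho>b\<close>, these are analytic also where \<open>z = zb\<close>.\<close>
definition sym_term :: "(real \<Rightarrow> real \<Rightarrow> real) \<Rightarrow> complex \<Rightarrow> complex \<Rightarrow> complex \<Rightarrow> real \<times> real \<Rightarrow> complex" where
  "sym_term b \<Theta> s p = (\<lambda>(h, hb). of_real (b h hb) / 2 * exp (of_real (min h hb) * \<Theta>) * power_sum (nat \<lfloor>\<bar>h - hb\<bar>\<rfloor>) s p)"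

lemma exp_min_split:
  "exp (of_real h * (\<i> * (w + wb))) * (exp (\<i> * w) ^ n) = exp (\<i> * of_real (h + real n) * w + \<i> * of_real h * wb)"
  unfolding exp_of_nat_mult[symmetric] exp_add[symmetric] by (simp add: algebra_simps)

text \<open>The common factor (rho rhob)^min(h,hb) is pulled out of the two mirrored terms; what
  remains is a power sum with exponent |h - hb|. The floor in it is exact, because h - hb is an
  integer when b is nonzero.\<close>

lemma sym_term_eq:
  assumes "ope_coeff b" "x \<in> {0..} \<times> {0..}"
  shows "sym_term b (\<i> * (w + wb)) (exp (\<i> * w) + exp (\<i> * wb)) (exp (\<i> * w) * exp (\<i> * wb)) x
    = (g_term b w wb x + g_term b wb w x) / 2"
proof -
  obtain h hb where x: "x = (h, hb)" "h \<ge> 0" "hb \<ge> 0" using assms(2) by (cases x) auto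
  show ?thesis
  proof (cases "b h hb = 0")
    case True then show ?thesis by (simp add: x sym_term_def g_term_def)
  next
    case False
    then have "h - hb \<in> \<int>" using assms(1) x unfolding ope_coeff_def by blast
    then obtain m where m: "h - hb = real_of_int m" by (rule Ints_cases)
    define n where "n = nat \<bar>m\<bar>"
    have n: "nat \<lfloor>\<bar>h - hb\<bar>\<rfloor> = n" unfolding m n_def by (metis floor_of_int of_int_abs)
    have comm: "w + wb = wb + w" by simp
    have "exp (of_real (min h hb) * (\<i> * (w + wb))) * (exp (\<i> * w) ^ n + exp (\<i> * wb) ^ n)
        = exp (\<i> * of_real h * w + \<i> * of_real hb * wb) + exp (\<i> * of_real h * wb + \<i> * of_real hb * w)"
    proof (cases "m \<ge> 0")
      case True
      then have h: "h = hb + real n" "min h hb = hb" using m by (auto simp: n_def)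
      have 1: "exp (of_real hb * (\<i> * (w + wb))) * exp (\<i> * wb) ^ n = exp (\<i> * of_real (hb + real n) * wb + \<i> * of_real hb * w)"
        unfolding comm by (rule exp_min_split)
      show ?thesis unfolding h(2) distrib_left[of "exp _"] exp_min_split 1 by (simp only: h(1))
    next
      case False
      then have h: "hb = h + real n" "min h hb = h" using m by (auto simp: n_def)
      have 1: "exp (of_real h * (\<i> * (w + wb))) * exp (\<i> * wb) ^ n = exp (\<i> * of_real h * w + \<i> * of_real (h + real n) * wb)"
        unfolding comm exp_min_split by (simp add: add.commute)
      have 2: "exp (of_real h * (\<i> * (w + wb))) * exp (\<i> * w) ^ n = exp (\<i> * of_real h * wb + \<i> * of_real (h + real n) * w)"
        unfolding exp_min_split by (simp add: add.commute)
      show ?thesis unfolding h(2) distrib_left[of "exp _"] 1 2 unfolding h(1)[symmetric] by (rule add.commute)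
    qed
    note e = this
    have "sym_term b (\<i> * (w + wb)) (exp (\<i> * w) + exp (\<i> * wb)) (exp (\<i> * w) * exp (\<i> * wb)) x
      = of_real (b h hb) / 2 * (exp (of_real (min h hb) * (\<i> * (w + wb))) * (exp (\<i> * w) ^ n + exp (\<i> * wb) ^ n))"
      unfolding x sym_term_def prod.case n power_sum_eq by (simp only: mult.assoc)
    also have "\<dots> = (g_term b w wb x + g_term b wb w x) / 2"
      unfolding e x g_term_def prod.case by (simp only: distrib_left times_divide_eq_left add_divide_distrib)
    finally show ?thesis .
  qed
qed

lemma sym_term_bound:
  assumes "ope_coeff b" "x \<in> {0..} \<times> {0..}" "exp \<Theta> = r * rb" "r \<noteq> 0" "rb \<noteq> 0" "cmod r \<le> exp (- y)" "cmod rb \<le> exp (- y)"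
  shows "cmod (sym_term b \<Theta> (r + rb) (r * rb) x) \<le> g_majorant b y x"
proof -
  define w where "w = - \<i> * Ln r"
  \<comment> \<open>The second logarithm is the remainder of \<Theta>, not a principal value, so
    that the two add up to \<Theta> exactly.\<close>
  define wb where "wb = - \<i> * (\<Theta> - Ln r)"
  have e: "exp (\<i> * w) = r" "exp (\<i> * wb) = rb" "\<i> * (w + wb) = \<Theta>"
    using assms(3-5) by (simp_all add: w_def wb_def exp_diff algebra_simps)
  have "y \<le> Im w" "y \<le> Im wb"
  proof -
    have "cmod r = exp (- Im w)" "cmod rb = exp (- Im wb)"
      unfolding e(1)[symmetric] e(2)[symmetric] by (simp_all add: norm_exp_eq_Re)
    then show "y \<le> Im w" "y \<le> Im wb" using assms(6,7) by simp_all
  qed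
  then have 1: "cmod (g_term b w wb x) \<le> g_majorant b y x" "cmod (g_term b wb w x) \<le> g_majorant b y x"
    using norm_g_term_le[OF assms(1,2)] by blast+
  have "sym_term b \<Theta> (r + rb) (r * rb) x = (g_term b w wb x + g_term b wb w x) / 2"
    using sym_term_eq[OF assms(1,2), of w wb] unfolding e .
  then have "cmod (sym_term b \<Theta> (r + rb) (r * rb) x) = cmod (g_term b w wb x + g_term b wb w x) / 2"
    by (simp only: norm_divide norm_numeral)
  also have "\<dots> \<le> (cmod (g_term b w wb x) + cmod (g_term b wb w x)) / 2"
    by (intro divide_right_mono norm_triangle_ineq) auto
  finally have "2 * cmod (sym_term b \<Theta> (r + rb) (r * rb) x) \<le> cmod (g_term b w wb x) + cmod (g_term b wb w x)"
    by simp
  then show ?thesis using 1 by linarith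
qed

lemma sym_series_eq:
  assumes b: "ope_coeff b" and w: "Im w > 0" "Im wb > 0" and sym: "g_series b w wb = g_series b wb w"
  shows "infsum (sym_term b (\<i> * (w + wb)) (exp (\<i> * w) + exp (\<i> * wb)) (exp (\<i> * w) * exp (\<i> * wb))) ({0..} \<times> {0..})
    = g_series b w wb"
proof -
  have "infsum (sym_term b (\<i> * (w + wb)) (exp (\<i> * w) + exp (\<i> * wb)) (exp (\<i> * w) * exp (\<i> * wb))) ({0..} \<times> {0..})
    = infsum (\<lambda>x. (1 / 2) * (g_term b w wb x + g_term b wb w x)) ({0..} \<times> {0..})"
    by (rule infsum_cong) (simp add: sym_term_eq[OF b])
  also have "\<dots> = (1 / 2) * infsum (\<lambda>x. g_term b w wb x + g_term b wb w x) ({0..} \<times> {0..})"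
    by (rule infsum_cmult_right) (intro summable_on_add g_term_summable b w)
  also have "infsum (\<lambda>x. g_term b w wb x + g_term b wb w x) ({0..} \<times> {0..}) = g_series b w wb + g_series b wb w"
    unfolding g_series_def by (rule infsum_add) (rule g_term_summable[OF b]; fact w)+
  finally show ?thesis using sym by simp
qed

section \<open>The roots as an unordered pair, and local logarithms\<close>

lemma exists_zzbar: "\<exists>p. is_zzbar C (fst p) (snd p)"
proof -
  define t where "t = 1 + cr_u C - cr_v C"
  define r where "r = csqrt (t\<^sup>2 - 4 * cr_u C)"
  have r2: "r\<^sup>2 = t\<^sup>2 - 4 * cr_u C" by (simp add: r_def)
  have "is_zzbar C ((t + r) / 2) ((t - r) / 2)"
  proof (rule is_zzbar_quadratic)
    show "(t + r) / 2 + (t - r) / 2 = 1 + cr_u C - cr_v C" by (simp add: t_def field_simps)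
    have "4 * (a / 2 * (b / 2)) = a * b" for a b :: complex by simp
    then have "4 * ((t + r) / 2 * ((t - r) / 2)) = (t + r) * (t - r)" .
    also have "\<dots> = t\<^sup>2 - r\<^sup>2" by algebra
    finally show "(t + r) / 2 * ((t - r) / 2) = cr_u C" unfolding r2 by simp
  qed
  then show ?thesis by (intro exI[of _ "((t + r) / 2, (t - r) / 2)"]) simp
qed

text \<open>A pointwise choice without any continuity; it enters only through expressions symmetric
  in the two roots, which are controlled by sum and product.\<close>

definition root1 :: "'n::finite config \<Rightarrow> complex" where
  "root1 C = fst (SOME p. is_zzbar C (fst p) (snd p))"

definition root2 :: "'n::finite config \<Rightarrow> complex" where
  "root2 C = snd (SOME p. is_zzbar C (fst p) (snd p))"

lemma is_zzbar_roots: "is_zzbar C (root1 C) (root2 C)"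
  unfolding root1_def root2_def using exists_zzbar by (rule someI_ex)

lemma is_zzbar_unique:
  assumes "is_zzbar C z zb" "is_zzbar C z' zb'"
  shows "z' = z \<and> zb' = zb \<or> z' = zb \<and> zb' = z"
proof -
  have s: "z + zb = z' + zb'" and p: "z * zb = z' * zb'"
    using is_zzbar_sum[OF assms(1)] is_zzbar_sum[OF assms(2)] assms by (auto simp: is_zzbar_def)
  have "(z' - z) * (z' - zb) = z' * z' - (z + zb) * z' + z * zb" by (simp add: algebra_simps)
  also have "\<dots> = 0" unfolding s p by (simp add: algebra_simps)
  finally have "z' = z \<or> z' = zb" by simp
  then show ?thesis using s by auto
qed

lemma symmetric_sum_roots:
  assumes "is_zzbar C z zb"
  shows "f z + f zb = f (root1 C) + (f (root2 C) :: complex)"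
  using is_zzbar_unique[OF is_zzbar_roots assms] by (auto simp: add.commute)

lemma continuous_on_roots_sum_prod:
  assumes "\<And>C. C \<in> W \<Longrightarrow> xsq 1 3 C \<noteq> 0 \<and> xsq 2 4 C \<noteq> 0"
  shows "continuous_on W (\<lambda>C. root1 C + root2 (C :: 'n::finite config))" "continuous_on W (\<lambda>C. root1 C * root2 C)"
proof -
  have c: "continuous_on W cr_u" "continuous_on W cr_v"
    unfolding cr_u_def[abs_def] cr_v_def[abs_def] using assms by (auto intro!: continuous_intros)
  have "root1 C * root2 C = cr_u C" "root1 C + root2 C = 1 + cr_u C - cr_v C" for C :: "'n config"
    using is_zzbar_roots[of C] is_zzbar_sum[OF is_zzbar_roots[of C]] by (auto simp: is_zzbar_def)
  then show "continuous_on W (\<lambda>C. root1 C + root2 (C :: 'n::finite config))" "continuous_on W (\<lambda>C. root1 C * root2 C)"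
    using c by (auto intro!: continuous_intros)
qed

lemma roots_eventually:
  fixes C :: "'n::finite config"
  assumes nz: "xsq 1 3 C \<noteq> 0" "xsq 2 4 C \<noteq> 0" and \<Omega>: "open \<Omega>" "root1 C \<in> \<Omega>" "root2 C \<in> \<Omega>"
  shows "eventually (\<lambda>C'. root1 C' \<in> \<Omega> \<and> root2 C' \<in> \<Omega>) (nhds C)"
proof -
  obtain e1 where e1: "e1 > 0" "ball (root1 C) e1 \<subseteq> \<Omega>" using \<Omega>(1,2) unfolding open_contains_ball by metis
  obtain e2 where e2: "e2 > 0" "ball (root2 C) e2 \<subseteq> \<Omega>" using \<Omega>(1,3) unfolding open_contains_ball by metis
  have "min e1 e2 > 0" using e1 e2 by simp
  then obtain \<eta> where \<eta>: "\<eta> > 0" "\<And>z zb. cmod (z + zb - (root1 C + root2 C)) < \<eta> \<Longrightarrow>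
      cmod (z * zb - root1 C * root2 C) < \<eta> \<Longrightarrow>
      cmod (z - root1 C) < min e1 e2 \<and> cmod (zb - root2 C) < min e1 e2 \<or>
      cmod (z - root2 C) < min e1 e2 \<and> cmod (zb - root1 C) < min e1 e2"
    using quadratic_roots_near by metis
  define W where "W = {C' :: 'n config. xsq 1 3 C' \<noteq> 0} \<inter> {C'. xsq 2 4 C' \<noteq> 0}"
  have W: "open W" "C \<in> W" unfolding W_def using nz by (auto intro!: open_Int open_Collect_neq continuous_intros)
  have c: "continuous_on W (\<lambda>C. root1 C + root2 C)" "continuous_on W (\<lambda>C. root1 C * root2 C)"
    by (rule continuous_on_roots_sum_prod; simp add: W_def)+
  have t: "((\<lambda>C. root1 C + root2 C) \<longlongrightarrow> root1 C + root2 C) (nhds C)" "((\<lambda>C. root1 C * root2 C) \<longlongrightarrow> root1 C * root2 C) (nhds C)"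
    using c[unfolded continuous_on_eq_continuous_at[OF W(1)], THEN bspec, OF W(2)]
      tendsto_at_iff_tendsto_nhds[of "\<lambda>C. root1 C + root2 C" C] tendsto_at_iff_tendsto_nhds[of "\<lambda>C. root1 C * root2 C" C]
    unfolding isCont_def by blast+
  have "eventually (\<lambda>C'. dist (root1 C' + root2 C') (root1 C + root2 C) < \<eta>) (nhds C)"
    "eventually (\<lambda>C'. dist (root1 C' * root2 C') (root1 C * root2 C) < \<eta>) (nhds C)"
    by (rule tendstoD[OF t(1) \<eta>(1)], rule tendstoD[OF t(2) \<eta>(1)])
  then show ?thesis
  proof eventually_elim
    case (elim C')
    from \<eta>(2)[OF elim[unfolded dist_norm]]
    have "root1 C' \<in> ball (root1 C) e1 \<and> root2 C' \<in> ball (root2 C) e2 \<or>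
        root1 C' \<in> ball (root2 C) e2 \<and> root2 C' \<in> ball (root1 C) e1"
      by (auto simp: dist_norm norm_minus_commute)
    then show ?case using e1(2) e2(2) by blast
  qed
qed

text \<open>f / a stays in the right half plane, so its principal logarithm is continuous and
  differs from L by a constant. This rewrites a logarithm known on part of a neighbourhood in a form
  that makes sense on all of it.\<close>

lemma local_logarithm:
  fixes L f :: "'a::topological_space \<Rightarrow> complex"
  assumes V: "connected V" "V \<noteq> {}" and c: "continuous_on V L" "continuous_on V f"
    and f: "\<And>x. x \<in> V \<Longrightarrow> exp (L x) = f x" "\<And>x. x \<in> V \<Longrightarrow> Re (f x / a) > 0"
  obtains k where "exp k = a" "\<And>x. x \<in> V \<Longrightarrow> L x = Ln (f x / a) + k"
proof -
  obtain x0 where x0: "x0 \<in> V" using V(2) by blast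
  have a: "a \<noteq> 0" using f(2)[OF x0] by auto
  have np: "f x / a \<notin> \<real>\<^sub>\<le>\<^sub>0" if "x \<in> V" for x
    using f(2)[OF that] unfolding complex_nonpos_Reals_iff by linarith
  define d where "d x = L x - Ln (f x / a)" for x
  have cd: "continuous_on V d" unfolding d_def using c np a by (intro continuous_intros) auto
  have ed: "exp (d x) = a" if "x \<in> V" for x
    using np[OF that] f(1)[OF that] a unfolding d_def exp_diff by (subst exp_Ln) (auto simp: field_simps)
  have dd: "d x = d x0" if "x \<in> V" for x
  proof -
    have "continuous_on V (\<lambda>x. d x - d x0)" using cd by (intro continuous_intros)
    moreover have "exp (d x - d x0) = 1" if "x \<in> V" for x using ed[OF that] ed[OF x0] a by (simp add: exp_diff)
    ultimately have "d x - d x0 = d x0 - d x0" using continuous_exp_eq_1_constant[OF V(1) _ _ x0 that] by blast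
    then show ?thesis by simp
  qed
  show ?thesis
  proof (rule that[of "d x0"])
    show "exp (d x0) = a" by (rule ed[OF x0])
    show "L x = Ln (f x / a) + d x0" if "x \<in> V" for x
      unfolding dd[OF that, symmetric] by (simp add: d_def)
  qed
qed

section \<open>Reduction of the end values of chi and chib to the strip\<close>

lemma crossings_eq:
  assumes "(2 * real_of_int n - 1) * pi < Re w" "Re w < (2 * real_of_int n + 1) * pi"
  shows "crossings w = n"
  unfolding crossings_def
proof (rule the_equality)
  fix m :: int assume m: "(2 * real_of_int m - 1) * pi < Re w \<and> Re w < (2 * real_of_int m + 1) * pi"
  have "(2 * real_of_int m - 1) * pi < (2 * real_of_int n + 1) * pi" "(2 * real_of_int n - 1) * pi < (2 * real_of_int m + 1) * pi"
    using m assms by linarith+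
  then have "2 * real_of_int m - 1 < 2 * real_of_int n + 1" "2 * real_of_int n - 1 < 2 * real_of_int m + 1"
    by (simp_all only: mult_less_cancel_right_pos pi_gt_zero)
  then show "m = n" by linarith
qed (use assms in simp)

lemma exp_shift: "exp (\<i> * (w + 2 * of_int n * of_real pi)) = exp (\<i> * w)"
proof -
  have "\<i> * (w + 2 * of_int n * of_real pi) = \<i> * w + 2 * of_int n * of_real pi * \<i>" by (simp add: algebra_simps)
  moreover have "exp (2 * of_int n * of_real pi * \<i>) = (1::complex)"
    using exp_integer_2pi[of "of_int n"] by (simp add: algebra_simps)
  ultimately show ?thesis by (simp only: exp_add mult_1_right)
qed

lemma z_of_chi_shift: "z_of_chi (w + 2 * of_int n * of_real pi) = z_of_chi w"
  unfolding z_of_chi_def exp_shift ..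

text \<open>Rounding Re w / (2 pi) shifts w to a real part of modulus at most pi; equality would
  make exp (i w) negative, and then z as well.\<close>

lemma shift_to_S_ext:
  assumes "Im w \<ge> 0" "1 + exp (\<i> * w) \<noteq> 0" "z_of_chi w \<notin> neg_reals" "z_of_chi w \<noteq> 1"
  obtains w' where "w' \<in> S_ext" "w = w' + 2 * of_int (crossings w) * of_real pi"
proof -
  define n where "n = round (Re w / (2 * pi))"
  define x where "x = Re w - 2 * real_of_int n * pi"
  have "\<bar>real_of_int n - Re w / (2 * pi)\<bar> \<le> 1 / 2" unfolding n_def by (rule of_int_round_abs_le)
  then have "\<bar>real_of_int n - Re w / (2 * pi)\<bar> * (2 * pi) \<le> 1 / 2 * (2 * pi)"
    using pi_gt_zero by (intro mult_right_mono) auto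
  moreover have "\<bar>real_of_int n - Re w / (2 * pi)\<bar> * (2 * pi) = \<bar>x\<bar>"
  proof -
    have "(real_of_int n - Re w / (2 * pi)) * (2 * pi) = - x" by (simp add: x_def field_simps)
    then have "\<bar>(real_of_int n - Re w / (2 * pi)) * (2 * pi)\<bar> = \<bar>x\<bar>" by simp
    then show ?thesis using pi_gt_zero by (simp add: abs_mult)
  qed
  ultimately have xle: "\<bar>x\<bar> \<le> pi" by simp
  define w' where "w' = w - 2 * of_int n * of_real pi"
  have w: "w = w' + 2 * of_int n * of_real pi" by (simp add: w'_def)
  have Rew': "Re w' = x" "Im w' = Im w" by (simp_all add: w'_def x_def)
  have ew: "exp (\<i> * w) = exp (\<i> * w')" unfolding w by (rule exp_shift)
  have "\<bar>x\<bar> \<noteq> pi"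
  proof
    assume "\<bar>x\<bar> = pi"
    then have "x = pi \<or> x = - pi" by (simp add: abs_if split: if_splits)
    then have cs: "cos x = -1" "sin x = 0" by (elim disjE; simp)+
    have iw: "\<i> * w' = of_real (- Im w) + \<i> * of_real x"
      using Rew' by (simp add: complex_eq_iff)
    have "exp (\<i> * of_real x) = - (1::complex)"
      unfolding exp_Euler cos_of_real sin_of_real cs by simp
    then have e: "exp (\<i> * w) = - of_real (exp (- Im w))"
      unfolding ew iw exp_add by (simp only: exp_of_real mult_minus_right mult_1_right)
    define t where "t = exp (- Im w)"
    \<comment> \<open>At t = 1 the formula for z has its pole;
      \<open>1 + exp (\<i> * w) \<noteq> 0\<close> rules this out.\<close>
    have "t \<noteq> 1"
    proof
      assume "t = 1"
      then have "1 + exp (\<i> * w) = 0" unfolding e t_def[symmetric] by simp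
      with assms(2) show False by contradiction
    qed
    then have "(1 - t)\<^sup>2 > 0" by simp
    then have "- (4 * t / (1 - t)\<^sup>2) < 0" by (simp add: t_def)
    moreover have "z_of_chi w = of_real (- (4 * t / (1 - t)\<^sup>2))"
      unfolding z_of_chi_def e t_def[symmetric] by simp
    ultimately show False using assms(3) unfolding neg_reals_def by blast
  qed
  then have x: "- pi < x" "x < pi" using xle by linarith+
  then have cr: "crossings w = n"
    by (intro crossings_eq) (simp_all add: x_def algebra_simps)
  have "w' \<noteq> 0"
  proof
    assume "w' = 0"
    then have e: "exp (\<i> * w) = 1" unfolding ew by simp
    have "z_of_chi w = 1" unfolding z_of_chi_def e by simp
    with assms(4) show False by simp
  qed
  then have "w' \<in> S_ext" using x assms(1) by (simp add: S_ext_def Rew')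
  moreover have "w = w' + 2 * of_int (crossings w) * of_real pi" unfolding cr by (rule w)
  ultimately show ?thesis by (rule that)
qed

lemma xpow_Dom: "C \<in> Dom \<Longrightarrow> i \<noteq> j \<Longrightarrow> xpow \<Delta> i j C = exp (of_real \<Delta> * Ln (xsq i j C))"
  by (simp add: xpow_def powr_def xsq_Dom_nonzero)

text \<open>The opposite shifts are used twice: they leave the series unchanged, and they cancel in
  the sum of the two values of \<open>log_ratio\<close>, so that the crossing prefactor is the
  exponential of \<Delta> times \<open>log_cross C\<close> and trades x12^2 x34^2 for x23^2
  x14^2.\<close>

lemma t_channel_formula:
  fixes GE G4 :: "'n::finite config \<Rightarrow> complex"
  assumes E: "euclidean_four_point \<Delta> GE g c b" and G: "four_point_continuation \<Delta> GE b G4"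
    and path: "admissible_path \<gamma>" "pathfinish \<gamma> = C" "continuation \<gamma> z zb chi chib" and C: "C \<in> Dom"
    and w: "w \<in> S_strip" "wb \<in> S_strip" "chi 1 = w + 2 * of_int n * of_real pi" "chib 1 = wb - 2 * of_int n * of_real pi"
  shows "G4 C = g_series b (Phi_ext w) (Phi_ext wb) / exp (of_real \<Delta> * (Ln (xsq 2 3 C) + Ln (xsq 1 4 C)))"
proof -
  have b: "ope_coeff b" by (rule euclidean_ope_coeff[OF E])
  have "\<gamma> 1 \<in> Dom" using path(2) C by (simp add: pathfinish_def)
  from continuation_log_cross[OF path(1,3) _ disjI2[OF this]]
  have lc: "log_ratio (chi 1) + log_ratio (chib 1) = log_cross C" using path(2) by (simp add: pathfinish_def)
  have chib: "chib 1 = wb + 2 * of_int (- n) * of_real pi" using w(4) by simp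
  have lw: "log_ratio w + log_ratio wb = log_cross C"
    using lc unfolding w(3) chib log_ratio_shift by simp
  have "G4 C = g_series b (chi 1) (chib 1) / (xpow \<Delta> 1 2 C * xpow \<Delta> 3 4 C)"
    using G path C unfolding four_point_continuation_def by blast
  also have "g_series b (chi 1) (chib 1) = g_series b w wb"
    unfolding w(3,4) by (rule g_series_shift[OF b])
  also have "\<dots> = exp (of_real \<Delta> * log_cross C) * g_series b (Phi_ext w) (Phi_ext wb)"
    unfolding crossing[OF E w(1,2)] lw ..
  also have "xpow \<Delta> 1 2 C * xpow \<Delta> 3 4 C = exp (of_real \<Delta> * (Ln (xsq 1 2 C) + Ln (xsq 3 4 C)))"
    using C by (simp add: xpow_Dom exp_add distrib_left)
  also have "of_real \<Delta> * log_cross C = of_real \<Delta> * (Ln (xsq 1 2 C) + Ln (xsq 3 4 C)) - of_real \<Delta> * (Ln (xsq 2 3 C) + Ln (xsq 1 4 C))"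
    unfolding log_cross_def by (simp add: algebra_simps)
  finally show ?thesis unfolding exp_diff by simp
qed

subsection \<open>Extension to a neighbourhood\<close>

lemma one_plus_csqrt_nonzero: "1 + csqrt z \<noteq> 0"
proof
  assume "1 + csqrt z = 0"
  then have "Re (1 + csqrt z) = 0" by (rule arg_cong[where f = Re, THEN trans]) (rule zero_complex.sel(1))
  moreover have "Re (csqrt z) \<ge> 0" using csqrt_principal[of z] by linarith
  ultimately show False unfolding plus_complex.sel one_complex.sel by linarith
qed

lemma rho_t_nonzero: "z \<noteq> 1 \<Longrightarrow> rho_t z \<noteq> 0"
proof
  assume "z \<noteq> 1" "rho_t z = 0"
  then have "csqrt z = 1" using one_plus_csqrt_nonzero[of z] by (simp add: rho_t_def)
  then have "(csqrt z)\<^sup>2 = 1" by simp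
  with \<open>z \<noteq> 1\<close> show False by simp
qed

lemma cmod_rho_t_less_1:
  assumes "z \<notin> \<real>\<^sub>\<le>\<^sub>0" shows "cmod (rho_t z) < 1"
proof -
  have "cmod (1 - csqrt z) < cmod (1 + csqrt z)"
    unfolding cmod_less_iff_square cmod_power2 using csqrt_Re_pos[OF assms]
    by (simp add: power2_eq_square algebra_simps)
  then show ?thesis unfolding rho_t_def norm_divide using one_plus_csqrt_nonzero[of z]
    by (simp add: divide_less_eq_1_pos)
qed

lemma isCont_rho_t: "z \<notin> \<real>\<^sub>\<le>\<^sub>0 \<Longrightarrow> isCont rho_t z"
  unfolding rho_t_def using one_plus_csqrt_nonzero[of z]
  by (intro continuous_intros continuous_at_csqrt) auto

text \<open>A value x in (-1,0] would give sqrt z = (1 - x) / (1 + x) >= 1.\<close>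

lemma rho_t_notin_nonpos_Reals:
  assumes "z \<notin> \<real>\<^sub>\<le>\<^sub>0" "z \<notin> one_to_inf"
  shows "rho_t z \<notin> \<real>\<^sub>\<le>\<^sub>0"
proof
  assume "rho_t z \<in> \<real>\<^sub>\<le>\<^sub>0"
  then obtain x where x: "rho_t z = of_real x" "x \<le> 0" by (auto elim: nonpos_Reals_cases)
  then have x1: "x > - 1" using cmod_rho_t_less_1[OF assms(1)] by simp
  have "1 - csqrt z = of_real x * (1 + csqrt z)"
    using x(1) one_plus_csqrt_nonzero[of z] by (simp add: rho_t_def field_simps)
  then have "csqrt z * of_real (1 + x) = of_real (1 - x)" by (simp add: algebra_simps)
  moreover have "complex_of_real (1 + x) \<noteq> 0" using x1 by (metis add_eq_0_iff less_irrefl of_real_eq_0_iff)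
  ultimately have "csqrt z = of_real (1 - x) / of_real (1 + x)" by (rule eq_divide_imp[rotated])
  then have "csqrt z = of_real ((1 - x) / (1 + x))" by (simp only: of_real_divide)
  then have "(csqrt z)\<^sup>2 = of_real (((1 - x) / (1 + x))\<^sup>2)" by (simp only: of_real_power)
  then have z: "z = of_real (((1 - x) / (1 + x))\<^sup>2)" by (simp only: power2_csqrt)
  have "1 \<le> (1 - x) / (1 + x)" using x1 x(2) by simp
  then have "((1 - x) / (1 + x))\<^sup>2 \<ge> 1" by (rule one_le_power)
  then have "z \<in> one_to_inf" unfolding one_to_inf_def z by (intro imageI) simp
  with assms(2) show False by contradiction
qed

text \<open>The symmetric functions of \<open>rho_t\<close> are rational in the sum and the product
  of the two square roots. The product squares to u, the sum to 1 + u - v plus twice the product: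
  two successive root extractions over u and v, which remain regular where z = zb.\<close>

definition sqrt_sum :: "'n::finite config \<Rightarrow> complex" where
  "sqrt_sum C = csqrt (root1 C) + csqrt (root2 C)"

definition sqrt_prod :: "'n::finite config \<Rightarrow> complex" where
  "sqrt_prod C = csqrt (root1 C) * csqrt (root2 C)"

definition rho_sum :: "'n::finite config \<Rightarrow> complex" where
  "rho_sum C = rho_t (root1 C) + rho_t (root2 C)"

definition rho_prod :: "'n::finite config \<Rightarrow> complex" where
  "rho_prod C = rho_t (root1 C) * rho_t (root2 C)"

lemma sqrt_prod_square: "(sqrt_prod C)\<^sup>2 = cr_u C"
  using is_zzbar_roots[of C] by (simp add: sqrt_prod_def power_mult_distrib is_zzbar_def)

lemma sqrt_sum_square: "(sqrt_sum C)\<^sup>2 = 1 + cr_u C - cr_v C + 2 * sqrt_prod C"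
proof -
  have "(sqrt_sum C)\<^sup>2 = (csqrt (root1 C))\<^sup>2 + (csqrt (root2 C))\<^sup>2 + 2 * sqrt_prod C"
    unfolding sqrt_sum_def sqrt_prod_def by (simp only: power2_sum mult.assoc)
  then show ?thesis using is_zzbar_sum[OF is_zzbar_roots[of C]] by simp
qed

lemma sqrt_denominator: "1 + sqrt_sum C + sqrt_prod C = (1 + csqrt (root1 C)) * (1 + csqrt (root2 C))"
  by (simp add: sqrt_sum_def sqrt_prod_def algebra_simps)

lemma sqrt_denominator_nonzero: "1 + sqrt_sum C + sqrt_prod C \<noteq> 0"
  unfolding sqrt_denominator using one_plus_csqrt_nonzero by simp

lemma rho_prod_eq: "rho_prod C = (1 - sqrt_sum C + sqrt_prod C) / (1 + sqrt_sum C + sqrt_prod C)"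
  unfolding rho_prod_def rho_t_def sqrt_denominator times_divide_times_eq
  by (simp add: sqrt_sum_def sqrt_prod_def algebra_simps)

lemma rho_sum_eq: "rho_sum C = 2 * (1 - sqrt_prod C) / (1 + sqrt_sum C + sqrt_prod C)"
proof -
  have gen: "(1 - a) / (1 + a) + (1 - c) / (1 + c) = 2 * (1 - a * c) / ((1 + a) * (1 + c))"
    if "1 + a \<noteq> 0" "1 + c \<noteq> 0" for a c :: complex
    unfolding add_frac_eq[OF that] by (simp add: algebra_simps)
  show ?thesis
    unfolding rho_sum_def rho_t_def sqrt_denominator gen[OF one_plus_csqrt_nonzero one_plus_csqrt_nonzero]
    by (simp add: sqrt_prod_def)
qed

definition nondegenerate :: "'n::finite config \<Rightarrow> bool" where
  "nondegenerate C \<longleftrightarrow> (\<forall>i j. i \<noteq> j \<longrightarrow> xsq i j C \<noteq> 0) \<and> root1 C \<notin> \<real>\<^sub>\<le>\<^sub>0 \<and> root2 C \<notin> \<real>\<^sub>\<le>\<^sub>0"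

lemma nondegenerate_neq_1:
  assumes "nondegenerate C"
  shows "root1 C \<noteq> 1" "root2 C \<noteq> 1" "cr_u C \<noteq> 0" "rho_prod C \<noteq> 0"
proof -
  have "cr_v C \<noteq> 0" "cr_u C \<noteq> 0" using assms by (simp_all add: nondegenerate_def cr_v_def cr_u_def)
  then show "root1 C \<noteq> 1" "root2 C \<noteq> 1" "cr_u C \<noteq> 0"
    using is_zzbar_roots[of C] by (auto simp: is_zzbar_def)
  then show "rho_prod C \<noteq> 0" using rho_t_nonzero by (simp add: rho_prod_def)
qed

lemma continuous_on_sqrt_rho:
  fixes W :: "'n::finite config set"
  assumes "\<And>C. C \<in> W \<Longrightarrow> nondegenerate C"
  shows "continuous_on W sqrt_sum" "continuous_on W sqrt_prod" "continuous_on W rho_sum" "continuous_on W rho_prod"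
proof -
  have nz: "xsq 1 3 C \<noteq> 0 \<and> xsq 2 4 C \<noteq> 0" if "C \<in> W" for C using assms[OF that] by (simp add: nondegenerate_def)
  have c: "continuous_on W cr_u" "continuous_on W cr_v"
    unfolding cr_u_def[abs_def] cr_v_def[abs_def] using nz by (auto intro!: continuous_intros)
  show S: "continuous_on W sqrt_sum"
    unfolding sqrt_sum_def[abs_def]
  proof (rule continuous_on_symmetric_sum[where f = csqrt and z = root1 and zb = root2])
    show "continuous_on W (\<lambda>C. root1 C + root2 C)" "continuous_on W (\<lambda>C. root1 C * root2 C)"
      by (rule continuous_on_roots_sum_prod[OF nz]; assumption)+
    show "isCont csqrt (root1 C)" "isCont csqrt (root2 C)" if "C \<in> W" for C
      using assms[OF that] unfolding nondegenerate_def by (auto intro: continuous_at_csqrt)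
  qed
  \<comment> \<open>A product is not of the form f(z) + f(zb), so its continuity is read off from
    the square of the sum.\<close>
  have e: "sqrt_prod = (\<lambda>C :: 'n config. ((sqrt_sum C)\<^sup>2 - (1 + cr_u C - cr_v C)) / 2)"
    unfolding sqrt_sum_square by (rule ext) simp
  show P: "continuous_on W sqrt_prod"
    unfolding e by (intro continuous_intros S c) simp
  show "continuous_on W rho_sum" "continuous_on W rho_prod"
    unfolding rho_sum_eq[abs_def] rho_prod_eq[abs_def]
    using S P sqrt_denominator_nonzero by (auto intro!: continuous_intros)
qed

lemma cdiff_xsq: "cdiff (\<lambda>\<tau>. xsq i j (\<tau>, x)) \<tau>0"
  unfolding xsq_def by (simp only: fst_conv snd_conv) (intro cdiff_add cdiff_power cdiff_diff cdiff_nth cdiff_const)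

text \<open>The product is differentiated first, because the square of the sum contains it. Both are
  nonzero: the product since u is, the sum since both roots have positive real part.\<close>

lemma cdiff_sqrt_rho:
  fixes W :: "'n::finite config set"
  assumes W: "\<And>C. C \<in> W \<Longrightarrow> nondegenerate C" and "open W" "(\<tau>0, x) \<in> W"
  shows "cdiff (\<lambda>\<tau>. rho_sum (\<tau>, x)) \<tau>0" "cdiff (\<lambda>\<tau>. rho_prod (\<tau>, x)) \<tau>0"
proof -
  have nd: "nondegenerate (\<tau>0, x)" using W assms(3) by blast
  then have nz: "xsq 1 3 (\<tau>0, x) * xsq 2 4 (\<tau>0, x) \<noteq> 0" by (simp add: nondegenerate_def)
  have u: "cdiff (\<lambda>\<tau>. cr_u (\<tau>, x)) \<tau>0" "cdiff (\<lambda>\<tau>. cr_v (\<tau>, x)) \<tau>0"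
    unfolding cr_u_def cr_v_def by (intro cdiff_divide cdiff_mult cdiff_xsq nz)+
  have cont: "isCont (\<lambda>\<tau>. f (\<tau>, x)) \<tau>0" if "continuous_on W f" for f :: "'n config \<Rightarrow> complex"
  proof -
    have "isCont f (\<tau>0, x)"
      using that[unfolded continuous_on_eq_continuous_at[OF assms(2)]] assms(3) by (rule bspec)
    moreover have "isCont (\<lambda>\<tau>. (\<tau>, x)) \<tau>0" by (intro continuous_intros)
    ultimately show ?thesis by (intro isCont_o2[where f = "\<lambda>\<tau>. (\<tau>, x)" and g = f])
  qed
  have "(sqrt_prod (\<tau>0, x))\<^sup>2 \<noteq> 0" unfolding sqrt_prod_square by (rule nondegenerate_neq_1(3)[OF nd])
  then have P0: "sqrt_prod (\<tau>0, x) \<noteq> 0" by (metis zero_power2)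
  have "cdiff (\<lambda>\<tau>. (sqrt_prod (\<tau>, x))\<^sup>2) \<tau>0" unfolding sqrt_prod_square by (rule u(1))
  from cdiff_square_root[OF cont[OF continuous_on_sqrt_rho(2)[OF W]] this P0]
  have P: "cdiff (\<lambda>\<tau>. sqrt_prod (\<tau>, x)) \<tau>0" by simp
  have "Re (csqrt (root1 (\<tau>0, x))) > 0" "Re (csqrt (root2 (\<tau>0, x))) > 0"
    using nd unfolding nondegenerate_def by (simp_all only: csqrt_Re_pos not_False_eq_True)
  then have "Re (sqrt_sum (\<tau>0, x)) > 0" unfolding sqrt_sum_def plus_complex.sel by linarith
  then have S0: "sqrt_sum (\<tau>0, x) \<noteq> 0" by (metis less_irrefl zero_complex.sel(1))
  have "cdiff (\<lambda>\<tau>. (sqrt_sum (\<tau>, x))\<^sup>2) \<tau>0"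
    unfolding sqrt_sum_square by (intro cdiff_add cdiff_diff cdiff_mult cdiff_const u P)
  from cdiff_square_root[OF cont[OF continuous_on_sqrt_rho(1)[OF W]] this S0]
  have S: "cdiff (\<lambda>\<tau>. sqrt_sum (\<tau>, x)) \<tau>0" by simp
  show "cdiff (\<lambda>\<tau>. rho_sum (\<tau>, x)) \<tau>0" "cdiff (\<lambda>\<tau>. rho_prod (\<tau>, x)) \<tau>0"
    unfolding rho_sum_eq rho_prod_eq
    by (intro cdiff_divide cdiff_add cdiff_diff cdiff_mult cdiff_const S P sqrt_denominator_nonzero)+
qed

text \<open>Convexity makes the intersection with \<open>Dom\<close> connected, R < 1 gives one
  majorant for the whole neighbourhood, and the ratios to the values at \<open>C\<close> stay off
  the cut of the logarithm.\<close>

lemma good_neighbourhood: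
  fixes C :: "'n::finite config"
  assumes "nondegenerate C"
  obtains U R where "open U" "C \<in> U" "convex U" "0 < R" "R < 1"
    "\<And>C'. C' \<in> U \<Longrightarrow> nondegenerate C'"
    "\<And>C' i j. C' \<in> U \<Longrightarrow> i \<noteq> j \<Longrightarrow> Re (xsq i j C' / xsq i j C) > 0"
    "\<And>C'. C' \<in> U \<Longrightarrow> cmod (rho_t (root1 C')) \<le> R \<and> cmod (rho_t (root2 C')) \<le> R"
    "\<And>C'. C' \<in> U \<Longrightarrow> Re (rho_prod C' / rho_prod C) > 0"
proof -
  have nz: "xsq i j C \<noteq> 0" if "i \<noteq> j" for i j using assms that by (simp add: nondegenerate_def)
  have r: "root1 C \<notin> \<real>\<^sub>\<le>\<^sub>0" "root2 C \<notin> \<real>\<^sub>\<le>\<^sub>0" using assms by (simp_all add: nondegenerate_def)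
  \<comment> \<open>Midway between 1 and the larger modulus at \<open>C\<close>, which leaves room
    on both sides.\<close>
  define R where "R = (1 + max (cmod (rho_t (root1 C))) (cmod (rho_t (root2 C)))) / 2"
  have mx: "max (cmod (rho_t (root1 C))) (cmod (rho_t (root2 C))) < 1"
    using cmod_rho_t_less_1[OF r(1)] cmod_rho_t_less_1[OF r(2)] by simp
  have m0: "0 \<le> max (cmod (rho_t (root1 C))) (cmod (rho_t (root2 C)))" by (simp add: le_max_iff_disj)
  have R2: "2 * R = 1 + max (cmod (rho_t (root1 C))) (cmod (rho_t (root2 C)))" by (simp add: R_def)
  have R: "0 < R" "R < 1" "cmod (rho_t (root1 C)) < R" "cmod (rho_t (root2 C)) < R"
    using mx m0 R2 by linarith+
  define \<Omega> where "\<Omega> = {z. z \<notin> \<real>\<^sub>\<le>\<^sub>0} \<inter> {z. cmod (rho_t z) < R}"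
  have o1: "open {z. z \<notin> (\<real>\<^sub>\<le>\<^sub>0 :: complex set)}" using closed_nonpos_Reals_complex by (simp add: closed_def Compl_eq)
  have "continuous_on {z. z \<notin> \<real>\<^sub>\<le>\<^sub>0} (\<lambda>z. cmod (rho_t z))"
    by (intro continuous_on_norm continuous_at_imp_continuous_on ballI isCont_rho_t) simp
  from continuous_open_preimage[OF this o1 open_lessThan[of R]]
  have "open \<Omega>" unfolding \<Omega>_def by (simp add: vimage_def lessThan_def)
  have "root1 C \<in> \<Omega>" "root2 C \<in> \<Omega>" using r R by (auto simp: \<Omega>_def)
  from roots_eventually[OF nz[of 1 3] nz[of 2 4] \<open>open \<Omega>\<close> this]
  have ev1: "eventually (\<lambda>C'. root1 C' \<in> \<Omega> \<and> root2 C' \<in> \<Omega>) (nhds C)" by simp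
  have ev2: "eventually (\<lambda>C'. i \<noteq> j \<longrightarrow> Re (xsq i j C' / xsq i j C) > 0) (nhds C)" for i j
  proof (cases "i = j")
    case False
    have "isCont (\<lambda>C'. xsq i j C') C"
      using continuous_on_xsq[of UNIV i j] unfolding continuous_on_eq_continuous_at[OF open_UNIV]
      by (rule bspec) simp
    then have "((\<lambda>C'. xsq i j C') \<longlongrightarrow> xsq i j C) (nhds C)"
      unfolding isCont_def tendsto_at_iff_tendsto_nhds .
    then have "((\<lambda>C'. Re (xsq i j C' / xsq i j C)) \<longlongrightarrow> Re (xsq i j C / xsq i j C)) (nhds C)"
      using nz[OF False] by (intro tendsto_intros)
    then have "((\<lambda>C'. Re (xsq i j C' / xsq i j C)) \<longlongrightarrow> 1) (nhds C)" using nz[OF False] by simp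
    then have "\<forall>\<^sub>F C' in nhds C. Re (xsq i j C' / xsq i j C) > 0" by (rule order_tendstoD) simp
    then show ?thesis by (rule eventually_mono) simp
  qed simp
  have ev2': "eventually (\<lambda>C'. \<forall>i j. i \<noteq> j \<longrightarrow> Re (xsq i j C' / xsq i j C) > 0) (nhds C)"
    by (intro eventually_all_finite ev2)
  from ev1 ev2' have "eventually (\<lambda>C'. (root1 C' \<in> \<Omega> \<and> root2 C' \<in> \<Omega>) \<and> (\<forall>i j. i \<noteq> j \<longrightarrow> Re (xsq i j C' / xsq i j C) > 0)) (nhds C)"
    by (rule eventually_conj)
  then obtain e where e: "e > 0" "\<And>C'. dist C' C < e \<Longrightarrow> (root1 C' \<in> \<Omega> \<and> root2 C' \<in> \<Omega>) \<and> (\<forall>i j. i \<noteq> j \<longrightarrow> Re (xsq i j C' / xsq i j C) > 0)"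
    unfolding eventually_nhds_metric by blast
  have nd: "nondegenerate C'" if "C' \<in> ball C e" for C'
  proof -
    have e2: "(root1 C' \<in> \<Omega> \<and> root2 C' \<in> \<Omega>) \<and> (\<forall>i j. i \<noteq> j \<longrightarrow> Re (xsq i j C' / xsq i j C) > 0)"
      using that e(2)[of C'] by (simp add: dist_commute)
    have "xsq i j C' \<noteq> 0" if "i \<noteq> j" for i j
    proof
      assume "xsq i j C' = 0"
      moreover have "Re (xsq i j C' / xsq i j C) > 0" using e2 that by blast
      ultimately show False by simp
    qed
    then show ?thesis using e2 by (simp add: nondegenerate_def \<Omega>_def)
  qed
  have "continuous_on (ball C e) rho_prod" by (rule continuous_on_sqrt_rho(4)[OF nd])
  then have "isCont rho_prod C" using e(1) by (simp add: continuous_on_eq_continuous_at)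
  then have "(rho_prod \<longlongrightarrow> rho_prod C) (nhds C)"
    unfolding isCont_def tendsto_at_iff_tendsto_nhds .
  then have "((\<lambda>C'. Re (rho_prod C' / rho_prod C)) \<longlongrightarrow> Re (rho_prod C / rho_prod C)) (nhds C)"
    using nondegenerate_neq_1(4)[OF assms] by (intro tendsto_intros)
  then have "((\<lambda>C'. Re (rho_prod C' / rho_prod C)) \<longlongrightarrow> 1) (nhds C)"
    using nondegenerate_neq_1(4)[OF assms] by simp
  then have "\<forall>\<^sub>F C' in nhds C. Re (rho_prod C' / rho_prod C) > 0" by (rule order_tendstoD) simp
  then obtain e' where e': "e' > 0" "\<And>C'. dist C' C < e' \<Longrightarrow> Re (rho_prod C' / rho_prod C) > 0"
    unfolding eventually_nhds_metric by blast
  show ?thesis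
  proof (rule that[of "ball C (min e e')" R])
    fix C' assume C': "C' \<in> ball C (min e e')"
    then show "nondegenerate C'" "Re (rho_prod C' / rho_prod C) > 0"
      using nd e'(2) by (auto simp: dist_commute)
    have d: "dist C' C < e" using C' by (simp add: dist_commute)
    show "cmod (rho_t (root1 C')) \<le> R \<and> cmod (rho_t (root2 C')) \<le> R"
      using e(2)[OF d] by (auto simp: \<Omega>_def)
    show "Re (xsq i j C' / xsq i j C) > 0" if "i \<noteq> j" for i j
      using e(2)[OF d] that by blast
  qed (use e e' R in auto)
qed

text \<open>Logarithms of ratios to the values at \<open>C\<close> are regular around
  \<open>C\<close> even where a principal logarithm jumps. The constants carry the branches: k is
  meant as a logarithm of \<open>rho_prod C\<close>, l as one of the product of x23^2 and x14^2 at
  \<open>C\<close>.\<close>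

definition t_extension :: "(real \<Rightarrow> real \<Rightarrow> real) \<Rightarrow> real \<Rightarrow> 'n::finite config \<Rightarrow> complex \<Rightarrow> complex \<Rightarrow> 'n config \<Rightarrow> complex" where
  "t_extension b \<Delta> C k l C' =
     infsum (sym_term b (Ln (rho_prod C' / rho_prod C) + k) (rho_sum C') (rho_prod C')) ({0..} \<times> {0..})
       / exp (of_real \<Delta> * (Ln (xsq 2 3 C' / xsq 2 3 C) + Ln (xsq 1 4 C' / xsq 1 4 C) + l))"

lemma t_extension_analytic:
  fixes C :: "'n::finite config"
  assumes b: "ope_coeff b" and U: "open U" and R: "0 < R" "R < 1"
    and nd: "\<And>C'. C' \<in> U \<Longrightarrow> nondegenerate C'"
    and x: "\<And>C' i j. C' \<in> U \<Longrightarrow> i \<noteq> j \<Longrightarrow> Re (xsq i j C' / xsq i j C) > 0"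
    and rt: "\<And>C'. C' \<in> U \<Longrightarrow> cmod (rho_t (root1 C')) \<le> R \<and> cmod (rho_t (root2 C')) \<le> R"
    and rp: "\<And>C'. C' \<in> U \<Longrightarrow> Re (rho_prod C' / rho_prod C) > 0"
    and C: "nondegenerate C" and k: "exp k = rho_prod C"
  shows "tau_analytic_on U (t_extension b \<Delta> C k l)"
proof -
  \<comment> \<open>The height at which |exp (i w)| = R, so that \<open>g_majorant b y\<close>
    dominates the terms on all of \<open>U\<close>.\<close>
  define y where "y = - ln R"
  have y: "y > 0" "exp (- y) = R" using R by (auto simp: y_def)
  have C0: "rho_prod C \<noteq> 0" "xsq 2 3 C \<noteq> 0" "xsq 1 4 C \<noteq> 0"
    using nondegenerate_neq_1[OF C] C by (auto simp: nondegenerate_def)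
  define \<Theta> where "\<Theta> C' = Ln (rho_prod C' / rho_prod C) + k" for C' :: "'n config"
  have np: "rho_prod C' / rho_prod C \<notin> \<real>\<^sub>\<le>\<^sub>0" if "C' \<in> U" for C'
    using rp[OF that] unfolding complex_nonpos_Reals_iff by linarith
  have npx: "xsq i j C' / xsq i j C \<notin> \<real>\<^sub>\<le>\<^sub>0" if "C' \<in> U" "i \<noteq> j" for C' i j
    using x[OF that] unfolding complex_nonpos_Reals_iff by linarith
  have exp\<Theta>: "exp (\<Theta> C') = rho_t (root1 C') * rho_t (root2 C')" if "C' \<in> U" for C'
  proof -
    have "rho_prod C' / rho_prod C \<noteq> 0" using rp[OF that] by auto
    then have "exp (\<Theta> C') = rho_prod C' / rho_prod C * rho_prod C" unfolding \<Theta>_def exp_add k by simp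
    then show ?thesis using C0 by (simp add: rho_prod_def)
  qed
  have bd: "cmod (sym_term b (\<Theta> C') (rho_sum C') (rho_prod C') i) \<le> g_majorant b y i"
    if "i \<in> {0..} \<times> {0..}" "C' \<in> U" for i C'
    unfolding rho_sum_def rho_prod_def
    by (rule sym_term_bound[OF b that(1) exp\<Theta>[OF that(2)]])
       (use rt[OF that(2)] y(2) rho_t_nonzero nondegenerate_neq_1[OF nd[OF that(2)]] in auto)
  note cont = continuous_on_sqrt_rho[OF nd]
  have c\<Theta>: "continuous_on U \<Theta>"
    unfolding \<Theta>_def[abs_def] using cont(4) np C0 by (intro continuous_intros) auto
  have csym: "continuous_on U (\<lambda>C'. sym_term b (\<Theta> C') (rho_sum C') (rho_prod C') i)" for i
    unfolding sym_term_def case_prod_unfold using c\<Theta> cont by (intro continuous_intros) auto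
  have u1: "uniform_limit U (\<lambda>X C'. \<Sum>i\<in>X. sym_term b (\<Theta> C') (rho_sum C') (rho_prod C') i)
      (\<lambda>C'. \<Sum>\<^sub>\<infinity>i\<in>{0..} \<times> {0..}. sym_term b (\<Theta> C') (rho_sum C') (rho_prod C') i) (finite_subsets_at_top ({0..} \<times> {0..}))"
    by (rule Weierstrass_m_test_general[OF bd g_majorant_summable[OF b y(1)]])
  have u2: "\<forall>\<^sub>F X in finite_subsets_at_top ({0..} \<times> {0..}).
      continuous_on U (\<lambda>C'. \<Sum>i\<in>X. sym_term b (\<Theta> C') (rho_sum C') (rho_prod C') i)"
    by (intro always_eventually allI continuous_on_sum csym)
  have cs: "continuous_on U (\<lambda>C'. \<Sum>\<^sub>\<infinity>i\<in>{0..} \<times> {0..}. sym_term b (\<Theta> C') (rho_sum C') (rho_prod C') i)"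
    by (rule uniform_limit_theorem[OF u2 u1]) simp
  have cL: "continuous_on U (\<lambda>C'. Ln (xsq i j C' / xsq i j C))" if "i \<noteq> j" "xsq i j C \<noteq> 0" for i j
    by (rule continuous_on_Ln'[OF _ npx[OF _ that(1)]]) (use that(2) in \<open>auto intro!: continuous_intros\<close>)
  have "continuous_on U (t_extension b \<Delta> C k l)"
    unfolding t_extension_def[abs_def] \<Theta>_def[symmetric]
    by (rule continuous_on_divide[OF cs]) (auto intro!: continuous_intros cL C0)
  moreover have "cdiff (\<lambda>\<tau>. t_extension b \<Delta> C k l (\<tau>, snd C')) (fst C')" if C': "C' \<in> U" for C'
  proof -
    obtain \<tau>0 x0 where C'eq: "C' = (\<tau>0, x0)" by (cases C')
    have "open ((\<lambda>\<tau>. (\<tau>, x0)) -` U)" by (rule open_vimage[OF U]) (intro continuous_intros)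
    moreover have "\<tau>0 \<in> (\<lambda>\<tau>. (\<tau>, x0)) -` U" using C' C'eq by simp
    ultimately have "\<exists>r>0. ball \<tau>0 r \<subseteq> (\<lambda>\<tau>. (\<tau>, x0)) -` U"
      unfolding open_contains_ball by (rule bspec)
    then obtain r where r: "r > 0" "ball \<tau>0 r \<subseteq> (\<lambda>\<tau>. (\<tau>, x0)) -` U" by (elim exE conjE)
    have inU: "(\<tau>, x0) \<in> U" if "\<tau> \<in> ball \<tau>0 r" for \<tau>
      using subsetD[OF r(2) that] by (rule vimageD)
    have dlog: "cdiff (\<lambda>\<tau>. Ln (f (\<tau>, x0) / a)) \<tau>" if "cdiff (\<lambda>\<tau>. f (\<tau>, x0)) \<tau>" "f (\<tau>, x0) / a \<notin> \<real>\<^sub>\<le>\<^sub>0" "a \<noteq> 0"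
      for f :: "'n config \<Rightarrow> complex" and a \<tau>
      by (rule cdiff_compose[OF cdiff_divide[OF that(1) cdiff_const that(3)]])
         (rule field_differentiable_at_Ln[OF that(2)])
    have dexp: "cdiff (\<lambda>\<tau>. exp (f \<tau>)) \<tau>" if "cdiff f \<tau>" for f \<tau>
      by (rule cdiff_compose[OF that]) (rule field_differentiable_within_exp)
    have dsym: "cdiff (\<lambda>\<tau>. sym_term b (\<Theta> (\<tau>, x0)) (rho_sum (\<tau>, x0)) (rho_prod (\<tau>, x0)) i) \<tau>"
      if "\<tau> \<in> ball \<tau>0 r" for i \<tau>
      unfolding sym_term_def case_prod_unfold \<Theta>_def
      by (intro cdiff_mult cdiff_const dexp cdiff_add cdiff_power_sum dlog np inU that C0 cdiff_sqrt_rho[OF nd U])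
    have "cdiff (\<lambda>\<tau>. infsum (\<lambda>i. sym_term b (\<Theta> (\<tau>, x0)) (rho_sum (\<tau>, x0)) (rho_prod (\<tau>, x0)) i) ({0..} \<times> {0..})) \<tau>0"
      by (rule cdiff_infsum[OF dsym bd[OF _ inU] g_majorant_summable[OF b y(1)] r(1)])
    moreover have t0: "\<tau>0 \<in> ball \<tau>0 r" using r(1) by simp
    have "cdiff (\<lambda>\<tau>. exp (of_real \<Delta> * (Ln (xsq 2 3 (\<tau>, x0) / xsq 2 3 C) + Ln (xsq 1 4 (\<tau>, x0) / xsq 1 4 C) + l))) \<tau>0"
      by (intro dexp cdiff_mult cdiff_add cdiff_const dlog cdiff_xsq npx inU[OF t0] C0) simp_all
    ultimately show ?thesis
      unfolding t_extension_def \<Theta>_def C'eq fst_conv snd_conv by (rule cdiff_divide) simp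
  qed
  ultimately show ?thesis unfolding tau_analytic_on_def cdiff_def by blast
qed

subsection \<open>Identification with the four-point function\<close>

text \<open>The inverse map x / (1 + x) sends (-1,0] into the nonpositive reals and x < -1 into
  [1,oo); x = -1 corresponds to z at infinity.\<close>

lemma ratio_notin_nonpos_Reals:
  assumes "z \<notin> \<real>\<^sub>\<le>\<^sub>0" "z \<notin> one_to_inf"
  shows "z / (1 - z) \<notin> \<real>\<^sub>\<le>\<^sub>0" "1 - z \<noteq> 0"
proof -
  have "1 \<in> one_to_inf" unfolding one_to_inf_def by (rule image_eqI[of _ _ 1]) auto
  with assms(2) show z1: "1 - z \<noteq> 0" by auto
  show "z / (1 - z) \<notin> \<real>\<^sub>\<le>\<^sub>0"
  proof
    assume "z / (1 - z) \<in> \<real>\<^sub>\<le>\<^sub>0"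
    then obtain x where x: "z / (1 - z) = of_real x" "x \<le> 0" by (auto elim: nonpos_Reals_cases)
    then have "z = of_real x * (1 - z)" using z1 by (simp add: field_simps)
    then have zx: "z * of_real (1 + x) = of_real x" by (simp add: algebra_simps)
    have "1 + x \<noteq> 0"
    proof
      assume "1 + x = 0"
      then have "complex_of_real x = 0" "x = - 1" using zx by (simp, linarith)
      then show False by simp
    qed
    then have "complex_of_real (1 + x) \<noteq> 0" by (metis of_real_eq_0_iff)
    then have "z = of_real x / of_real (1 + x)" using zx by (rule eq_divide_imp)
    then have z: "z = of_real (x / (1 + x))" by (simp only: of_real_divide)
    show False
    proof (cases "1 + x > 0")
      case True
      then have "x / (1 + x) \<le> 0" using x(2) by (simp add: divide_le_0_iff)
      then show False using assms(1) unfolding z by (simp only: nonpos_Reals_of_real_iff not_True_eq_False)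
    next
      case False
      with \<open>1 + x \<noteq> 0\<close> have "x / (1 + x) \<ge> 1" by (simp add: le_divide_eq)
      then show False using assms(2) unfolding z one_to_inf_def by blast
    qed
  qed
qed

text \<open>On the nondegenerate part of \<open>Dom\<close> this takes values in 2 pi i Z and equals
  - 2 pi i times the sum of the crossing numbers of any path that ends there. Being a function of
  the configuration alone, it shows that this sum does not depend on the path.\<close>

definition cross_defect :: "'n::finite config \<Rightarrow> complex" where
  "cross_defect C = Ln (root1 C / (1 - root1 C)) + Ln (root2 C / (1 - root2 C)) - log_cross C"

text \<open>The crossing numbers of a path are read off from the configuration it has reached.\<close>
lemma cross_defect_path:
  assumes path: "admissible_path \<gamma>" "continuation \<gamma> z zb chi chib" "s \<in> {0..1}" "s < 1 \<or> \<gamma> s \<in> Dom"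
    and w: "w \<in> S_strip" "wb \<in> S_strip" "chi s = w + 2 * of_int n * of_real pi" "chib s = wb + 2 * of_int m * of_real pi"
  shows "cross_defect (\<gamma> s) = - (2 * of_int (n + m) * of_real pi * \<i>)"
    and "is_zzbar (\<gamma> s) (z_of_chi w) (z_of_chi wb)"
proof -
  have zz: "is_zzbar (\<gamma> s) (z s) (zb s)" using path(2,3) unfolding continuation_def by blast
  have "z s = z_of_chi w" "zb s = z_of_chi wb"
    using continuation_interior(4,5)[OF path] unfolding w(3,4) z_of_chi_shift by simp_all
  with zz show zz': "is_zzbar (\<gamma> s) (z_of_chi w) (z_of_chi wb)" by simp
  have "log_cross (\<gamma> s) = log_ratio w + log_ratio wb + 2 * of_int (n + m) * of_real pi * \<i>"
    unfolding continuation_log_cross[OF path, symmetric] w(3,4) log_ratio_shift by (simp add: algebra_simps)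
  moreover have "log_ratio w + log_ratio wb
      = Ln (root1 (\<gamma> s) / (1 - root1 (\<gamma> s))) + Ln (root2 (\<gamma> s) / (1 - root2 (\<gamma> s)))"
    unfolding log_ratio_eq_Ln[OF w(1)] log_ratio_eq_Ln[OF w(2)]
    by (rule symmetric_sum_roots[OF zz', of "\<lambda>z. Ln (z / (1 - z))"])
  ultimately show "cross_defect (\<gamma> s) = - (2 * of_int (n + m) * of_real pi * \<i>)"
    by (simp add: cross_defect_def)
qed

text \<open>The exponential is 1, and z / (1 - z) meets the cut of the logarithm only on the rays
  that are excluded here; symmetry in the two roots makes up for their lack of continuity.\<close>

lemma cross_defect_constant:
  fixes V :: "'n::finite config set"
  assumes V: "connected V" "V \<subseteq> Dom" "\<And>C. C \<in> V \<Longrightarrow> nondegenerate C" and C: "C1 \<in> V" "C2 \<in> V"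
  shows "cross_defect C1 = cross_defect C2"
proof (rule continuous_exp_eq_1_constant[OF V(1) _ _ C(2,1)])
  have r: "root1 C \<notin> \<real>\<^sub>\<le>\<^sub>0" "root2 C \<notin> \<real>\<^sub>\<le>\<^sub>0" "root1 C \<notin> one_to_inf" "root2 C \<notin> one_to_inf" if "C \<in> V" for C
  proof -
    have D: "C \<in> Dom" using that V(2) by blast
    show "root1 C \<notin> one_to_inf" by (rule Dom_zzbar(1)[OF D is_zzbar_roots])
    show "root2 C \<notin> one_to_inf" by (rule Dom_zzbar(1)[OF D is_zzbar_roots[THEN is_zzbar_commute[THEN iffD1]]])
    show "root1 C \<notin> \<real>\<^sub>\<le>\<^sub>0" "root2 C \<notin> \<real>\<^sub>\<le>\<^sub>0" using V(3)[OF that] by (simp_all add: nondegenerate_def)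
  qed
  have ic: "isCont (\<lambda>z. Ln (z / (1 - z))) z" if "z \<notin> \<real>\<^sub>\<le>\<^sub>0" "z \<notin> one_to_inf" for z
    using ratio_notin_nonpos_Reals[OF that] by (intro continuous_intros) auto
  have "continuous_on V (\<lambda>C. Ln (root1 C / (1 - root1 C)) + Ln (root2 C / (1 - root2 C)))"
  proof (rule continuous_on_symmetric_sum[where f = "\<lambda>z. Ln (z / (1 - z))" and z = root1 and zb = root2])
    have nz: "xsq 1 3 C \<noteq> 0 \<and> xsq 2 4 C \<noteq> 0" if "C \<in> V" for C using V(3)[OF that] by (simp add: nondegenerate_def)
    show "continuous_on V (\<lambda>C. root1 C + root2 C)" "continuous_on V (\<lambda>C. root1 C * root2 C)"
      by (rule continuous_on_roots_sum_prod[OF nz]; assumption)+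
  qed (use r ic in blast)+
  then show "continuous_on V cross_defect"
    unfolding cross_defect_def[abs_def]
    by (intro continuous_on_diff continuous_on_subset[OF continuous_on_log_cross V(2)])
  fix C assume "C \<in> V"
  then have D: "C \<in> Dom" using V(2) by blast
  have nz: "root1 C / (1 - root1 C) \<noteq> 0" "root2 C / (1 - root2 C) \<noteq> 0"
    using ratio_notin_nonpos_Reals(1)[OF r(1,3)[OF \<open>C \<in> V\<close>]] ratio_notin_nonpos_Reals(1)[OF r(2,4)[OF \<open>C \<in> V\<close>]]
    by (auto simp only: nonpos_Reals_zero_I)
  have lc: "exp (log_cross C) = root1 C / (1 - root1 C) * (root2 C / (1 - root2 C))"
    by (rule exp_log_cross[OF xsq_Dom_nonzero[OF D] is_zzbar_roots])
  have "exp (cross_defect C) = exp (Ln (root1 C / (1 - root1 C))) * exp (Ln (root2 C / (1 - root2 C))) / exp (log_cross C)"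
    unfolding cross_defect_def exp_diff exp_add ..
  also have "\<dots> = 1"
    unfolding exp_Ln[OF nz(1)] exp_Ln[OF nz(2)] lc[symmetric] by (rule divide_self[OF exp_not_eq_zero])
  finally show "exp (cross_defect C) = 1" .
qed

lemma symmetric_prod_roots:
  assumes "is_zzbar C z zb"
  shows "f z * f zb = f (root1 C) * (f (root2 C) :: complex)"
  using is_zzbar_unique[OF is_zzbar_roots assms] by (auto simp: mult.commute)

lemma path_end_S_ext:
  assumes path: "admissible_path \<gamma>" "continuation \<gamma> z zb chi chib" "pathfinish \<gamma> = C" and C: "nondegenerate C"
  obtains w wb where "w \<in> S_ext" "wb \<in> S_ext" "chi 1 = w + 2 * of_int (crossings (chi 1)) * of_real pi"
    "chib 1 = wb + 2 * of_int (crossings (chib 1)) * of_real pi" "is_zzbar C (z_of_chi w) (z_of_chi wb)"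
proof -
  note ends = continuation_end[OF path(1,2)]
  have zz0: "\<forall>s\<in>{0..1}. is_zzbar (\<gamma> s) (z s) (zb s)" using path(2) unfolding continuation_def by (elim conjE)
  have zz: "is_zzbar C (z 1) (zb 1)" using bspec[OF zz0, of 1] path(3) by (simp add: pathfinish_def)
  have zc: "z 1 = root1 C \<and> zb 1 = root2 C \<or> z 1 = root2 C \<and> zb 1 = root1 C"
    by (rule is_zzbar_unique[OF is_zzbar_roots zz])
  have "neg_reals \<subseteq> \<real>\<^sub>\<le>\<^sub>0" by (auto simp: neg_reals_def)
  moreover have "root1 C \<notin> \<real>\<^sub>\<le>\<^sub>0" "root2 C \<notin> \<real>\<^sub>\<le>\<^sub>0" using C by (simp_all add: nondegenerate_def)
  ultimately have np: "root1 C \<notin> neg_reals" "root2 C \<notin> neg_reals" by (meson subsetD)+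
  have z: "z 1 \<notin> neg_reals" "z 1 \<noteq> 1" "zb 1 \<notin> neg_reals" "zb 1 \<noteq> 1"
    using zc np nondegenerate_neq_1(1,2)[OF C] by (elim disjE conjE; simp)+
  obtain w where w: "w \<in> S_ext" "chi 1 = w + 2 * of_int (crossings (chi 1)) * of_real pi"
    by (rule shift_to_S_ext[OF ends(5) ends(3) z(1)[unfolded ends(1)] z(2)[unfolded ends(1)]])
  obtain wb where wb: "wb \<in> S_ext" "chib 1 = wb + 2 * of_int (crossings (chib 1)) * of_real pi"
    by (rule shift_to_S_ext[OF ends(6) ends(4) z(3)[unfolded ends(2)] z(4)[unfolded ends(2)]])
  have "z 1 = z_of_chi w" unfolding ends(1) by (subst w(2)) (rule z_of_chi_shift)
  moreover have "zb 1 = z_of_chi wb" unfolding ends(2) by (subst wb(2)) (rule z_of_chi_shift)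
  ultimately have "is_zzbar C (z_of_chi w) (z_of_chi wb)" using zz by (simp only:)
  with w(1) wb(1) w(2) wb(2) show ?thesis by (rule that)
qed

text \<open>The end value may lie on the boundary segments of \<open>S_ext\<close>, but before the
  end Im chi > 0, so the shifted values lie in the open strip.\<close>

lemma eventually_S_strip:
  fixes chi :: "real \<Rightarrow> complex"
  assumes chi: "continuous_on {0..1} chi" "\<And>s. s \<in> {0..<1} \<Longrightarrow> Im (chi s) > 0"
    and w: "w \<in> S_ext" "chi 1 = w + 2 * of_int n * of_real pi"
  shows "((\<lambda>s. chi s - 2 * of_int n * of_real pi) \<longlongrightarrow> w) (at 1 within {0..<1})"
    and "eventually (\<lambda>s. chi s - 2 * of_int n * of_real pi \<in> S_strip) (at 1 within {0..<1})"
proof -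
  have "(chi \<longlongrightarrow> chi 1) (at 1 within {0..1})" using chi(1) unfolding continuous_on_def by (rule bspec) simp
  then have "(chi \<longlongrightarrow> chi 1) (at 1 within {0..<1})" by (rule tendsto_within_subset) auto
  then have "((\<lambda>s. chi s - 2 * of_int n * of_real pi) \<longlongrightarrow> chi 1 - 2 * of_int n * of_real pi) (at 1 within {0..<1})"
    by (intro tendsto_intros)
  then show t: "((\<lambda>s. chi s - 2 * of_int n * of_real pi) \<longlongrightarrow> w) (at 1 within {0..<1})" by (simp add: w(2))
  have tr: "((\<lambda>s. Re (chi s - 2 * of_int n * of_real pi)) \<longlongrightarrow> Re w) (at 1 within {0..<1})"
    using t by (intro tendsto_intros)
  have b: "- pi < Re w" "Re w < pi" using w(1) by (simp_all add: S_ext_def)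
  have "eventually (\<lambda>s. s \<in> {0..<1}) (at 1 within {0..<1::real})" by (simp add: eventually_at_filter)
  with order_tendstoD(1)[OF tr b(1)] order_tendstoD(2)[OF tr b(2)]
  show "eventually (\<lambda>s. chi s - 2 * of_int n * of_real pi \<in> S_strip) (at 1 within {0..<1})"
  proof eventually_elim
    case (elim s)
    then show ?case using chi(2)[OF elim(3)] by (simp add: S_strip_def)
  qed
qed

lemma at_1_within_nontrivial: "at 1 within {0..<1::real} \<noteq> bot"
  by (simp add: trivial_limit_within islimpt_Ico)

lemma path_approach:
  fixes C :: "'n::finite config"
  assumes path: "admissible_path \<gamma>" "pathfinish \<gamma> = C" "continuation \<gamma> z zb chi chib" and U: "open U" "C \<in> U"
    and w: "w \<in> S_ext" "wb \<in> S_ext" "chi 1 = w + 2 * of_int n * of_real pi" "chib 1 = wb + 2 * of_int m * of_real pi"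
  shows "(\<gamma> \<longlongrightarrow> C) (at 1 within {0..<1})"
    and "eventually (\<lambda>s. \<gamma> s \<in> U \<inter> Dom \<and> s \<in> {0..<1} \<and> chi s - 2 * of_int n * of_real pi \<in> S_strip
      \<and> chib s - 2 * of_int m * of_real pi \<in> S_strip) (at 1 within {0..<1})"
proof -
  have c: "continuous_on {0..1} chi" "continuous_on {0..1} chib" using path(3) unfolding continuation_def by blast+
  have int: "Im (chi s) > 0 \<and> Im (chib s) > 0 \<and> \<gamma> s \<in> Dom" if "s \<in> {0..<1}" for s
    using continuation_before_end(1-3)[OF path(1,3) that] by simp
  have "continuous_on {0..1} \<gamma>" using path(1) by (simp add: admissible_path_def path_def)
  then have "(\<gamma> \<longlongrightarrow> \<gamma> 1) (at 1 within {0..1})" unfolding continuous_on_def by (rule bspec) simp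
  then have "(\<gamma> \<longlongrightarrow> \<gamma> 1) (at 1 within {0..<1})" by (rule tendsto_within_subset) auto
  then show t: "(\<gamma> \<longlongrightarrow> C) (at 1 within {0..<1})" using path(2) by (simp add: pathfinish_def)
  have ev: "eventually (\<lambda>s. s \<in> {0..<1}) (at 1 within {0..<1::real})" by (simp add: eventually_at_filter)
  have 1: "eventually (\<lambda>s. chi s - 2 * of_int n * of_real pi \<in> S_strip) (at 1 within {0..<1})"
    by (rule eventually_S_strip(2)[OF c(1) _ w(1,3)]) (use int in blast)
  have 2: "eventually (\<lambda>s. chib s - 2 * of_int m * of_real pi \<in> S_strip) (at 1 within {0..<1})"
    by (rule eventually_S_strip(2)[OF c(2) _ w(2,4)]) (use int in blast)
  from topological_tendstoD[OF t U] ev 1 2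
  show "eventually (\<lambda>s. \<gamma> s \<in> U \<inter> Dom \<and> s \<in> {0..<1} \<and> chi s - 2 * of_int n * of_real pi \<in> S_strip
      \<and> chib s - 2 * of_int m * of_real pi \<in> S_strip) (at 1 within {0..<1})"
    by eventually_elim (use int in blast)
qed

text \<open>\<open>C\<close> may lie outside \<open>Dom\<close>, where \<open>log_cross\<close> need
  not be the continued branch; the defect is therefore read off just before the end of the
  path.\<close>

lemma cross_defect_near_end:
  fixes C :: "'n::finite config"
  assumes path: "admissible_path \<gamma>" "pathfinish \<gamma> = C" "continuation \<gamma> z zb chi chib" and U: "open U" "C \<in> U"
    and C: "nondegenerate C"
  obtains C' where "C' \<in> U \<inter> Dom"
    "cross_defect C' = - (2 * of_int (crossings (chi 1) + crossings (chib 1)) * of_real pi * \<i>)"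
proof -
  obtain w wb where w: "w \<in> S_ext" "wb \<in> S_ext" "chi 1 = w + 2 * of_int (crossings (chi 1)) * of_real pi"
    "chib 1 = wb + 2 * of_int (crossings (chib 1)) * of_real pi"
    using path_end_S_ext[OF path(1,3,2) C] by metis
  obtain s where s: "\<gamma> s \<in> U \<inter> Dom" "s \<in> {0..<1}" "chi s - 2 * of_int (crossings (chi 1)) * of_real pi \<in> S_strip"
      "chib s - 2 * of_int (crossings (chib 1)) * of_real pi \<in> S_strip"
    using eventually_happens'[OF at_1_within_nontrivial path_approach(2)[OF path U w]] by metis
  have s01: "s \<in> {0..1}" "s < 1" using s(2) by auto
  have "cross_defect (\<gamma> s) = - (2 * of_int (crossings (chi 1) + crossings (chib 1)) * of_real pi * \<i>)"
    by (rule cross_defect_path(1)[OF path(1,3) s01(1) disjI1[OF s01(2)] s(3,4)]) simp_all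
  with s(1) show ?thesis by (rule that)
qed

lemma sym_series_Phi_ext:
  fixes C :: "'n::finite config" and GE :: "'n config \<Rightarrow> complex"
  assumes E: "euclidean_four_point \<Delta> GE g c b"
    and w: "w \<in> S_ext" "wb \<in> S_ext" "is_zzbar C (z_of_chi w) (z_of_chi wb)"
  shows "infsum (sym_term b (\<i> * (Phi_ext w + Phi_ext wb)) (rho_sum C) (rho_prod C)) ({0..} \<times> {0..})
    = g_series b (Phi_ext w) (Phi_ext wb)"
proof -
  have "rho_sum C = exp (\<i> * Phi_ext w) + exp (\<i> * Phi_ext wb)"
    unfolding exp_Phi_ext[OF w(1)] exp_Phi_ext[OF w(2)] rho_sum_def by (rule symmetric_sum_roots[OF w(3), symmetric])
  moreover have "rho_prod C = exp (\<i> * Phi_ext w) * exp (\<i> * Phi_ext wb)"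
    unfolding exp_Phi_ext[OF w(1)] exp_Phi_ext[OF w(2)] rho_prod_def by (rule symmetric_prod_roots[OF w(3), symmetric])
  ultimately show ?thesis
    using sym_series_eq[OF euclidean_ope_coeff[OF E] Im_Phi_ext_pos[OF w(1)] Im_Phi_ext_pos[OF w(2)]
        g_series_symmetric[OF E Im_Phi_ext_pos[OF w(1)] Im_Phi_ext_pos[OF w(2)]]] by simp
qed

lemma sum_Ln_rho_t:
  assumes "w \<in> S_strip" "wb \<in> S_strip" "is_zzbar C (z_of_chi w) (z_of_chi wb)"
  shows "\<i> * (Phi_ext w + Phi_ext wb) = Ln (rho_t (root1 C)) + Ln (rho_t (root2 C))"
  unfolding distrib_left Phi_ext_eq_Ln[OF assms(1)] Phi_ext_eq_Ln[OF assms(2)]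
  by (rule symmetric_sum_roots[OF assms(3), of "\<lambda>z. Ln (rho_t z)"])

text \<open>The intersection of a convex neighbourhood with \<open>Dom\<close> is connected, and the
  path witnessing \<open>N_t_equals C 0\<close> shows that the defect vanishes on it. So admissible
  paths to its points have crossing sum 0, and the t-channel formula holds there with the same
  branches. The identities for logarithms are exported to evaluate the extension at
  \<open>C\<close>.\<close>

lemma local_extension:
  fixes GE G4 :: "'n::finite config \<Rightarrow> complex" and C :: "'n config"
  assumes E: "euclidean_four_point \<Delta> GE g c b" and G: "four_point_continuation \<Delta> GE b G4"
    and C: "nondegenerate C" and N: "N_t_equals C 0"
  obtains U k k23 k14 where "open U" "C \<in> U" "exp k = rho_prod C" "convex U"
    "\<And>C'. C' \<in> U \<Longrightarrow> nondegenerate C'"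
    "tau_analytic_on U (t_extension b \<Delta> C k (k23 + k14))"
    "\<And>C'. C' \<in> U \<inter> Dom \<Longrightarrow> t_extension b \<Delta> C k (k23 + k14) C' = G4 C'"
    "\<And>C'. C' \<in> U \<inter> Dom \<Longrightarrow> Ln (rho_t (root1 C')) + Ln (rho_t (root2 C')) = Ln (rho_prod C' / rho_prod C) + k"
    "\<And>C'. C' \<in> U \<inter> Dom \<Longrightarrow> Ln (xsq 2 3 C') = Ln (xsq 2 3 C' / xsq 2 3 C) + k23"
    "\<And>C'. C' \<in> U \<inter> Dom \<Longrightarrow> Ln (xsq 1 4 C') = Ln (xsq 1 4 C' / xsq 1 4 C) + k14"
    "\<And>C'. C' \<in> U \<inter> Dom \<Longrightarrow> cross_defect C' = 0"
proof -
  have b: "ope_coeff b" by (rule euclidean_ope_coeff[OF E])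
  show ?thesis
  proof (rule good_neighbourhood[OF C])
  fix U R assume U: "open U" "C \<in> U" "convex U" and R: "0 < R" "R < 1"
    and nd: "\<And>C'. C' \<in> U \<Longrightarrow> nondegenerate C'"
    and x: "\<And>C' i j. C' \<in> U \<Longrightarrow> i \<noteq> j \<Longrightarrow> Re (xsq i j C' / xsq i j C) > 0"
    and rt: "\<And>C'. C' \<in> U \<Longrightarrow> cmod (rho_t (root1 C')) \<le> R \<and> cmod (rho_t (root2 C')) \<le> R"
    and rp: "\<And>C'. C' \<in> U \<Longrightarrow> Re (rho_prod C' / rho_prod C) > 0"
  obtain \<gamma>0 z0 zb0 chi0 chib0 where p0: "admissible_path \<gamma>0" "pathfinish \<gamma>0 = C" "continuation \<gamma>0 z0 zb0 chi0 chib0"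
    and N0: "0 = crossings (chi0 1) + crossings (chib0 1)"
    using N unfolding N_t_equals_def by (elim exE conjE)
  define V where "V = U \<inter> Dom"
  have oV: "open V" unfolding V_def using U(1) open_Dom by (rule open_Int)
  have cV: "connected V" unfolding V_def by (intro convex_connected convex_Int U(3) convex_Dom)
  have VD: "C' \<in> Dom" "C' \<in> U" if "C' \<in> V" for C' using that by (simp_all add: V_def)
  obtain C0 where C0: "C0 \<in> V" "cross_defect C0 = 0"
    using cross_defect_near_end[OF p0 U(1,2) C] unfolding N0[symmetric] V_def by auto
  have cd: "cross_defect C' = 0" if "C' \<in> V" for C'
    using cross_defect_constant[OF cV _ nd[OF VD(2)] that C0(1)] C0(2) by (simp add: V_def)
  have Vne: "V \<noteq> {}" using C0(1) by blast
  have lx: "\<exists>k. \<forall>C'\<in>V. Ln (xsq i j C') = Ln (xsq i j C' / xsq i j C) + k" if "i \<noteq> j" for i j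
  proof -
    have c1: "continuous_on V (\<lambda>C. Ln (xsq i j C))"
      by (rule continuous_on_subset[OF continuous_on_Ln_xsq[OF that]]) (simp add: V_def)
    have c2: "continuous_on V (\<lambda>C. xsq i j C)" by (intro continuous_intros)
    have e1: "exp (Ln (xsq i j C')) = xsq i j C'" if "C' \<in> V" for C'
      by (rule exp_Ln[OF xsq_Dom_nonzero[OF VD(1)[OF that] \<open>i \<noteq> j\<close>]])
    have r1: "Re (xsq i j C' / xsq i j C) > 0" if "C' \<in> V" for C' by (rule x[OF VD(2)[OF that] \<open>i \<noteq> j\<close>])
    show ?thesis
      by (rule local_logarithm[OF cV Vne c1 c2 e1 r1]) (assumption | blast)+
  qed
  have "(2::4) \<noteq> 3" "(1::4) \<noteq> 4" by simp_all
  note ne = this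
  obtain k23 where k23: "\<forall>C'\<in>V. Ln (xsq 2 3 C') = Ln (xsq 2 3 C' / xsq 2 3 C) + k23"
    using lx[OF ne(1)] by (elim exE)
  obtain k14 where k14: "\<forall>C'\<in>V. Ln (xsq 1 4 C') = Ln (xsq 1 4 C' / xsq 1 4 C) + k14"
    using lx[OF ne(2)] by (elim exE)
  have r: "root1 C' \<notin> \<real>\<^sub>\<le>\<^sub>0" "root2 C' \<notin> \<real>\<^sub>\<le>\<^sub>0" "root1 C' \<notin> one_to_inf" "root2 C' \<notin> one_to_inf"
      "root1 C' \<noteq> 1" "root2 C' \<noteq> 1" if "C' \<in> V" for C'
  proof -
    show "root1 C' \<notin> one_to_inf" by (rule Dom_zzbar(1)[OF VD(1)[OF that] is_zzbar_roots])
    show "root2 C' \<notin> one_to_inf" by (rule Dom_zzbar(1)[OF VD(1)[OF that] is_zzbar_roots[THEN is_zzbar_commute[THEN iffD1]]])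
    show "root1 C' \<notin> \<real>\<^sub>\<le>\<^sub>0" "root2 C' \<notin> \<real>\<^sub>\<le>\<^sub>0" using nd[OF VD(2)[OF that]] by (simp_all add: nondegenerate_def)
    show "root1 C' \<noteq> 1" "root2 C' \<noteq> 1" by (rule nondegenerate_neq_1[OF nd[OF VD(2)[OF that]]])+
  qed
  have ic: "isCont (\<lambda>z. Ln (rho_t z)) z" if "z \<notin> \<real>\<^sub>\<le>\<^sub>0" "z \<notin> one_to_inf" for z
    using isCont_rho_t[OF that(1)] rho_t_notin_nonpos_Reals[OF that] by (rule isCont_Ln')
  have "\<exists>k. exp k = rho_prod C \<and> (\<forall>C'\<in>V. Ln (rho_t (root1 C')) + Ln (rho_t (root2 C')) = Ln (rho_prod C' / rho_prod C) + k)"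
  proof -
    have "continuous_on V (\<lambda>C'. Ln (rho_t (root1 C')) + Ln (rho_t (root2 C')))"
    proof (rule continuous_on_symmetric_sum[where f = "\<lambda>z. Ln (rho_t z)" and z = root1 and zb = root2])
      have nz: "xsq 1 3 C \<noteq> 0 \<and> xsq 2 4 C \<noteq> 0" if "C \<in> V" for C using nd[OF VD(2)[OF that]] by (simp add: nondegenerate_def)
      show "continuous_on V (\<lambda>C. root1 C + root2 C)" "continuous_on V (\<lambda>C. root1 C * root2 C)"
        by (rule continuous_on_roots_sum_prod[OF nz]; assumption)+
    qed (use r ic in blast)+
    note c1 = this
    have c2: "continuous_on V rho_prod" by (rule continuous_on_sqrt_rho(4)[OF nd[OF VD(2)]])
    have e1: "exp (Ln (rho_t (root1 C')) + Ln (rho_t (root2 C'))) = rho_prod C'" if "C' \<in> V" for C'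
      using rho_t_nonzero r(5,6)[OF that] by (simp add: exp_add rho_prod_def)
    have r1: "Re (rho_prod C' / rho_prod C) > 0" if "C' \<in> V" for C' by (rule rp[OF VD(2)[OF that]])
    show ?thesis
      by (rule local_logarithm[OF cV Vne c1 c2 e1 r1]) (assumption | blast)+
  qed
  then obtain k where k: "exp k = rho_prod C"
    "\<forall>C'\<in>V. Ln (rho_t (root1 C')) + Ln (rho_t (root2 C')) = Ln (rho_prod C' / rho_prod C) + k" by (elim exE conjE)
  define F where "F = t_extension b \<Delta> C k (k23 + k14)"
  have ana: "tau_analytic_on U F"
    unfolding F_def by (rule t_extension_analytic[OF b U(1) R nd x rt rp C k(1)])
  have agree: "F C' = G4 C'" if D: "C' \<in> V" "C' \<in> Dom - Gamma_set" for C'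
  proof -
    obtain \<gamma> :: "real \<Rightarrow> 'n config" and z zb chi chib
      where p: "admissible_path \<gamma>" "pathfinish \<gamma> = C'" "continuation \<gamma> z zb chi chib"
      by (rule exists_admissible_path[OF p0(1,3) D(2)])
    have g1: "\<gamma> 1 = C'" using p(2) by (simp add: pathfinish_def)
    have one: "(1::real) \<in> {0..1}" "(1::real) < 1 \<or> \<gamma> 1 \<in> Dom" using D(2) g1 by auto
    have nd': "nondegenerate C'" by (rule nd[OF VD(2)[OF D(1)]])
    obtain w wb where w: "w \<in> S_ext" "wb \<in> S_ext" "chi 1 = w + 2 * of_int (crossings (chi 1)) * of_real pi"
      "chib 1 = wb + 2 * of_int (crossings (chib 1)) * of_real pi" "is_zzbar C' (z_of_chi w) (z_of_chi wb)"
      by (rule path_end_S_ext[OF p(1,3,2) nd'])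
    define n where "n = crossings (chi 1)"
    define m where "m = crossings (chib 1)"
    note w' = w(3)[folded n_def] w(4)[folded m_def]
    have im: "Im (chi 1) > 0" "Im (chib 1) > 0" by (fact continuation_interior[OF p(1,3) one])+
    have "Im w = Im (chi 1)" "Im wb = Im (chib 1)" unfolding w' by simp_all
    then have S: "w \<in> S_strip" "wb \<in> S_strip" using w(1,2) im by (auto simp: S_ext_def S_strip_def)
    \<comment> \<open>The defect is known twice, from this path and as 0 from connectedness, so the
      two crossing numbers are opposite.\<close>
    have "cross_defect (\<gamma> 1) = - (2 * of_int (n + m) * of_real pi * \<i>)"
      by (rule cross_defect_path(1)[OF p(1,3) one S w'])
    then have "2 * complex_of_int (n + m) * of_real pi * \<i> = 0" unfolding g1 cd[OF D(1)] by (metis neg_equal_0_iff_equal)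
    then have "complex_of_int (n + m) = 0"
      unfolding mult_eq_0_iff of_real_eq_0_iff using pi_neq_zero by (elim disjE) simp_all
    then have "n + m = 0" by (rule of_int_eq_0_iff[THEN iffD1])
    then have "m = - n" by linarith
    then have wb': "chib 1 = wb - 2 * of_int n * of_real pi" using w'(2) by simp
    have G4: "G4 C' = g_series b (Phi_ext w) (Phi_ext wb) / exp (of_real \<Delta> * (Ln (xsq 2 3 C') + Ln (xsq 1 4 C')))"
      by (rule t_channel_formula[OF E G p VD(1)[OF D(1)] S w'(1) wb'])
    have \<Theta>: "Ln (rho_prod C' / rho_prod C) + k = \<i> * (Phi_ext w + Phi_ext wb)"
      unfolding sum_Ln_rho_t[OF S w(5)] using k(2) D(1) by simp
    have den: "Ln (xsq 2 3 C' / xsq 2 3 C) + Ln (xsq 1 4 C' / xsq 1 4 C) + (k23 + k14) = Ln (xsq 2 3 C') + Ln (xsq 1 4 C')"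
      using k23 k14 D(1) by simp
    show ?thesis
      unfolding F_def t_extension_def \<Theta> den sym_series_Phi_ext[OF E w(1,2,5)] G4 ..
  qed
  have cF: "continuous_on V F" using ana unfolding tau_analytic_on_def V_def by (meson continuous_on_subset inf_le1)
  have cG: "continuous_on V G4"
  proof -
    have "continuous_on Dom G4" using G unfolding four_point_continuation_def tau_analytic_on_def by blast
    then show ?thesis by (rule continuous_on_subset) (simp add: V_def)
  qed
  \<comment> \<open>\<open>exists_admissible_path\<close> reaches points off
    \<open>Gamma_set\<close>; the others follow by continuity and density.\<close>
  have all: "F C' = G4 C'" if inV: "C' \<in> V" for C'
  proof (rule ccontr)
    assume ne: "F C' \<noteq> G4 C'"
    have o: "open (V \<inter> (\<lambda>C. F C - G4 C) -` (- {0}))"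
      by (rule continuous_open_preimage[OF _ oV]) (auto intro!: continuous_intros cF cG)
    have mem: "C' \<in> V \<inter> (\<lambda>C. F C - G4 C) -` (- {0})" using inV ne by simp
    obtain D where "D \<in> V \<inter> (\<lambda>C. F C - G4 C) -` (- {0})" "D \<in> Dom - Gamma_set"
      by (rule Dom_minus_Gamma_dense[OF o mem VD(1)[OF inV]])
    then show False using agree[of D] by simp
  qed
  show ?thesis
    by (rule that[OF U(1,2) k(1) U(3) nd ana[unfolded F_def]])
       (use all k(2) k23 k14 cd in \<open>auto simp: V_def F_def\<close>)
  qed
qed

section \<open>Evaluation at the Lorentzian configuration\<close>

lemma nonpos_Reals_neg_reals: "z \<in> \<real>\<^sub>\<le>\<^sub>0 \<Longrightarrow> z = 0 \<or> z \<in> neg_reals"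
proof -
  assume "z \<in> \<real>\<^sub>\<le>\<^sub>0"
  then obtain x where x: "z = of_real x" "x \<le> 0" by (auto elim: nonpos_Reals_cases)
  show ?thesis
  proof (cases "x = 0")
    case True then show ?thesis using x by simp
  next
    case False
    then have "x \<in> {..<0}" using x(2) by simp
    then show ?thesis unfolding neg_reals_def x(1) by blast
  qed
qed

lemma Dom_L_nondegenerate:
  assumes "C \<in> Dom_L" "is_zzbar C z zb" "z \<notin> neg_reals" "zb \<notin> neg_reals"
  shows "nondegenerate C"
proof -
  have nz: "xsq i j C \<noteq> 0" if "i \<noteq> j" for i j using assms(1) that by (simp add: Dom_L_def)
  have "cr_u C \<noteq> 0" by (simp add: cr_u_def nz)
  then have "root1 C \<noteq> 0" "root2 C \<noteq> 0" using is_zzbar_roots[of C] by (auto simp: is_zzbar_def)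
  moreover have "root1 C \<notin> neg_reals" "root2 C \<notin> neg_reals"
    using is_zzbar_unique[OF assms(2) is_zzbar_roots] assms(3,4) by (elim disjE conjE; simp)+
  ultimately have "root1 C \<notin> \<real>\<^sub>\<le>\<^sub>0" "root2 C \<notin> \<real>\<^sub>\<le>\<^sub>0" using nonpos_Reals_neg_reals by metis+
  then show ?thesis using nz by (simp add: nondegenerate_def)
qed

text \<open>The ratio tends to 1, so \<kappa> is the limit of the principal logarithm from
  \<open>Dom\<close>, which is the branch that \<open>xpow\<close> prescribes at the
  boundary.\<close>

lemma xpow_boundary:
  fixes C :: "'n::finite config"
  assumes C: "C \<notin> Dom" "C \<in> closure Dom" and U: "open U" "C \<in> U" and nz: "xsq i j C \<noteq> 0" and ij: "i \<noteq> j"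
    and L: "\<And>C'. C' \<in> U \<inter> Dom \<Longrightarrow> Ln (xsq i j C') = Ln (xsq i j C' / xsq i j C) + \<kappa>"
  shows "xpow \<Delta> i j C = exp (of_real \<Delta> * \<kappa>)"
proof -
  have "C islimpt Dom" using C by (simp add: closure_def)
  then have nontriv: "at C within Dom \<noteq> bot" by (simp add: trivial_limit_within)
  have "continuous_on UNIV (\<lambda>C' :: 'n config. xsq i j C')" by (intro continuous_intros)
  then have "((\<lambda>C'. xsq i j C') \<longlongrightarrow> xsq i j C) (at C)" unfolding continuous_on_def by (metis UNIV_I)
  then have "((\<lambda>C'. xsq i j C') \<longlongrightarrow> xsq i j C) (at C within Dom)" by (rule tendsto_within_subset) simp
  then have "((\<lambda>C'. xsq i j C' / xsq i j C) \<longlongrightarrow> xsq i j C / xsq i j C) (at C within Dom)"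
    using nz by (intro tendsto_intros)
  then have q: "((\<lambda>C'. xsq i j C' / xsq i j C) \<longlongrightarrow> 1) (at C within Dom)" using nz by simp
  have "((\<lambda>C'. exp (of_real \<Delta> * (Ln (xsq i j C' / xsq i j C) + \<kappa>))) \<longlongrightarrow> exp (of_real \<Delta> * (Ln 1 + \<kappa>))) (at C within Dom)"
    by (intro tendsto_intros tendsto_Ln q) simp
  then have t: "((\<lambda>C'. exp (of_real \<Delta> * (Ln (xsq i j C' / xsq i j C) + \<kappa>))) \<longlongrightarrow> exp (of_real \<Delta> * \<kappa>)) (at C within Dom)"
    by simp
  have ev: "eventually (\<lambda>C'. exp (of_real \<Delta> * (Ln (xsq i j C' / xsq i j C) + \<kappa>)) = xsq i j C' powr of_real \<Delta>) (at C within Dom)"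
    unfolding eventually_at_topological
  proof (intro exI[of _ U] conjI U ballI impI)
    fix C' assume C': "C' \<in> U" "C' \<noteq> C" "C' \<in> Dom"
    then have "xsq i j C' \<noteq> 0" using xsq_Dom_nonzero ij by blast
    then have "xsq i j C' powr of_real \<Delta> = exp (of_real \<Delta> * Ln (xsq i j C'))" by (simp add: powr_def)
    also have "Ln (xsq i j C') = Ln (xsq i j C' / xsq i j C) + \<kappa>" by (rule L) (use C' in simp)
    finally show "exp (of_real \<Delta> * (Ln (xsq i j C' / xsq i j C) + \<kappa>)) = xsq i j C' powr of_real \<Delta>" ..
  qed
  have "((\<lambda>C'. xsq i j C' powr of_real \<Delta>) \<longlongrightarrow> exp (of_real \<Delta> * \<kappa>)) (at C within Dom)"
    by (rule Lim_transform_eventually[OF t ev])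
  then have "Lim (at C within Dom) (\<lambda>C'. xsq i j C' powr of_real \<Delta>) = exp (of_real \<Delta> * \<kappa>)"
    by (rule tendsto_Lim[OF nontriv])
  then show ?thesis using C(1) by (simp add: xpow_def)
qed

lemma lorentzian_value_extension:
  fixes C :: "'n::finite config"
  assumes C: "C \<in> Dom_L" and U: "open U" "C \<in> U" and F: "continuous_on U F"
    and eq: "\<And>C'. C' \<in> U \<inter> Dom \<Longrightarrow> F C' = G4 C'"
  shows "lorentzian_value G4 C (F C)"
proof -
  define S where "S = {\<epsilon> :: real^4. \<epsilon> $ 1 > \<epsilon> $ 2 \<and> \<epsilon> $ 2 > \<epsilon> $ 3 \<and> \<epsilon> $ 3 > \<epsilon> $ 4}"
  define f where "f \<epsilon> = ((\<chi> k. complex_of_real (\<epsilon> $ k) + fst C $ k), snd C)" for \<epsilon> :: "real^4"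
  have f0: "f 0 = C" by (simp add: f_def prod_eq_iff vec_eq_iff)
  have "continuous_on UNIV f" unfolding f_def by (intro continuous_intros)
  then have "(f \<longlongrightarrow> f 0) (at 0)" unfolding continuous_on_def by (metis UNIV_I)
  then have t: "(f \<longlongrightarrow> C) (at 0 within S)" unfolding f0 by (rule tendsto_within_subset) simp
  have "isCont F C" using F[unfolded continuous_on_eq_continuous_at[OF U(1)]] U(2) by (rule bspec)
  then have tF: "((\<lambda>\<epsilon>. F (f \<epsilon>)) \<longlongrightarrow> F C) (at 0 within S)" using t by (rule isCont_tendsto_compose)
  have evU: "eventually (\<lambda>\<epsilon>. f \<epsilon> \<in> U) (at 0 within S)" by (rule topological_tendstoD[OF t U])
  have evS: "eventually (\<lambda>\<epsilon>. \<epsilon> \<in> S) (at 0 within S)" by (simp add: eventually_at_filter)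
  have Re0: "Re (fst C $ k) = 0" for k using C by (simp add: Dom_L_def)
  have ev: "eventually (\<lambda>\<epsilon>. F (f \<epsilon>) = G4 (f \<epsilon>)) (at 0 within S)"
    using evU evS
  proof eventually_elim
    case (elim \<epsilon>)
    have "f \<epsilon> \<in> Dom" using elim(2) by (simp add: f_def Dom_def S_def Re0)
    with elim(1) show ?case by (intro eq) simp
  qed
  have "((\<lambda>\<epsilon>. G4 (f \<epsilon>)) \<longlongrightarrow> F C) (at 0 within S)" by (rule Lim_transform_eventually[OF tF ev])
  then show ?thesis unfolding lorentzian_value_def f_def S_def .
qed

text \<open>A logarithm of \<open>rho_prod C\<close> is fixed only up to 2 pi i, and the principal
  logarithm of \<open>rho_t\<close> jumps where z lies in (1,oo), since \<open>rho_t\<close> is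
  negative there. The value of k is therefore found as a limit along the given path, where
  \<open>Phi_ext\<close> stays continuous up to the end.\<close>

lemma t_extension_value:
  fixes GE :: "'n::finite config \<Rightarrow> complex" and C :: "'n config"
  assumes E: "euclidean_four_point \<Delta> GE g c b" and U: "open U" "C \<in> U" "\<And>C'. C' \<in> U \<Longrightarrow> nondegenerate C'"
    and \<Theta>: "\<And>C'. C' \<in> U \<inter> Dom \<Longrightarrow> Ln (rho_t (root1 C')) + Ln (rho_t (root2 C')) = Ln (rho_prod C' / rho_prod C) + k"
    and path: "admissible_path \<gamma>" "pathfinish \<gamma> = C" "continuation \<gamma> z zb chi chib"
    and w: "w \<in> S_ext" "wb \<in> S_ext" "is_zzbar C (z_of_chi w) (z_of_chi wb)"
    "chi 1 = w + 2 * of_int n * of_real pi" "chib 1 = wb + 2 * of_int m * of_real pi"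
  shows "t_extension b \<Delta> C k l C = g_series b (Phi_ext w) (Phi_ext wb) / exp (of_real \<Delta> * l)"
proof -
  have nd: "nondegenerate C" by (rule U(3)[OF U(2)])
  note rp0 = nondegenerate_neq_1(4)[OF nd]
  define F where "F = at 1 within {0..<1::real}"
  define w' where "w' s = chi s - 2 * of_int n * of_real pi" for s
  define wb' where "wb' s = chib s - 2 * of_int m * of_real pi" for s
  have c: "continuous_on {0..1} chi" "continuous_on {0..1} chib" using path(3) unfolding continuation_def by blast+
  have int: "Im (chi s) > 0" "Im (chib s) > 0" if "s \<in> {0..<1}" for s
    by (rule continuation_before_end(2,3)[OF path(1,3) that])+
  have tw: "(w' \<longlongrightarrow> w) F" "(wb' \<longlongrightarrow> wb) F"
    unfolding w'_def wb'_def F_def by (rule eventually_S_strip(1)[OF c(1) int(1) w(1,4)], assumption)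
      (rule eventually_S_strip(1)[OF c(2) int(2) w(2,5)])
  have "((\<lambda>s. \<i> * (Phi_ext (w' s) + Phi_ext (wb' s))) \<longlongrightarrow> \<i> * (Phi_ext w + Phi_ext wb)) F"
    by (intro tendsto_intros isCont_tendsto_compose[OF isCont_Phi_ext[OF w(1)]]
        isCont_tendsto_compose[OF isCont_Phi_ext[OF w(2)]] tw)
  moreover have "eventually (\<lambda>s. \<i> * (Phi_ext (w' s) + Phi_ext (wb' s)) = Ln (rho_prod (\<gamma> s) / rho_prod C) + k) F"
    using path_approach(2)[OF path U(1,2) w(1,2,4,5)] unfolding F_def
  proof eventually_elim
    case (elim s)
    then have s: "s \<in> {0..1}" "s < 1" and inU: "\<gamma> s \<in> U \<inter> Dom" and S: "w' s \<in> S_strip" "wb' s \<in> S_strip"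
      by (auto simp: w'_def wb'_def)
    have "is_zzbar (\<gamma> s) (z_of_chi (w' s)) (z_of_chi (wb' s))"
      by (rule cross_defect_path(2)[OF path(1,3) s(1) disjI1[OF s(2)] S, of n m]) (simp_all add: w'_def wb'_def)
    from sum_Ln_rho_t[OF S this] show ?case unfolding \<Theta>[OF inU] .
  qed
  ultimately have lim: "((\<lambda>s. Ln (rho_prod (\<gamma> s) / rho_prod C) + k) \<longlongrightarrow> \<i> * (Phi_ext w + Phi_ext wb)) F"
    by (rule Lim_transform_eventually)
  have t\<gamma>: "(\<gamma> \<longlongrightarrow> C) F" unfolding F_def by (rule path_approach(1)[OF path U(1,2) w(1,2,4,5)])
  have "continuous_on U rho_prod" by (rule continuous_on_sqrt_rho(4)[OF U(3)])
  then have "isCont rho_prod C" using U(2) unfolding continuous_on_eq_continuous_at[OF U(1)] by (rule bspec)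
  then have "((\<lambda>s. rho_prod (\<gamma> s)) \<longlongrightarrow> rho_prod C) F" using t\<gamma> by (rule isCont_tendsto_compose)
  then have "((\<lambda>s. rho_prod (\<gamma> s) / rho_prod C) \<longlongrightarrow> rho_prod C / rho_prod C) F"
    using rp0 by (intro tendsto_intros)
  then have q: "((\<lambda>s. rho_prod (\<gamma> s) / rho_prod C) \<longlongrightarrow> 1) F" using rp0 by simp
  have "((\<lambda>s. Ln (rho_prod (\<gamma> s) / rho_prod C) + k) \<longlongrightarrow> Ln 1 + k) F"
    by (intro tendsto_intros tendsto_Ln q) simp
  then have "Ln 1 + k = \<i> * (Phi_ext w + Phi_ext wb)"
    using lim at_1_within_nontrivial unfolding F_def by (intro tendsto_unique)
  then have k: "Ln (rho_prod C / rho_prod C) + k = \<i> * (Phi_ext w + Phi_ext wb)" using rp0 by simp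
  have x: "xsq 2 3 C / xsq 2 3 C = 1" "xsq 1 4 C / xsq 1 4 C = 1"
    using nd by (simp_all add: nondegenerate_def)
  show ?thesis
    unfolding t_extension_def k sym_series_Phi_ext[OF E w(1-3)] x by simp
qed

theorem theorem4p4:
  fixes GE G4 :: "'n::finite config \<Rightarrow> complex"
    and g :: "complex \<Rightarrow> complex \<Rightarrow> complex"
    and c :: "real \<Rightarrow> nat \<Rightarrow> real"
    and b :: "real \<Rightarrow> real \<Rightarrow> real"
    and \<Delta> :: real
    and C :: "'n config"
    and z\<^sub>L zb\<^sub>L :: complex
  assumes "euclidean_four_point \<Delta> GE g c b"
    and "four_point_continuation \<Delta> GE b G4"
    and "C \<in> Dom_L"
    and "is_zzbar C z\<^sub>L zb\<^sub>L" and "z\<^sub>L \<notin> neg_reals" and "zb\<^sub>L \<notin> neg_reals"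
    and "N_t_equals C 0"
  shows "analytic_at_config G4 C \<and>
    (\<forall>\<gamma> z zb chi chib.
       admissible_path \<gamma> \<and> pathfinish \<gamma> = C \<and> continuation \<gamma> z zb chi chib \<longrightarrow>
       g_term b (chi_t (chi 1)) (chib_t (chi 1) (chib 1)) summable_on ({0..} \<times> {0..}) \<and>
       lorentzian_value G4 C
         (g_series b (chi_t (chi 1)) (chib_t (chi 1) (chib 1)) / (xpow \<Delta> 2 3 C * xpow \<Delta> 1 4 C)))"
proof -
  note E = assms(1) and CL = assms(3)
  have b: "ope_coeff b" by (rule euclidean_ope_coeff[OF E])
  have nd: "nondegenerate C" by (rule Dom_L_nondegenerate[OF assms(3-6)])
  have nz: "xsq 2 3 C \<noteq> 0" "xsq 1 4 C \<noteq> 0" using nd by (simp_all add: nondegenerate_def)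
  have CD: "C \<notin> Dom" using CL by (simp add: Dom_L_def Dom_def)
  show ?thesis
  proof (rule local_extension[OF E assms(2) nd assms(7)])
    fix U k k23 k14
    assume U: "open U" "C \<in> U" and ndU: "\<And>C'. C' \<in> U \<Longrightarrow> nondegenerate C'"
      and ana: "tau_analytic_on U (t_extension b \<Delta> C k (k23 + k14))"
      and eq: "\<And>C'. C' \<in> U \<inter> Dom \<Longrightarrow> t_extension b \<Delta> C k (k23 + k14) C' = G4 C'"
      and \<Theta>: "\<And>C'. C' \<in> U \<inter> Dom \<Longrightarrow> Ln (rho_t (root1 C')) + Ln (rho_t (root2 C')) = Ln (rho_prod C' / rho_prod C) + k"
      and L23: "\<And>C'. C' \<in> U \<inter> Dom \<Longrightarrow> Ln (xsq 2 3 C') = Ln (xsq 2 3 C' / xsq 2 3 C) + k23"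
      and L14: "\<And>C'. C' \<in> U \<inter> Dom \<Longrightarrow> Ln (xsq 1 4 C') = Ln (xsq 1 4 C' / xsq 1 4 C) + k14"
      and defect: "\<And>C'. C' \<in> U \<inter> Dom \<Longrightarrow> cross_defect C' = 0"
    define F where "F = t_extension b \<Delta> C k (k23 + k14)"
    have contF: "continuous_on U F" using ana unfolding F_def tau_analytic_on_def by (rule conjunct1)
    have analytic: "analytic_at_config G4 C"
      unfolding analytic_at_config_def
      by (intro exI[of _ U] exI[of _ F] conjI U ballI ana[folded F_def] eq[folded F_def])
    have main: "g_term b (chi_t (chi 1)) (chib_t (chi 1) (chib 1)) summable_on ({0..} \<times> {0..}) \<and>
       lorentzian_value G4 C
         (g_series b (chi_t (chi 1)) (chib_t (chi 1) (chib 1)) / (xpow \<Delta> 2 3 C * xpow \<Delta> 1 4 C))"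
      if p: "admissible_path \<gamma>" "pathfinish \<gamma> = C" "continuation \<gamma> z zb chi chib" for \<gamma> z zb chi chib
    proof -
      define n where "n = crossings (chi 1)"
      define m where "m = crossings (chib 1)"
      obtain w wb where w: "w \<in> S_ext" "wb \<in> S_ext" "chi 1 = w + 2 * of_int n * of_real pi"
        "chib 1 = wb + 2 * of_int m * of_real pi" "is_zzbar C (z_of_chi w) (z_of_chi wb)"
        unfolding n_def m_def by (rule path_end_S_ext[OF p(1,3,2) nd])
      \<comment> \<open>An arbitrary path to \<open>C\<close> passes through points of
        \<open>Dom\<close> near \<open>C\<close>, where the defect is 0; hence its own crossing
        numbers are opposite too.\<close>
      obtain C' where C': "C' \<in> U \<inter> Dom" "cross_defect C' = - (2 * of_int (n + m) * of_real pi * \<i>)"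
        unfolding n_def m_def by (rule cross_defect_near_end[OF p U nd])
      have "2 * complex_of_int (n + m) * of_real pi * \<i> = 0"
        using C'(2) unfolding defect[OF C'(1)] by (metis neg_equal_0_iff_equal)
      then have "complex_of_int (n + m) = 0"
        unfolding mult_eq_0_iff of_real_eq_0_iff using pi_neq_zero by (elim disjE) simp_all
      then have "n + m = 0" by (rule of_int_eq_0_iff[THEN iffD1])
      then have mn: "m = - n" by linarith
      \<comment> \<open>Since m = - n, the shift by the crossing number of chi with opposite sign
        removes that of chib.\<close>
      have t: "chi_t (chi 1) = Phi_ext w" "chib_t (chi 1) (chib 1) = Phi_ext wb"
        unfolding chi_t_def chib_t_def n_def[symmetric] using w(3,4) Phi_eq[OF w(1)] Phi_eq[OF w(2)] by (simp_all add: mn)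
      have "F C = g_series b (Phi_ext w) (Phi_ext wb) / exp (of_real \<Delta> * (k23 + k14))"
        unfolding F_def by (rule t_extension_value[OF E U ndU \<Theta> p w(1,2,5,3,4)])
      moreover have "C \<in> closure Dom"
        using p(1,2) unfolding admissible_path_def pathfinish_def path_image_def by (metis atLeastAtMost_iff imageI order_refl subsetD zero_le_one)
      then have "xpow \<Delta> 2 3 C = exp (of_real \<Delta> * k23)" "xpow \<Delta> 1 4 C = exp (of_real \<Delta> * k14)"
        using xpow_boundary[OF CD _ U nz(1) _ L23] xpow_boundary[OF CD _ U nz(2) _ L14] by simp_all
      ultimately have "F C = g_series b (Phi_ext w) (Phi_ext wb) / (xpow \<Delta> 2 3 C * xpow \<Delta> 1 4 C)"
        by (simp add: distrib_left exp_add)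
      moreover have "lorentzian_value G4 C (F C)"
        by (rule lorentzian_value_extension[OF CL U contF]) (rule eq[folded F_def])
      ultimately show ?thesis
        unfolding t using g_term_summable[OF b Im_Phi_ext_pos[OF w(1)] Im_Phi_ext_pos[OF w(2)]] by simp
    qed
    show ?thesis by (rule conjI[OF analytic], intro allI impI, elim conjE, rule main)
  qed
qed

end
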